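(* The data-to-solution map $u_0\mapsto\mathcal{S}_t(u_0)$ of the Fornberg-Whitham Cauchy problem $$u_t+\tfrac32 u u_x=\partial_xG*u,\qquad u(0,x)=u_0(x),\qquad x\in\mathbb{R},$$ is not uniformly continuous on bounded subsets of $B^1_{\infty,1}(\mathbb{R})$ as a map into $\mathcal{C}([0,T];B^1_{\infty,1}(\mathbb{R}))$. More precisely, there exist two sequences of initial data $(f_n)$ and $(g_n)$ in $B^1_{\infty,1}(\mathbb{R})$ such that $$\sup_n\|f_n\|_{B^1_{\infty,1}}<\infty,\qquad \lim_{n\to\infty}\|g_n\|_{B^1_{\infty,1}}=0,$$ and such that, with $T>0$ a common existence time for the solutions with data $f_n$ and $f_n+g_n$, there exist a time $T_0\in(0,T]$ and a constant $c>0$ with $$\liminf_{n\to\infty}\|\mathcal{S}_t(f_n+g_n)-\mathcal{S}_t(f_n)\|_{B^1_{\infty,1}}\ge c\,t\qquad\text{for all } t\in[0,T_0].$$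
   Context: $G(x)=\frac12 e^{-|x|}$ for $x\in\mathbb{R}$, so $\partial_xG*u=\partial_x(1-\partial_{xx})^{-1}u$. Littlewood-Paley blocks: fix radial $\chi\in C_c^\infty(\{|\xi|\le 4/3\})$ and $\varphi\in C_c^\infty(\{3/4\le|\xi|\le 8/3\})$ with values in $[0,1]$ and $\chi(\xi)+\sum_{j\ge0}\varphi(2^{-j}\xi)=1$ for all $\xi\in\mathbb{R}$. For a tempered distribution $u$ on $\mathbb{R}$, let $\Delta_ju=0$ for $j\le-2$, $\Delta_{-1}u=\mathcal{F}^{-1}(\chi\mathcal{F}u)$, and $\Delta_ju=\mathcal{F}^{-1}(\varphi(2^{-j}\cdot)\mathcal{F}u)$ for $j\ge0$. For $s\in\mathbb{R}$, $B^s_{\infty,1}(\mathbb{R})$ is the space of tempered distributions $f$ with $\|f\|_{B^s_{\infty,1}}=\sum_{j\ge-1}2^{js}\|\Delta_jf\|_{L^\infty}<\infty$. Data-to-solution map: the problem is locally well-posed in $B^1_{\infty,1}(\mathbb{R})$, i.e. for every bounded subset $U\subset B^1_{\infty,1}(\mathbb{R})$ there is $T>0$ such that each $u_0\in U$ has a unique solution in $\mathcal{C}([0,T];B^1_{\infty,1}(\mathbb{R}))\cap\mathcal{C}^1([0,T];B^0_{\infty,1}(\mathbb{R}))$; its value at time $t$ is denoted $\mathcal{S}_t(u_0)$. *)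

theory Defs
  imports
    "HOL-Analysis.Analysis"
    "HOL-Probability.Essential_Supremum"
    "HOL-Library.Function_Algebras"
begin

section \<open>Smooth functions and Schwartz functions on the real line\<close>

definition ddx :: "(real \<Rightarrow> 'a::real_normed_vector) \<Rightarrow> real \<Rightarrow> 'a" where
  "ddx f = (\<lambda>x. vector_derivative f (at x))"

definition smooth :: "(real \<Rightarrow> 'a::real_normed_vector) \<Rightarrow> bool" where
  "smooth f \<longleftrightarrow> (\<forall>k x. (ddx ^^ k) f differentiable (at x))"

definition schwartz :: "(real \<Rightarrow> complex) set" where
  "schwartz = {\<psi>. smooth \<psi> \<and>
     (\<forall>k m. bounded (range (\<lambda>x. x ^ k *\<^sub>R (ddx ^^ m) \<psi> x)))}"

definition schwartz_seminorm :: "nat \<Rightarrow> nat \<Rightarrow> (real \<Rightarrow> complex) \<Rightarrow> real" where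
  "schwartz_seminorm k m \<psi> = (SUP x. norm (x ^ k *\<^sub>R (ddx ^^ m) \<psi> x))"

definition fourier :: "(real \<Rightarrow> complex) \<Rightarrow> real \<Rightarrow> complex" where
  "fourier \<psi> \<xi> = (LINT x|lborel. cis (- (x * \<xi>)) * \<psi> x)"

definition inv_fourier :: "(real \<Rightarrow> complex) \<Rightarrow> real \<Rightarrow> complex" where
  "inv_fourier \<psi> x = (LINT \<xi>|lborel. cis (x * \<xi>) * \<psi> \<xi>) / (2 * of_real pi)"


section \<open>Tempered distributions\<close>

text \<open>A tempered distribution is a functional on Schwartz functions. HOL functions are total, so
  every distribution is required to vanish off the Schwartz space; this makes equality of
  distributions the equality of HOL functions. Sums and differences of distributions are the
  pointwise ones.\<close>

type_synonym distr = "(real \<Rightarrow> complex) \<Rightarrow> complex"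

definition mk_distr :: "distr \<Rightarrow> distr" where
  "mk_distr F = (\<lambda>\<psi>. if \<psi> \<in> schwartz then F \<psi> else 0)"

definition tempered :: "distr set" where
  "tempered = {u.
     (\<forall>\<psi>. \<psi> \<notin> schwartz \<longrightarrow> u \<psi> = 0) \<and>
     (\<forall>\<psi>\<in>schwartz. \<forall>\<eta>\<in>schwartz. u (\<lambda>x. \<psi> x + \<eta> x) = u \<psi> + u \<eta>) \<and>
     (\<forall>\<psi>\<in>schwartz. \<forall>c. u (\<lambda>x. c * \<psi> x) = c * u \<psi>) \<and>
     (\<exists>C N. \<forall>\<psi>\<in>schwartz.
        norm (u \<psi>) \<le> C * (\<Sum>k\<le>N. \<Sum>m\<le>N. schwartz_seminorm k m \<psi>))}"

definition real_valued :: "distr \<Rightarrow> bool" where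
  "real_valued u \<longleftrightarrow> (\<forall>\<psi>\<in>schwartz. range \<psi> \<subseteq> \<real> \<longrightarrow> u \<psi> \<in> \<real>)"

definition scale_distr :: "real \<Rightarrow> distr \<Rightarrow> distr" where
  "scale_distr c u = (\<lambda>\<psi>. of_real c * u \<psi>)"

definition dx_distr :: "distr \<Rightarrow> distr" where
  "dx_distr u = mk_distr (\<lambda>\<psi>. - u (ddx \<psi>))"

definition fourier_distr :: "distr \<Rightarrow> distr" where
  "fourier_distr u = mk_distr (\<lambda>\<psi>. u (fourier \<psi>))"

definition inv_fourier_distr :: "distr \<Rightarrow> distr" where
  "inv_fourier_distr u = mk_distr (\<lambda>\<psi>. u (inv_fourier \<psi>))"

definition mult_distr :: "(real \<Rightarrow> real) \<Rightarrow> distr \<Rightarrow> distr" where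
  "mult_distr a u = mk_distr (\<lambda>\<psi>. u (\<lambda>\<xi>. of_real (a \<xi>) * \<psi> \<xi>))"

text \<open>Convolution with an integrable kernel \<open>K\<close>, by duality with the reflected kernel:
  \<open>\<langle>K * u, \<psi>\<rangle> = \<langle>u, K(- \<cdot>) * \<psi>\<rangle>\<close>.\<close>

definition conv_distr :: "(real \<Rightarrow> real) \<Rightarrow> distr \<Rightarrow> distr" where
  "conv_distr K u = mk_distr (\<lambda>\<psi>. u (\<lambda>y. LINT x|lborel. of_real (K (x - y)) * \<psi> x))"

definition regular_distr :: "(real \<Rightarrow> complex) \<Rightarrow> distr" where
  "regular_distr g = mk_distr (\<lambda>\<psi>. LINT x|lborel. g x * \<psi> x)"

definition Linf_norm_fun :: "(real \<Rightarrow> complex) \<Rightarrow> ennreal" where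
  "Linf_norm_fun g = esssup lborel (\<lambda>x. ennreal (norm (g x)))"

definition represents :: "(real \<Rightarrow> complex) \<Rightarrow> distr \<Rightarrow> bool" where
  "represents g u \<longleftrightarrow>
     g \<in> borel_measurable lborel \<and> Linf_norm_fun g < \<infinity> \<and> u = regular_distr g"

text \<open>The norm is infinite for distributions that are not given by an essentially bounded function;
  a representing function is unique up to null sets, so at most one value enters the infimum.\<close>

definition Linf_norm :: "distr \<Rightarrow> ennreal" where
  "Linf_norm u = (INF g\<in>{g. represents g u}. Linf_norm_fun g)"

text \<open>Pointwise product of two distributions given by essentially bounded functions, which is the
  only case in which it is used.\<close>

definition prod_distr :: "distr \<Rightarrow> distr \<Rightarrow> distr" where
  "prod_distr u v =
     regular_distr (\<lambda>x. (SOME g. represents g u) x * (SOME h. represents h v) x)"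


section \<open>Littlewood--Paley blocks and Besov spaces\<close>

definition littlewood_paley :: "(real \<Rightarrow> real) \<Rightarrow> (real \<Rightarrow> real) \<Rightarrow> bool" where
  "littlewood_paley chi phi \<longleftrightarrow>
     smooth chi \<and> smooth phi \<and>
     (\<forall>\<xi>. chi (- \<xi>) = chi \<xi>) \<and> (\<forall>\<xi>. phi (- \<xi>) = phi \<xi>) \<and>
     (\<forall>\<xi>. chi \<xi> \<in> {0..1}) \<and> (\<forall>\<xi>. phi \<xi> \<in> {0..1}) \<and>
     closure {\<xi>. chi \<xi> \<noteq> 0} \<subseteq> {\<xi>. \<bar>\<xi>\<bar> \<le> 4 / 3} \<and>
     closure {\<xi>. phi \<xi> \<noteq> 0} \<subseteq> {\<xi>. 3 / 4 \<le> \<bar>\<xi>\<bar> \<and> \<bar>\<xi>\<bar> \<le> 8 / 3} \<and>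
     (\<forall>\<xi>. chi \<xi> + (\<Sum>j. phi (\<xi> / 2 ^ j)) = 1)"

definition lp_block :: "(real \<Rightarrow> real) \<Rightarrow> (real \<Rightarrow> real) \<Rightarrow> int \<Rightarrow> distr \<Rightarrow> distr" where
  "lp_block chi phi j u =
     (if j \<le> -2 then 0
      else if j = -1 then inv_fourier_distr (mult_distr chi (fourier_distr u))
      else inv_fourier_distr (mult_distr (\<lambda>\<xi>. phi (2 powr (- of_int j) * \<xi>)) (fourier_distr u)))"

text \<open>The summation index \<open>j = k - 1\<close> runs over \<open>-1, 0, 1, \<dots>\<close>.\<close>

definition besov_norm ::
    "(real \<Rightarrow> real) \<Rightarrow> (real \<Rightarrow> real) \<Rightarrow> real \<Rightarrow> distr \<Rightarrow> ennreal" where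
  "besov_norm chi phi s u =
     (\<Sum>k. ennreal (2 powr ((real k - 1) * s)) * Linf_norm (lp_block chi phi (int k - 1) u))"

text \<open>The equation is posed for real-valued unknowns, so the space consists of real-valued
  distributions.\<close>

definition besov :: "(real \<Rightarrow> real) \<Rightarrow> (real \<Rightarrow> real) \<Rightarrow> real \<Rightarrow> distr set" where
  "besov chi phi s = {u \<in> tempered. real_valued u \<and> besov_norm chi phi s u < \<infinity>}"

definition besov_bounded :: "(real \<Rightarrow> real) \<Rightarrow> (real \<Rightarrow> real) \<Rightarrow> real \<Rightarrow> distr set \<Rightarrow> bool" where
  "besov_bounded chi phi s U \<longleftrightarrow>
     U \<subseteq> besov chi phi s \<and> (SUP u\<in>U. besov_norm chi phi s u) < \<infinity>"


section \<open>The Fornberg--Whitham Cauchy problem\<close>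

definition C_besov ::
    "(real \<Rightarrow> real) \<Rightarrow> (real \<Rightarrow> real) \<Rightarrow> real \<Rightarrow> real \<Rightarrow> (real \<Rightarrow> distr) set" where
  "C_besov chi phi s T = {u. \<forall>t\<in>{0..T}. u t \<in> besov chi phi s \<and>
     ((\<lambda>\<tau>. besov_norm chi phi s (u \<tau> - u t)) \<longlongrightarrow> 0) (at t within {0..T})}"

definition has_besov_time_derivative ::
    "(real \<Rightarrow> real) \<Rightarrow> (real \<Rightarrow> real) \<Rightarrow> real \<Rightarrow> real \<Rightarrow> (real \<Rightarrow> distr) \<Rightarrow> (real \<Rightarrow> distr) \<Rightarrow> bool"
  where
  "has_besov_time_derivative chi phi s T u v \<longleftrightarrow> (\<forall>t\<in>{0..T}.
     ((\<lambda>\<tau>. besov_norm chi phi s (scale_distr (1 / (\<tau> - t)) (u \<tau> - u t) - v t)) \<longlongrightarrow> 0)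
       (at t within {0..T}))"

definition fw_kernel :: "real \<Rightarrow> real" where
  "fw_kernel x = exp (- \<bar>x\<bar>) / 2"

text \<open>\<open>u\<close> solves the problem on \<open>[0,T]\<close> and belongs to
  \<open>C([0,T]; B\<^sup>1) \<inter> C\<^sup>1([0,T]; B\<^sup>0)\<close>; \<open>v\<close> is its time derivative.\<close>

definition fw_solution ::
    "(real \<Rightarrow> real) \<Rightarrow> (real \<Rightarrow> real) \<Rightarrow> real \<Rightarrow> distr \<Rightarrow> (real \<Rightarrow> distr) \<Rightarrow> bool" where
  "fw_solution chi phi T u0 u \<longleftrightarrow>
     u \<in> C_besov chi phi 1 T \<and> u \<in> C_besov chi phi 0 T \<and> u 0 = u0 \<and>
     (\<exists>v \<in> C_besov chi phi 0 T.
        has_besov_time_derivative chi phi 0 T u v \<and>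
        (\<forall>t\<in>{0..T}.
           v t + scale_distr (3 / 2) (prod_distr (u t) (dx_distr (u t)))
             = dx_distr (conv_distr fw_kernel (u t))))"

text \<open>Solutions are identified when they agree on \<open>[0,T]\<close>; their values elsewhere are irrelevant.\<close>

definition fw_existence_time ::
    "(real \<Rightarrow> real) \<Rightarrow> (real \<Rightarrow> real) \<Rightarrow> real \<Rightarrow> distr set \<Rightarrow> bool" where
  "fw_existence_time chi phi T U \<longleftrightarrow> T > 0 \<and>
     (\<forall>u0\<in>U. \<exists>u. fw_solution chi phi T u0 u \<and>
        (\<forall>w. fw_solution chi phi T u0 w \<longrightarrow> (\<forall>t\<in>{0..T}. w t = u t)))"

definition fw_locally_well_posed :: "(real \<Rightarrow> real) \<Rightarrow> (real \<Rightarrow> real) \<Rightarrow> bool" where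
  "fw_locally_well_posed chi phi \<longleftrightarrow>
     (\<forall>U. besov_bounded chi phi 1 U \<longrightarrow> (\<exists>T. fw_existence_time chi phi T U))"

text \<open>\<open>fw_flow chi phi T t u0\<close> is the value at time \<open>t \<in> [0,T]\<close> of the unique solution on \<open>[0,T]\<close>
  with initial value \<open>u0\<close>.\<close>

definition fw_flow ::
    "(real \<Rightarrow> real) \<Rightarrow> (real \<Rightarrow> real) \<Rightarrow> real \<Rightarrow> real \<Rightarrow> distr \<Rightarrow> distr" where
  "fw_flow chi phi T t u0 = (THE y. \<exists>u. fw_solution chi phi T u0 u \<and> u t = y)"

definition fw_flow_uniformly_continuous_on ::
    "(real \<Rightarrow> real) \<Rightarrow> (real \<Rightarrow> real) \<Rightarrow> real \<Rightarrow> distr set \<Rightarrow> bool" where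
  "fw_flow_uniformly_continuous_on chi phi T U \<longleftrightarrow>
     (\<forall>\<epsilon>>0. \<exists>\<delta>>0. \<forall>u\<in>U. \<forall>w\<in>U.
        besov_norm chi phi 1 (u - w) < ennreal \<delta> \<longrightarrow>
        (SUP t\<in>{0..T}. besov_norm chi phi 1 (fw_flow chi phi T t u - fw_flow chi phi T t w))
          < ennreal \<epsilon>)"

end

theory Submission
  imports Defs "HOL-Probability.Probability"
begin

text \<open>
  Constants belong to \<open>B\<^sup>1\<close>, so one may take \<open>f n = cos (k x) / k\<close> with \<open>k = 2 ^ n\<close> and let \<open>g n\<close> be the constant \<open>1 / k\<close>.
  The constant changes the transport speed by \<open>3 / (2 k)\<close>, which over a time \<open>t\<close> shifts the oscillation by a
  phase of order \<open>t\<close> and hence changes its slope by an amount of order \<open>t\<close>.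

  Only \<open>B\<^sup>0 \<subseteq> L\<^sup>\<infinity>\<close> and \<open>B\<^sup>1 \<subseteq> W\<^bsup>1,\<infinity>\<^esup>\<close> are needed to make this rigorous: a solution is a classical
  \<open>C\<^sup>1\<close> function, doubling of variables bounds its slope by \<open>2\<close> up to a time independent of \<open>k\<close>, and therefore
  both solutions stay within \<open>O (t / k)\<close> of their data. Integrating the difference \<open>z\<close> of the two solutions over two adjacent half
  periods and using the equation in conservation form gives
  \<open>\<integral>\<^sub>0\<^bsup>\<pi>/k\<^esup> (z x - z (x + \<pi>/k)) dx \<ge> 3 t / k\<^sup>2\<close>, so \<open>z\<close> has slope at least \<open>3 t / \<pi>\<^sup>2\<close> somewhere.\<close>

section \<open>Rapidly decreasing and Schwartz functions\<close>

text \<open>The assumed well-posedness supplies existence and uniqueness but no estimate, so every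
  quantitative fact about the solutions has to come from the equation itself. Solutions are given
  only as distributions with convergence in Besov norms; once the embeddings have made them
  functions, no Besov norm occurs until the final lower bound, where it dominates a Lipschitz
  constant. The slope of the difference is not followed in time, because its evolution involves
  second derivatives, which a B^1 solution need not have. In flux form only the values of the
  solutions at three points enter, and these are known up to the drift from the data. Origin of the
  3: initially the difference of the squares is \<open>(2 * cos (k * x) + 1) / k\<^sup>2\<close>,
  with second difference \<open>8 / k\<^sup>2\<close> over half periods. The flux factor 3/4 makes
  this \<open>6 / k\<^sup>2\<close>, half of which is given up to the errors, and dividing by the
  squared half period leaves \<open>3 / pi\<^sup>2\<close>.\<close>

definition rapid :: "(real \<Rightarrow> 'a::real_normed_vector) \<Rightarrow> bool" where
  "rapid f \<longleftrightarrow> (\<forall>k. bounded (range (\<lambda>x. x ^ k *\<^sub>R f x)))"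

lemma rapidD: "rapid f \<Longrightarrow> \<exists>C. \<forall>x. \<bar>x\<bar> ^ k * norm (f x) \<le> C"
  unfolding rapid_def bounded_iff by (simp add: power_abs)

lemma rapidI: "(\<And>k. \<exists>C. \<forall>x. \<bar>x\<bar> ^ k * norm (f x) \<le> C) \<Longrightarrow> rapid f"
  unfolding rapid_def bounded_iff by (simp add: power_abs)

lemma rapid_bounded: "rapid f \<Longrightarrow> \<exists>C. \<forall>x. norm (f x) \<le> C"
  using rapidD[of f 0] by simp

text \<open>The decay exponents 0 and 2 add up to an integrable majorant, which is all that
  integrability of rapidly decreasing functions requires.\<close>

lemma rapid_weighted_bound:
  assumes "rapid f"
  shows "\<exists>C\<ge>0. \<forall>x. norm (f x) \<le> C * (1 / (1 + x\<^sup>2))"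
proof -
  obtain C0 C2 where C: "\<And>x. norm (f x) \<le> C0" "\<And>x. \<bar>x\<bar>^2 * norm (f x) \<le> C2"
    using rapidD[OF assms, of 0] rapidD[OF assms, of 2] by auto
  have "norm (f x) \<le> (C0 + C2) * (1 / (1 + x\<^sup>2))" for x
    using C[of x] by (simp add: pos_le_divide_eq add_pos_nonneg algebra_simps)
  moreover have "0 \<le> C0 + C2"
    using order_trans[OF norm_ge_zero C(1)[of 0]] order_trans[OF mult_nonneg_nonneg C(2)[of 0]] by simp
  ultimately show ?thesis by blast
qed

lemma rapid_add: "rapid f \<Longrightarrow> rapid g \<Longrightarrow> rapid (\<lambda>x. f x + g x)"
proof (rule rapidI)
  fix k assume "rapid f" "rapid g"
  then obtain A B where "\<And>x. \<bar>x\<bar> ^ k * norm (f x) \<le> A" "\<And>x. \<bar>x\<bar> ^ k * norm (g x) \<le> B"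
    using rapidD by metis
  then have "\<bar>x\<bar> ^ k * norm (f x + g x) \<le> A + B" for x
    by (smt (verit) distrib_left mult_left_mono norm_triangle_ineq power_abs abs_ge_zero zero_le_power)
  then show "\<exists>C. \<forall>x. \<bar>x\<bar> ^ k * norm (f x + g x) \<le> C" by blast
qed

lemma rapid_bound:
  assumes "rapid f" and "\<And>x. norm (g x) \<le> C * norm (f x)"
  shows "rapid g"
proof (rule rapidI)
  fix k
  obtain A where A: "\<And>x. \<bar>x\<bar> ^ k * norm (f x) \<le> A"
    using rapidD assms by metis
  have "\<bar>x\<bar> ^ k * norm (g x) \<le> \<bar>C\<bar> * A" for x
  proof -
    have "norm (g x) \<le> \<bar>C\<bar> * norm (f x)"
      using assms(2)[of x] by (smt (verit) mult_right_mono norm_ge_zero)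
    then have "\<bar>x\<bar> ^ k * norm (g x) \<le> \<bar>x\<bar> ^ k * (\<bar>C\<bar> * norm (f x))"
      by (intro mult_left_mono) auto
    also have "\<dots> = \<bar>C\<bar> * (\<bar>x\<bar> ^ k * norm (f x))" by simp
    also have "\<dots> \<le> \<bar>C\<bar> * A" by (intro mult_left_mono A) auto
    finally show ?thesis .
  qed
  then show "\<exists>C. \<forall>x. \<bar>x\<bar> ^ k * norm (g x) \<le> C" by blast
qed

lemma rapid_mult_id: "rapid f \<Longrightarrow> rapid (\<lambda>x. x *\<^sub>R f x)"
proof (rule rapidI)
  fix k assume "rapid f"
  then obtain A where "\<And>x. \<bar>x\<bar> ^ Suc k * norm (f x) \<le> A"
    using rapidD by metis
  then have "\<And>x. \<bar>x\<bar> ^ k * norm (x *\<^sub>R f x) \<le> A"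
    by (simp add: mult.assoc mult.left_commute)
  then show "\<exists>C. \<forall>x. \<bar>x\<bar> ^ k * norm (x *\<^sub>R f x) \<le> C" by blast
qed

lemma rapid_mult_id_complex: "rapid f \<Longrightarrow> rapid (\<lambda>x. complex_of_real x * f x)"
  using rapid_mult_id[of f] by (simp add: scaleR_conv_of_real)

lemma rapid_power: "rapid f \<Longrightarrow> rapid (\<lambda>x. x ^ k *\<^sub>R f x)"
proof (induction k)
  case (Suc k)
  then show ?case using rapid_mult_id[of "\<lambda>x. x ^ k *\<^sub>R f x"] by simp
qed simp

lemma rapid_dilate:
  assumes "rapid f" "c \<noteq> 0" shows "rapid (\<lambda>x. f (c * x))"
proof (rule rapidI)
  fix k
  obtain A where A: "\<And>x. \<bar>x\<bar> ^ k * norm (f x) \<le> A"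
    using rapidD assms by metis
  have "\<bar>x\<bar> ^ k * norm (f (c * x)) \<le> A / \<bar>c\<bar> ^ k" for x
    using A[of "c * x"] assms(2)
    by (simp add: abs_mult power_mult_distrib pos_le_divide_eq algebra_simps)
  then show "\<exists>C. \<forall>x. \<bar>x\<bar> ^ k * norm (f (c * x)) \<le> C" by blast
qed

lemma integrable_inverse_quadratic: "integrable lborel (\<lambda>x::real. 1 / (1 + x\<^sup>2))"
  using integrable_inverse_1_plus_square
  by (simp add: set_integrable_def inverse_eq_divide)

lemma rapid_integrable:
  fixes f :: "real \<Rightarrow> 'a::{banach, second_countable_topology}"
  assumes "rapid f" "f \<in> borel_measurable borel"
  shows "integrable lborel f"
proof -
  obtain C where C: "\<And>x. norm (f x) \<le> C * (1 / (1 + x\<^sup>2))" "C \<ge> 0"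
    using rapid_weighted_bound[OF assms(1)] by blast
  show ?thesis
  proof (rule Bochner_Integration.integrable_bound)
    show "integrable lborel (\<lambda>x. C * (1 / (1 + x\<^sup>2)))"
      by (rule integrable_mult_right[OF integrable_inverse_quadratic])
    show "AE x in lborel. norm (f x) \<le> norm (C * (1 / (1 + x\<^sup>2)))"
      using C by (auto intro: order_trans[OF C(1)])
  qed (use assms in simp)
qed

lemma rapid_vanish:
  assumes "\<And>x. \<bar>x\<bar> > R \<Longrightarrow> f x = 0" "continuous_on UNIV f"
  shows "rapid (f :: real \<Rightarrow> 'a::real_normed_vector)"
proof (rule rapidI)
  fix k
  have "compact ((\<lambda>x. \<bar>x\<bar> ^ k * norm (f x)) ` {-R..R})"
    by (intro compact_continuous_image continuous_intros continuous_on_subset[OF assms(2)]) auto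
  then obtain C where "\<And>x. x \<in> {-R..R} \<Longrightarrow> \<bar>x\<bar> ^ k * norm (f x) \<le> C"
    by (fastforce dest!: compact_imp_bounded simp: bounded_iff)
  then have "\<bar>x\<bar> ^ k * norm (f x) \<le> max C 0" for x
    by (cases "x \<in> {-R..R}") (auto simp: assms(1) max_def intro: order_trans)
  then show "\<exists>C. \<forall>x. \<bar>x\<bar> ^ k * norm (f x) \<le> C" by blast
qed

section \<open>Derivatives, smoothness and closure properties of the Schwartz space\<close>

lemma ddx_eqI: "(\<And>x. (f has_vector_derivative f' x) (at x)) \<Longrightarrow> ddx f = f'"
  by (auto simp: ddx_def vector_derivative_at)

lemma smoothD: "smooth f \<Longrightarrow> (f has_vector_derivative ddx f x) (at x)"
  unfolding smooth_def ddx_def by (metis funpow_0 vector_derivative_works)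

lemma smooth_ddx: "smooth f \<Longrightarrow> smooth (ddx f)"
  unfolding smooth_def by (metis comp_apply funpow_Suc_right)

lemma smooth_continuous: "smooth f \<Longrightarrow> continuous_on UNIV f"
  using smoothD by (metis continuous_at_imp_continuous_on has_vector_derivative_continuous)

lemma schwartzD:
  assumes "\<psi> \<in> schwartz"
  shows "(\<psi> has_vector_derivative ddx \<psi> x) (at x)" "ddx \<psi> \<in> schwartz" "rapid \<psi>"
    "continuous_on UNIV \<psi>" "\<psi> \<in> borel_measurable borel" "integrable lborel \<psi>"
proof -
  have s: "smooth \<psi>" and b: "\<And>k m. bounded (range (\<lambda>x. x ^ k *\<^sub>R (ddx ^^ m) \<psi> x))"
    using assms by (auto simp: schwartz_def)
  show "(\<psi> has_vector_derivative ddx \<psi> x) (at x)" using s by (rule smoothD)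
  have "bounded (range (\<lambda>x. x ^ k *\<^sub>R (ddx ^^ m) (ddx \<psi>) x))" for k m
    using b[of k "Suc m"] by (metis comp_apply funpow_Suc_right)
  then show "ddx \<psi> \<in> schwartz" using smooth_ddx[OF s] by (auto simp: schwartz_def)
  show r: "rapid \<psi>" unfolding rapid_def using b[of _ 0] by simp
  show c: "continuous_on UNIV \<psi>" using s by (rule smooth_continuous)
  show m: "\<psi> \<in> borel_measurable borel" using c by (rule borel_measurable_continuous_onI)
  show "integrable lborel \<psi>" using r m by (rule rapid_integrable)
qed

text \<open>Iterated derivatives never leave a class that contains a derivative of each of its
  members, so decay of the members bounds them all. Each closure property below then amounts to
  choosing a class large enough to be closed under differentiation, without a formula for higher
  derivatives.\<close>

lemma schwartz_coinduct:
  assumes "f \<in> A"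
    and step: "\<And>f. f \<in> A \<Longrightarrow> rapid f \<and> (\<exists>f'\<in>A. \<forall>x. (f has_vector_derivative f' x) (at x))"
  shows "f \<in> schwartz"
proof -
  have ddx: "g \<in> A \<Longrightarrow> ddx g \<in> A \<and> (\<forall>x. (g has_vector_derivative ddx g x) (at x))" for g
    using step[of g] ddx_eqI by metis
  have it: "(ddx ^^ m) f \<in> A" for m
    by (induction m) (use assms(1) ddx in auto)
  show ?thesis unfolding schwartz_def smooth_def mem_Collect_eq
  proof (intro conjI allI)
    fix k x show "(ddx ^^ k) f differentiable at x"
      using ddx[OF it[of k]] differentiableI_vector by metis
  next
    fix k m show "bounded (range (\<lambda>x. x ^ k *\<^sub>R (ddx ^^ m) f x))"
      using step[OF it[of m]] by (simp add: rapid_def)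
  qed
qed

lemma schwartz_add: assumes "\<psi> \<in> schwartz" "\<eta> \<in> schwartz" shows "(\<lambda>x. \<psi> x + \<eta> x) \<in> schwartz"
proof (rule schwartz_coinduct[where A="{\<lambda>x. \<psi> x + \<eta> x | \<psi> \<eta>. \<psi> \<in> schwartz \<and> \<eta> \<in> schwartz}"])
  show "(\<lambda>x. \<psi> x + \<eta> x) \<in> {\<lambda>x. \<psi> x + \<eta> x | \<psi> \<eta>. \<psi> \<in> schwartz \<and> \<eta> \<in> schwartz}" using assms by blast
  fix f assume "f \<in> {\<lambda>x. \<psi> x + \<eta> x | \<psi> \<eta>. \<psi> \<in> schwartz \<and> \<eta> \<in> schwartz}"
  then obtain a b where f: "f = (\<lambda>x. a x + b x)" "a \<in> schwartz" "b \<in> schwartz" by blast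
  have "\<forall>x. (f has_vector_derivative ddx a x + ddx b x) (at x)"
    unfolding f(1) using f schwartzD by (auto intro!: derivative_intros)
  then show "rapid f \<and> (\<exists>f'\<in>{\<lambda>x. \<psi> x + \<eta> x | \<psi> \<eta>. \<psi> \<in> schwartz \<and> \<eta> \<in> schwartz}. \<forall>x. (f has_vector_derivative f' x) (at x))"
  proof (intro conjI bexI)
    show "rapid f" unfolding f(1) using f schwartzD(3) by (intro rapid_add)
    show "(\<lambda>x. ddx a x + ddx b x) \<in> {\<lambda>x. \<psi> x + \<eta> x | \<psi> \<eta>. \<psi> \<in> schwartz \<and> \<eta> \<in> schwartz}"
      using schwartzD(2)[OF f(2)] schwartzD(2)[OF f(3)] by blast
  qed
qed

lemma schwartz_cmult: assumes "\<psi> \<in> schwartz" shows "(\<lambda>x. c * \<psi> x) \<in> schwartz"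
proof (rule schwartz_coinduct[where A="{\<lambda>x. c * \<psi> x | \<psi>. \<psi> \<in> schwartz}"])
  show "(\<lambda>x. c * \<psi> x) \<in> {\<lambda>x. c * \<psi> x | \<psi>. \<psi> \<in> schwartz}" using assms by blast
  fix f assume "f \<in> {\<lambda>x. c * \<psi> x | \<psi>. \<psi> \<in> schwartz}"
  then obtain a where f: "f = (\<lambda>x. c * a x)" "a \<in> schwartz" by blast
  have "\<forall>x. (f has_vector_derivative c * ddx a x) (at x)"
    unfolding f(1) using f schwartzD by (auto intro!: derivative_intros)
  moreover have "rapid f" unfolding f(1)
    by (rule rapid_bound[OF schwartzD(3)[OF f(2)], where C="norm c"]) (simp add: norm_mult)
  ultimately show "rapid f \<and> (\<exists>f'\<in>{\<lambda>x. c * \<psi> x | \<psi>. \<psi> \<in> schwartz}. \<forall>x. (f has_vector_derivative f' x) (at x))"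
  proof (intro conjI bexI)
    show "(\<lambda>x. c * ddx a x) \<in> {\<lambda>x. c * \<psi> x | \<psi>. \<psi> \<in> schwartz}"
      using schwartzD(2)[OF f(2)] by blast
  qed
qed

lemma schwartz_zero: "(\<lambda>x. 0) \<in> schwartz"
proof (rule schwartz_coinduct[where A="{\<lambda>x. 0}"])
  fix f :: "real \<Rightarrow> complex" assume "f \<in> {\<lambda>x. 0}"
  then show "rapid f \<and> (\<exists>f'\<in>{\<lambda>x. 0}. \<forall>x. (f has_vector_derivative f' x) (at x))"
    by (auto simp: rapid_def)
qed simp

lemma schwartz_minus: "\<psi> \<in> schwartz \<Longrightarrow> \<eta> \<in> schwartz \<Longrightarrow> (\<lambda>x. \<psi> x - \<eta> x) \<in> schwartz"
  using schwartz_add[of \<psi> "\<lambda>x. - 1 * \<eta> x"] schwartz_cmult[of \<eta> "-1"] by simp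

lemma schwartz_mult_id: assumes "\<psi> \<in> schwartz" shows "(\<lambda>x. of_real x * \<psi> x) \<in> schwartz"
proof -
  \<comment> \<open>Differentiating \<open>x * \<psi> x\<close> leaves the extra term
    \<open>\<psi> x\<close>; the free summand \<open>\<eta>\<close> makes room for it.\<close>
  let ?A = "{\<lambda>x. complex_of_real x * \<psi> x + \<eta> x | \<psi> \<eta>. \<psi> \<in> schwartz \<and> \<eta> \<in> schwartz}"
  have "(\<lambda>x. of_real x * \<psi> x + 0) \<in> schwartz"
  proof (rule schwartz_coinduct[where A="?A"])
    show "(\<lambda>x. of_real x * \<psi> x + 0) \<in> ?A"
      using assms schwartz_zero by (intro CollectI exI[of _ \<psi>] exI[of _ "\<lambda>x. 0"]) simp
    fix f assume "f \<in> ?A"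
    then obtain a b where f: "f = (\<lambda>x. of_real x * a x + b x)" "a \<in> schwartz" "b \<in> schwartz" by blast
    have d: "\<forall>x. (f has_vector_derivative of_real x * ddx a x + (a x + ddx b x)) (at x)"
      unfolding f(1)
    proof
      fix x
      have 1: "(complex_of_real has_vector_derivative 1) (at x)"
        using has_vector_derivative_of_real[OF DERIV_ident, of "at x"] by simp
      show "((\<lambda>x. of_real x * a x + b x) has_vector_derivative of_real x * ddx a x + (a x + ddx b x)) (at x)"
        using has_vector_derivative_add[OF has_vector_derivative_mult[OF 1 schwartzD(1)[OF f(2)]] schwartzD(1)[OF f(3)]]
        by (simp add: add.assoc)
    qed
    have r: "rapid f" unfolding f(1)
      by (intro rapid_add rapid_mult_id_complex) (use f schwartzD in auto)
    have "(\<lambda>x. a x + ddx b x) \<in> schwartz"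
      by (rule schwartz_add[OF f(2) schwartzD(2)[OF f(3)]])
    then have "(\<lambda>x. of_real x * ddx a x + (a x + ddx b x)) \<in> ?A"
      using schwartzD(2)[OF f(2)] by (intro CollectI exI[of _ "ddx a"] exI[of _ "\<lambda>x. a x + ddx b x"]) simp
    then show "rapid f \<and> (\<exists>f'\<in>?A. \<forall>x. (f has_vector_derivative f' x) (at x))"
      by (intro conjI r bexI) (rule d)
  qed
  then show ?thesis by simp
qed

lemma schwartz_chain:
  assumes "\<psi> \<in> schwartz" "(g has_real_derivative c) (at x)"
  shows "((\<lambda>x. \<psi> (g x)) has_vector_derivative of_real c * ddx \<psi> (g x)) (at x)"
  using vector_diff_chain_at[OF assms(2)[unfolded has_real_derivative_iff_has_vector_derivative] schwartzD(1)[OF assms(1)]]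
  by (simp add: comp_def scaleR_conv_of_real)

lemma schwartz_dilate:
  assumes "\<psi> \<in> schwartz" "c \<noteq> 0" shows "(\<lambda>x. \<psi> (c * x)) \<in> schwartz"
proof -
  \<comment> \<open>The free factor \<open>a\<close> collects the powers of \<open>c\<close>
    produced by the chain rule.\<close>
  let ?A = "{\<lambda>x. a * \<psi> (c * x) | \<psi> a. \<psi> \<in> schwartz}"
  have "(\<lambda>x. 1 * \<psi> (c * x)) \<in> schwartz"
  proof (rule schwartz_coinduct[where A="?A"])
    show "(\<lambda>x. 1 * \<psi> (c * x)) \<in> ?A" using assms by blast
    fix f assume "f \<in> ?A"
    then obtain b a where f: "f = (\<lambda>x. a * b (c * x))" "b \<in> schwartz" by blast
    have "(f has_vector_derivative (a * c) * ddx b (c * x)) (at x)" for x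
    proof -
      have "((\<lambda>x. a * b (c * x)) has_vector_derivative a * (of_real c * ddx b (c * x))) (at x)"
        by (intro has_vector_derivative_mult_right schwartz_chain[OF f(2)] DERIV_cmult_Id)
      then show ?thesis by (simp add: f(1) mult.assoc)
    qed
    moreover have "rapid f" unfolding f(1)
      by (rule rapid_bound[OF rapid_dilate[OF schwartzD(3)[OF f(2)] assms(2)], where C="norm a"])
         (simp add: norm_mult)
    moreover have "(\<lambda>x. (a * c) * ddx b (c * x)) \<in> ?A"
      using schwartzD(2)[OF f(2)] by blast
    ultimately show "rapid f \<and> (\<exists>f'\<in>?A. \<forall>x. (f has_vector_derivative f' x) (at x))"
      by (intro conjI bexI) auto
  qed
  then show ?thesis by simp
qed

lemma ddx_vanish:
  assumes "\<And>x. \<bar>x\<bar> > R \<Longrightarrow> f x = 0" "\<bar>x\<bar> > R" shows "ddx f x = 0"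
proof -
  have "open {y::real. \<bar>y\<bar> > R}" by (intro open_Collect_less continuous_intros)
  then have "(f has_vector_derivative 0) (at x)"
    using has_vector_derivative_transform_within_open[OF has_vector_derivative_const[of 0 "at x"], where g=f] assms
    by auto
  then show ?thesis by (simp add: ddx_def vector_derivative_at)
qed

text \<open>The product rule doubles the number of terms at each differentiation, so the invariant
  class consists of finite sums of products whose first factors all vanish outside
  \<open>[-R, R]\<close>.\<close>

lemma schwartz_mult_compact_support:
  fixes a :: "real \<Rightarrow> real"
  assumes "smooth a" "\<And>x. \<bar>x\<bar> > R \<Longrightarrow> a x = 0" "\<psi> \<in> schwartz"
  shows "(\<lambda>x. of_real (a x) * \<psi> x) \<in> schwartz"
proof -
  let ?B = "{a :: real \<Rightarrow> real. smooth a \<and> (\<forall>x. \<bar>x\<bar> > R \<longrightarrow> a x = 0)}"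
  let ?A = "{\<lambda>x. \<Sum>i<n. of_real (a i x) * \<psi> i x | (n::nat) a \<psi>. \<forall>i<n. a i \<in> ?B \<and> \<psi> i \<in> schwartz}"
  have "(\<lambda>x. \<Sum>i<1::nat. of_real (a x) * \<psi> x) \<in> schwartz"
  proof (rule schwartz_coinduct[where A="?A"])
    show "(\<lambda>x. \<Sum>i<1::nat. of_real (a x) * \<psi> x) \<in> ?A"
      by (intro CollectI exI[of _ 1] exI[of _ "\<lambda>_. a"] exI[of _ "\<lambda>_. \<psi>"]) (use assms in auto)
    fix f assume "f \<in> ?A"
    then obtain n :: nat and b \<theta> where f: "f = (\<lambda>x. \<Sum>i<n. of_real (b i x) * \<theta> i x)"
      and b: "\<And>i. i < n \<Longrightarrow> smooth (b i)" "\<And>i x. i < n \<Longrightarrow> \<bar>x\<bar> > R \<Longrightarrow> b i x = 0"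
      and th: "\<And>i. i < n \<Longrightarrow> \<theta> i \<in> schwartz" by blast
    have r: "rapid f"
    proof (rule rapid_vanish[where R=R])
      show "continuous_on UNIV f" unfolding f
        by (intro continuous_intros) (auto intro: smooth_continuous b th schwartzD)
    qed (use b f in auto)
    have d: "(f has_vector_derivative
       (\<Sum>i<n. of_real (b i x) * ddx (\<theta> i) x) + (\<Sum>i<n. of_real (ddx (b i) x) * \<theta> i x)) (at x)" for x
      unfolding f sum.distrib[symmetric]
      by (intro has_vector_derivative_sum has_vector_derivative_mult has_vector_derivative_of_real)
        (use smoothD[OF b(1)] schwartzD(1)[OF th] in \<open>auto simp: has_real_derivative_iff_has_vector_derivative\<close>)
    have m: "(\<lambda>x. (\<Sum>i<n. of_real (b i x) * ddx (\<theta> i) x) + (\<Sum>i<n. of_real (ddx (b i) x) * \<theta> i x)) \<in> ?A"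
    proof -
      \<comment> \<open>Of the \<open>n + n\<close> terms of the product rule, the first
        \<open>n\<close> differentiate the Schwartz factor and the others the cut-off.\<close>
      define c where "c i = (if i < n then b i else ddx (b (i - n)))" for i
      define \<eta> where "\<eta> i = (if i < n then ddx (\<theta> i) else \<theta> (i - n))" for i
      have split: "(\<Sum>i<n+m. g i) = (\<Sum>i<n. g i) + (\<Sum>i<m. g (i + n))" for g :: "nat \<Rightarrow> complex" and m
        by (induction m) (simp_all add: add.commute add.left_commute)
      have "(\<Sum>i<n. of_real (b i x) * ddx (\<theta> i) x) + (\<Sum>i<n. of_real (ddx (b i) x) * \<theta> i x)
        = (\<Sum>i<n+n. of_real (c i x) * \<eta> i x)" for x
        unfolding split by (simp add: c_def \<eta>_def)
      moreover have "\<forall>i<n+n. c i \<in> ?B \<and> \<eta> i \<in> schwartz"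
        using b th by (auto simp: c_def \<eta>_def intro!: schwartzD(2) smooth_ddx ddx_vanish[where R=R])
      ultimately show ?thesis by (intro CollectI exI[of _ "n + n"] exI[of _ c] exI[of _ \<eta>]) simp
    qed
    show "rapid f \<and> (\<exists>f'\<in>?A. \<forall>x. (f has_vector_derivative f' x) (at x))"
      by (intro conjI r bexI[OF _ m] allI d)
  qed
  then show ?thesis by simp
qed

text \<open>The coinduction above asks for decay, which a merely smooth function lacks, so the
  derivatives are computed: each one contributes a factor \<open>c\<close>.\<close>

lemma smooth_dilate:
  fixes a :: "real \<Rightarrow> real" assumes "smooth a" shows "smooth (\<lambda>x. a (c * x))"
proof -
  have "(ddx ^^ k) (\<lambda>x. a (c * x)) = (\<lambda>x. c ^ k * (ddx ^^ k) a (c * x)) \<and>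
     (\<forall>x. (\<lambda>x. c ^ k * (ddx ^^ k) a (c * x)) differentiable (at x))" for k
  proof (induction k)
    have *: "((\<lambda>x. c ^ k * (ddx ^^ k) a (c * x)) has_vector_derivative c ^ Suc k * (ddx ^^ Suc k) a (c * x)) (at x)" for k x
    proof -
      have "((ddx ^^ k) a has_vector_derivative (ddx ^^ Suc k) a (c * x)) (at (c * x))"
        using assms by (simp add: smooth_def ddx_def vector_derivative_works[symmetric])
      then have "((ddx ^^ k) a has_real_derivative (ddx ^^ Suc k) a (c * x)) (at (c * x))"
        by (simp add: has_real_derivative_iff_has_vector_derivative)
      then have "((\<lambda>x. (ddx ^^ k) a (c * x)) has_real_derivative (ddx ^^ Suc k) a (c * x) * c) (at x)"
        by (rule DERIV_chain2[OF _ DERIV_cmult_Id])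
      then have "((\<lambda>x. c ^ k * (ddx ^^ k) a (c * x)) has_real_derivative c ^ Suc k * (ddx ^^ Suc k) a (c * x)) (at x)"
        using DERIV_cmult by (fastforce simp: mult_ac)
      then show ?thesis by (simp add: has_real_derivative_iff_has_vector_derivative)
    qed
    case 0 show ?case using *[of 0] by (auto intro: differentiableI_vector)
    case (Suc k)
    then have "(ddx ^^ Suc k) (\<lambda>x. a (c * x)) = ddx (\<lambda>x. c ^ k * (ddx ^^ k) a (c * x))" by simp
    also have "\<dots> = (\<lambda>x. c ^ Suc k * (ddx ^^ Suc k) a (c * x))" by (rule ddx_eqI[OF *])
    finally show ?case using *[of "Suc k"] differentiableI_vector by blast
  qed
  then show ?thesis by (simp add: smooth_def)
qed

lemma schwartz_compact_support:
  fixes a :: "real \<Rightarrow> real"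
  assumes "smooth a" "\<And>x. \<bar>x\<bar> > R \<Longrightarrow> a x = 0"
  shows "(\<lambda>x. complex_of_real (a x)) \<in> schwartz"
proof (rule schwartz_coinduct[where A="{\<lambda>x. complex_of_real (a x) | a. smooth a \<and> (\<forall>x. \<bar>x\<bar> > R \<longrightarrow> a x = 0)}"])
  fix f assume "f \<in> {\<lambda>x. complex_of_real (a x) | a. smooth a \<and> (\<forall>x. \<bar>x\<bar> > R \<longrightarrow> a x = 0)}"
  then obtain b where b: "f = (\<lambda>x. of_real (b x))" "smooth b" "\<And>x. \<bar>x\<bar> > R \<Longrightarrow> b x = 0" by blast
  have "rapid f" unfolding b(1)
    by (rule rapid_vanish[where R=R]) (use b smooth_continuous in \<open>auto intro!: continuous_intros\<close>)
  moreover have "\<forall>x. (f has_vector_derivative of_real (ddx b x)) (at x)"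
    unfolding b(1) using smoothD[OF b(2)] has_vector_derivative_of_real
    by (metis has_real_derivative_iff_has_vector_derivative)
  moreover have "(\<lambda>x. complex_of_real (ddx b x)) \<in> {\<lambda>x. complex_of_real (a x) | a. smooth a \<and> (\<forall>x. \<bar>x\<bar> > R \<longrightarrow> a x = 0)}"
    using b(2,3) smooth_ddx ddx_vanish[where R=R and f=b] by blast
  ultimately show "rapid f \<and> (\<exists>f'\<in>{\<lambda>x. complex_of_real (a x) | a. smooth a \<and> (\<forall>x. \<bar>x\<bar> > R \<longrightarrow> a x = 0)}. \<forall>x. (f has_vector_derivative f' x) (at x))"
    by (intro conjI bexI) auto
qed (use assms in blast)

section \<open>The Fourier transform on Schwartz functions\<close>

lemma has_vector_derivative_at_iff_quotient:
  fixes f :: "real \<Rightarrow> 'a::real_normed_vector"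
  shows "(f has_vector_derivative D) (at x) \<longleftrightarrow> ((\<lambda>h. (f (x + h) - f x) /\<^sub>R h) \<longlongrightarrow> D) (at 0)"
proof -
  have "(f has_vector_derivative D) (at x) \<longleftrightarrow> ((\<lambda>h. norm (f (x + h) - f x - h *\<^sub>R D) / norm h) \<longlongrightarrow> 0) (at 0)"
    by (simp add: has_vector_derivative_def has_derivative_at bounded_linear_scaleR_left)
  also have "\<dots> \<longleftrightarrow> ((\<lambda>h. norm ((f (x + h) - f x) /\<^sub>R h - D)) \<longlongrightarrow> 0) (at 0)"
  proof (rule filterlim_cong[OF refl refl])
    have "norm (f (x + h) - f x - h *\<^sub>R D) / norm h = norm ((f (x + h) - f x) /\<^sub>R h - D)" if "h \<noteq> 0" for h
    proof -
      have "(f (x + h) - f x) /\<^sub>R h - D = (f (x + h) - f x - h *\<^sub>R D) /\<^sub>R h"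
        using that by (simp add: scaleR_diff_right)
      then show ?thesis by (simp add: divide_inverse mult.commute)
    qed
    then show "\<forall>\<^sub>F h in at 0. norm (f (x + h) - f x - h *\<^sub>R D) / norm h = norm ((f (x + h) - f x) /\<^sub>R h - D)"
      by (auto simp: eventually_at_filter)
  qed
  finally show ?thesis by (simp add: tendsto_norm_zero_iff LIM_zero_iff)
qed

text \<open>The mean value inequality bounds the difference quotients near \<open>x0\<close> by
  \<open>w\<close>, so dominated convergence applies. The measure is arbitrary because the same
  lemma later differentiates a series termwise, with counting measure.\<close>

lemma has_vector_derivative_integral_param:
  fixes f f' :: "real \<Rightarrow> 'a \<Rightarrow> complex"
  assumes int: "\<And>x. integrable M (f x)"
    and meas: "f' x0 \<in> borel_measurable M"
    and der: "\<And>x y. ((\<lambda>x. f x y) has_vector_derivative f' x y) (at x)"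
    and w: "integrable M w" and bnd: "\<And>x y. \<bar>x - x0\<bar> \<le> 1 \<Longrightarrow> norm (f' x y) \<le> w y"
  shows "((\<lambda>x. LINT y|M. f x y) has_vector_derivative (LINT y|M. f' x0 y)) (at x0)"
proof -
  define q where "q h y = (f (x0 + h) y - f x0 y) /\<^sub>R h" for h y
  have qb: "norm (q h y) \<le> w y" if "\<bar>h\<bar> \<le> 1" "h \<noteq> 0" for h y
  proof -
    have "norm (f (x0 + h) y - f x0 y) \<le> w y * norm (x0 + h - x0)"
    proof (rule differentiable_bound)
      show "convex {x0 - 1..x0 + 1}" by simp
      fix x assume x: "x \<in> {x0 - 1..x0 + 1}"
      show "((\<lambda>x. f x y) has_derivative (\<lambda>h. h *\<^sub>R f' x y)) (at x within {x0 - 1..x0 + 1})"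
        using der[of y x] unfolding has_vector_derivative_def by (rule has_derivative_at_withinI)
      show "onorm (\<lambda>h. h *\<^sub>R f' x y) \<le> w y"
        by (rule onorm_le) (use bnd[of x y] x in \<open>auto simp: mult.commute intro!: mult_right_mono mult_left_mono\<close>)
    qed (use that in auto)
    then show ?thesis using that by (simp add: q_def divide_simps mult.commute)
  qed
  have lim: "((\<lambda>h. LINT y|M. q h y) \<longlongrightarrow> (LINT y|M. f' x0 y)) (at 0)"
    unfolding tendsto_at_iff_sequentially comp_def
  proof (intro allI impI)
    fix X :: "nat \<Rightarrow> real" assume X: "\<forall>i. X i \<in> UNIV - {0}" "X \<longlonglongrightarrow> 0"
    \<comment> \<open>The majorant is valid only for increments of size at most 1, hence the passage
      to the tail from \<open>N\<close> on.\<close>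
    obtain N where "\<forall>n\<ge>N. norm (X n - 0) < 1"
      using LIMSEQ_D[OF X(2), of 1] by auto
    then have N: "\<bar>X n\<bar> \<le> 1" if "n \<ge> N" for n
      using that by (force simp: less_imp_le)
    have "(\<lambda>i. LINT y|M. q (X (i + N)) y) \<longlonglongrightarrow> (LINT y|M. f' x0 y)"
    proof (rule integral_dominated_convergence[where w=w])
      show "AE y in M. (\<lambda>i. q (X (i + N)) y) \<longlonglongrightarrow> f' x0 y"
      proof (intro AE_I2)
        fix y
        have "((\<lambda>h. (f (x0 + h) y - f x0 y) /\<^sub>R h) \<longlongrightarrow> f' x0 y) (at 0)"
          using der[of y x0] by (simp add: has_vector_derivative_at_iff_quotient)
        moreover have "filterlim (\<lambda>i. X (i + N)) (at 0) sequentially"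
          using X by (auto simp: filterlim_at LIMSEQ_ignore_initial_segment)
        ultimately show "(\<lambda>i. q (X (i + N)) y) \<longlonglongrightarrow> f' x0 y"
          unfolding q_def by (rule filterlim_compose)
      qed
    next
      fix i
      show "q (X (i + N)) \<in> borel_measurable M"
        unfolding q_def using int by (intro borel_measurable_scaleR borel_measurable_diff) auto
      show "AE y in M. norm (q (X (i + N)) y) \<le> w y"
        using X N[of "i + N"] by (auto intro!: qb)
    qed (use meas w in auto)
    then show "(\<lambda>i. LINT y|M. q (X i) y) \<longlonglongrightarrow> (LINT y|M. f' x0 y)"
      by (rule LIMSEQ_offset)
  qed
  have "(LINT y|M. q h y) = ((LINT y|M. f (x0 + h) y) - (LINT y|M. f x0 y)) /\<^sub>R h" for h
    unfolding q_def using int by (simp add: Bochner_Integration.integral_diff)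
  with lim have "((\<lambda>h. ((LINT y|M. f (x0 + h) y) - (LINT y|M. f x0 y)) /\<^sub>R h) \<longlongrightarrow> (LINT y|M. f' x0 y)) (at 0)"
    by simp
  then show ?thesis
    by (simp add: has_vector_derivative_at_iff_quotient)
qed

text \<open>Applied to products, this is integration by parts on the whole real axis without
  boundary terms.\<close>

lemma integral_derivative_eq_0:
  fixes f :: "real \<Rightarrow> complex"
  assumes der: "\<And>x. (f has_vector_derivative f' x) (at x)"
    and "continuous_on UNIV f'" "integrable lborel f'" "(f \<longlongrightarrow> 0) at_top" "(f \<longlongrightarrow> 0) at_bot"
  shows "(LINT x|lborel. f' x) = 0"
proof -
  have "(LBINT x=-\<infinity>..\<infinity>. f' x) = 0 - 0"
    by (rule interval_integral_FTC_integrable[where F=f])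
      (use assms in \<open>auto simp: ereal_tendsto_simps continuous_on_eq_continuous_at set_integrable_def\<close>)
  then show ?thesis
    by (simp add: interval_lebesgue_integral_def set_lebesgue_integral_def)
qed

lemma rapid_tendsto:
  fixes f :: "real \<Rightarrow> 'a::real_normed_vector"
  assumes "rapid f" shows "(f \<longlongrightarrow> 0) at_top" "(f \<longlongrightarrow> 0) at_bot"
proof -
  obtain C where C: "\<And>x. \<bar>x\<bar> ^ 1 * norm (f x) \<le> C" using rapidD[OF assms] by blast
  have b: "norm (f x) \<le> norm (C * inverse x)" if "x \<noteq> 0" for x
    using C[of x] that by (simp add: field_simps abs_mult)
  have "((\<lambda>x::real. norm (C * inverse x)) \<longlongrightarrow> 0) at_infinity"
    by (intro tendsto_norm_zero tendsto_mult_right_zero tendsto_inverse_0)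
  then have "((\<lambda>x::real. norm (C * inverse x)) \<longlongrightarrow> 0) at_top" "((\<lambda>x::real. norm (C * inverse x)) \<longlongrightarrow> 0) at_bot"
    using tendsto_mono at_top_le_at_infinity at_bot_le_at_infinity by blast+
  moreover have "eventually (\<lambda>x. norm (f x) \<le> norm (C * inverse x)) at_top" "eventually (\<lambda>x. norm (f x) \<le> norm (C * inverse x)) at_bot"
    by (rule eventually_mono[OF eventually_gt_at_top[of 0]], rule b, simp)
      (rule eventually_mono[OF eventually_gt_at_bot[of 0]], rule b, simp)
  ultimately show "(f \<longlongrightarrow> 0) at_top" "(f \<longlongrightarrow> 0) at_bot"
    by (auto intro: Lim_null_comparison)
qed

text \<open>The sign \<open>s\<close> treats both directions at once: \<open>s = -1\<close> is
  \<open>fourier\<close>, and \<open>s = 1\<close> is the inverse transform without its factor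
  \<open>1 / (2 * pi)\<close>. Inversion is then proved once, for \<open>s * s = 1\<close>.\<close>

definition FT :: "real \<Rightarrow> (real \<Rightarrow> complex) \<Rightarrow> real \<Rightarrow> complex" where
  "FT s \<psi> \<xi> = (LINT x|lborel. cis (s * x * \<xi>) * \<psi> x)"

lemma fourier_FT: "fourier \<psi> = FT (-1) \<psi>"
  by (auto simp: FT_def fourier_def fun_eq_iff)

lemma inv_fourier_FT: "inv_fourier \<psi> = (\<lambda>x. 1 / (2 * of_real pi) * FT 1 \<psi> x)"
  by (auto simp: FT_def inv_fourier_def fun_eq_iff mult.commute)

lemma measurable_cis [measurable]: "cis \<in> borel_measurable borel"
  by (intro borel_measurable_continuous_onI continuous_intros)

lemma integrable_cis_mult:
  assumes "integrable lborel \<psi>" shows "integrable lborel (\<lambda>x. cis (s * x * \<xi>) * \<psi> x)"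
  by (rule Bochner_Integration.integrable_bound[OF assms])
    (use borel_measurable_integrable[OF assms] in \<open>auto simp: norm_mult\<close>)

lemma norm_FT_le: "norm (FT s \<psi> \<xi>) \<le> (LINT x|lborel. norm (\<psi> x))"
  unfolding FT_def by (rule order_trans[OF integral_norm_bound]) (simp add: norm_mult)

lemma cis_linear_has_vector_derivative:
  "((\<lambda>\<xi>. cis (s * x * \<xi>)) has_vector_derivative \<i> * of_real (s * x) * cis (s * x * \<xi>)) (at \<xi>)"
proof -
  have "((\<lambda>\<xi>. s * x * \<xi>) has_vector_derivative s * x) (at \<xi>)"
    by (auto intro!: derivative_eq_intros simp flip: has_real_derivative_iff_has_vector_derivative)
  moreover have "(cis has_vector_derivative \<i> * cis t) (at t)" for t
  proof -
    have "((\<lambda>z. exp (\<i> * z)) has_field_derivative \<i> * exp (\<i> * of_real t)) (at (of_real t))"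
      by (auto intro!: derivative_eq_intros)
    then show ?thesis unfolding cis_conv_exp by (rule has_vector_derivative_real_field)
  qed
  ultimately have "(cis \<circ> (\<lambda>\<xi>. s * x * \<xi>) has_vector_derivative (s * x) *\<^sub>R (\<i> * cis (s * x * \<xi>))) (at \<xi>)"
    by (rule vector_diff_chain_at)
  then show ?thesis
    by (simp add: comp_def scaleR_conv_of_real mult_ac)
qed

lemma FT_has_vector_derivative:
  assumes "\<psi> \<in> schwartz"
  shows "(FT s \<psi> has_vector_derivative FT s (\<lambda>x. \<i> * of_real s * (of_real x * \<psi> x)) \<xi>) (at \<xi>)"
proof -
  have i: "integrable lborel (\<lambda>x. of_real x * \<psi> x)"
    using schwartzD(6)[OF schwartz_mult_id[OF assms]] .
  have *: "((\<lambda>\<xi>. LINT x|lborel. cis (s * x * \<xi>) * \<psi> x) has_vector_derivative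
     (LINT x|lborel. \<i> * of_real (s * x) * cis (s * x * \<xi>) * \<psi> x)) (at \<xi>)"
  proof (rule has_vector_derivative_integral_param[where w="\<lambda>x. \<bar>s\<bar> * norm (of_real x * \<psi> x)"])
    show "integrable lborel (\<lambda>x. \<bar>s\<bar> * norm (complex_of_real x * \<psi> x))"
      by (intro integrable_mult_right integrable_norm i)
  qed (use integrable_cis_mult schwartzD(5,6)[OF assms] cis_linear_has_vector_derivative
       in \<open>auto intro!: has_vector_derivative_mult_left simp: norm_mult abs_mult\<close>)
  show ?thesis using * by (simp add: FT_def[abs_def] mult_ac)
qed

lemma FT_ddx:
  assumes "\<psi> \<in> schwartz"
  shows "FT s (ddx \<psi>) \<xi> = - (\<i> * of_real s * of_real \<xi> * FT s \<psi> \<xi>)"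
proof -
  note S = schwartzD[OF assms] and S' = schwartzD[OF schwartzD(2)[OF assms]]
  have c: "cis (s * x * \<xi>) = cis (s * \<xi> * x)" for x by (simp add: mult_ac)
  have "(LINT x|lborel. cis (s * x * \<xi>) * ddx \<psi> x + \<i> * of_real (s * \<xi>) * (cis (s * x * \<xi>) * \<psi> x)) = 0"
  proof (rule integral_derivative_eq_0)
    fix x
    show "((\<lambda>x. cis (s * x * \<xi>) * \<psi> x) has_vector_derivative
       cis (s * x * \<xi>) * ddx \<psi> x + \<i> * of_real (s * \<xi>) * (cis (s * x * \<xi>) * \<psi> x)) (at x)"
      using has_vector_derivative_mult[OF cis_linear_has_vector_derivative[of s \<xi> x] S(1)]
      unfolding c by (simp add: mult_ac)
    have r: "rapid (\<lambda>x. cis (s * x * \<xi>) * \<psi> x)"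
      by (rule rapid_bound[OF S(3), where C=1]) (simp add: norm_mult)
    show "((\<lambda>x. cis (s * x * \<xi>) * \<psi> x) \<longlongrightarrow> 0) at_top" "((\<lambda>x. cis (s * x * \<xi>) * \<psi> x) \<longlongrightarrow> 0) at_bot"
      using rapid_tendsto[OF r] .
  qed (use S S' integrable_cis_mult in \<open>auto intro!: continuous_intros\<close>)
  then have "FT s (ddx \<psi>) \<xi> + \<i> * of_real (s * \<xi>) * FT s \<psi> \<xi> = 0"
    using integrable_cis_mult S(6) S'(6) by (simp add: FT_def)
  then show ?thesis by (simp add: add_eq_0_iff mult_ac)
qed

text \<open>Each power of the frequency is traded for a derivative of \<open>\<psi>\<close>; what
  remains is bounded by an L1 norm.\<close>

lemma FT_rapid:
  assumes "\<psi> \<in> schwartz" "s \<noteq> 0" shows "rapid (FT s \<psi>)"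
proof (rule rapidI)
  fix k
  have "\<exists>C. \<forall>\<xi>. \<bar>\<xi>\<bar> ^ k * norm (FT s \<psi> \<xi>) \<le> C" if "\<psi> \<in> schwartz" for \<psi> using that
  proof (induction k arbitrary: \<psi>)
    case 0 then show ?case using norm_FT_le by force
  next
    case (Suc k)
    then obtain C where C: "\<And>\<xi>. \<bar>\<xi>\<bar> ^ k * norm (FT s (ddx \<psi>) \<xi>) \<le> C"
      using schwartzD(2) by metis
    have "\<bar>\<xi>\<bar> ^ Suc k * norm (FT s \<psi> \<xi>) \<le> C / \<bar>s\<bar>" for \<xi>
      using C[of \<xi>] assms(2) unfolding FT_ddx[OF Suc.prems]
      by (simp add: norm_mult pos_le_divide_eq mult_ac)
    then show ?case by blast
  qed
  then show "\<exists>C. \<forall>\<xi>. \<bar>\<xi>\<bar> ^ k * norm (FT s \<psi> \<xi>) \<le> C" using assms(1) by blast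
qed

lemma FT_schwartz:
  assumes "\<psi> \<in> schwartz" "s \<noteq> 0" shows "FT s \<psi> \<in> schwartz"
proof (rule schwartz_coinduct[where A="FT s ` schwartz"])
  fix f assume "f \<in> FT s ` schwartz"
  then obtain \<psi> where f: "f = FT s \<psi>" "\<psi> \<in> schwartz" by blast
  show "rapid f \<and> (\<exists>f'\<in>FT s ` schwartz. \<forall>x. (f has_vector_derivative f' x) (at x))"
  proof (intro conjI bexI allI)
    show "rapid f" using f FT_rapid assms(2) by simp
    show "(f has_vector_derivative FT s (\<lambda>x. \<i> * of_real s * (of_real x * \<psi> x)) x) (at x)" for x
      unfolding f(1) by (rule FT_has_vector_derivative[OF f(2)])
    show "FT s (\<lambda>x. \<i> * of_real s * (of_real x * \<psi> x)) \<in> FT s ` schwartz"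
      using schwartz_cmult[OF schwartz_mult_id[OF f(2)]] by blast
  qed
qed (use assms in blast)

text \<open>Bounding only the inner integral by an integrable function of \<open>x\<close> covers
  convolution kernels, which are not dominated by a product; the product case is the lemma that
  follows.\<close>

lemma Fubini_lborel:
  fixes h :: "real \<Rightarrow> real \<Rightarrow> complex"
  assumes meas: "case_prod h \<in> borel_measurable (lborel \<Otimes>\<^sub>M lborel)"
    and int: "\<And>x. integrable lborel (h x)"
    and bnd: "\<And>x. (LINT y|lborel. norm (h x y)) \<le> w x" and w: "integrable lborel w"
  shows "(LINT y|lborel. LINT x|lborel. h x y) = (LINT x|lborel. LINT y|lborel. h x y)"
proof (rule lborel_pair.Fubini_integral)
  show "integrable (lborel \<Otimes>\<^sub>M lborel) (case_prod h)"
  proof (rule lborel_pair.Fubini_integrable[OF meas])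
    show "integrable lborel (\<lambda>x. LINT y|lborel. norm (case_prod h (x, y)))"
    proof (rule Bochner_Integration.integrable_bound[OF w])
      show "(\<lambda>x. LINT y|lborel. norm (case_prod h (x, y))) \<in> borel_measurable lborel"
        by (intro lborel.borel_measurable_lebesgue_integral) (use meas in \<open>simp add: case_prod_beta'\<close>)
      show "AE x in lborel. norm (LINT y|lborel. norm (case_prod h (x, y))) \<le> norm (w x)"
        using bnd by (auto intro!: AE_I2 order_trans[OF bnd])
    qed
  qed (use int in auto)
qed

lemma Fubini_lborel_product:
  fixes h :: "real \<Rightarrow> real \<Rightarrow> complex"
  assumes meas: "case_prod h \<in> borel_measurable (lborel \<Otimes>\<^sub>M lborel)"
    and bnd: "\<And>x y. norm (h x y) \<le> norm (f x) * norm (g y)"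
    and f: "integrable lborel (f :: real \<Rightarrow> complex)" and g: "integrable lborel (g :: real \<Rightarrow> complex)"
  shows "(LINT y|lborel. LINT x|lborel. h x y) = (LINT x|lborel. LINT y|lborel. h x y)"
proof (rule Fubini_lborel[OF meas])
  fix x
  have m: "h x \<in> borel_measurable lborel"
    using measurable_compose[OF measurable_Pair1'[of x] meas] by simp
  show i: "integrable lborel (h x)"
    by (rule Bochner_Integration.integrable_bound[OF integrable_mult_right[OF integrable_norm[OF g], of "norm (f x)"]])
      (use m bnd in auto)
  show "(LINT y|lborel. norm (h x y)) \<le> norm (f x) * (LINT y|lborel. norm (g y))"
    using integral_mono[OF integrable_norm[OF i] integrable_mult_right[OF integrable_norm[OF g], of "norm (f x)"]] bnd
    by simp
qed (use f in auto)

section \<open>Fourier inversion by Gaussian regularisation\<close>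

abbreviation gauss :: "real \<Rightarrow> real" where "gauss \<equiv> std_normal_density"

lemma integrable_gauss: "integrable lborel gauss"
  using integrable_std_normal_moment[of 0] by simp

lemma integral_gauss: "(LINT x|lborel. gauss x) = 1"
  using integral_std_normal_moment_even[of 0] by simp

lemma gauss_le: "gauss x \<le> 1"
proof -
  have "1 \<le> sqrt (2 * pi)" using pi_gt3 by simp
  then show ?thesis unfolding std_normal_density_def
    by (intro mult_le_one) auto
qed

text \<open>Read off from the characteristic function of the standard normal distribution.\<close>

lemma FT_gauss: "(LINT x|lborel. cis (t * x) * of_real (gauss x)) = of_real (exp (- t\<^sup>2 / 2))"
proof -
  have "char std_normal_distribution t = (LINT x|lborel. gauss x *\<^sub>R iexp (t * x))"
    unfolding char_def by (subst integral_density) (auto simp: normal_density_nonneg)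
  also have "\<dots> = (LINT x|lborel. cis (t * x) * of_real (gauss x))"
    by (simp add: cis_conv_exp scaleR_conv_of_real mult_ac)
  finally show ?thesis by (simp add: char_std_normal_distribution)
qed

lemma FT_gauss_dilate:
  assumes "\<epsilon> > 0"
  shows "(LINT x|lborel. cis (t * x) * of_real (gauss (\<epsilon> * x))) = of_real (sqrt (2 * pi) / \<epsilon> * gauss (t / \<epsilon>))"
proof -
  have "of_real (exp (- (t / \<epsilon>)\<^sup>2 / 2)) = (LINT x|lborel. cis (t / \<epsilon> * x) * of_real (gauss x))"
    by (rule FT_gauss[symmetric])
  also have "\<dots> = \<bar>\<epsilon>\<bar> *\<^sub>R (LINT x|lborel. cis (t / \<epsilon> * (0 + \<epsilon> * x)) * of_real (gauss (0 + \<epsilon> * x)))"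
    using assms by (intro lborel_integral_real_affine) simp
  also have "\<dots> = of_real \<epsilon> * (LINT x|lborel. cis (t * x) * of_real (gauss (\<epsilon> * x)))"
    using assms by (simp add: scaleR_conv_of_real)
  finally have "(LINT x|lborel. cis (t * x) * of_real (gauss (\<epsilon> * x))) = of_real (exp (- (t / \<epsilon>)\<^sup>2 / 2) / \<epsilon>)"
    using assms by (simp add: field_simps)
  also have "exp (- (t / \<epsilon>)\<^sup>2 / 2) / \<epsilon> = sqrt (2 * pi) / \<epsilon> * gauss (t / \<epsilon>)"
    by (simp add: std_normal_density_def)
  finally show ?thesis .
qed

text \<open>Inserting \<open>gauss (\<epsilon> * x)\<close> makes the double integral absolutely
  convergent, so the order of integration may be exchanged; the inner integral then is a Gaussian of
  width \<open>\<epsilon>\<close> centred at \<open>\<xi>\<close>. The limit of \<open>J\<close>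
  before the exchange carries the factor \<open>gauss 0\<close>, the one after it
  \<open>sqrt (2 * pi)\<close>, and their quotient is \<open>2 * pi\<close>.\<close>

theorem FT_inversion:
  assumes \<theta>: "\<theta> \<in> schwartz" and s: "s * s = 1"
  shows "FT (- s) (FT s \<theta>) \<xi> = 2 * of_real pi * \<theta> \<xi>"
proof -
  have s0: "s \<noteq> 0" using s by auto
  have s1: "\<bar>s\<bar> = 1" using s by (metis abs_mult abs_one mult_cancel_left1 abs_mult_self_eq power2_eq_square real_sqrt_abs2 real_sqrt_one)
  note E = FT_schwartz[OF \<theta> s0]
  note [measurable] = schwartzD(5)[OF \<theta>] schwartzD(5)[OF E]
  define \<epsilon> where "\<epsilon> n = inverse (real (Suc n))" for n
  have \<epsilon>: "\<epsilon> n > 0" "\<epsilon> \<longlonglongrightarrow> 0" for n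
    using LIMSEQ_inverse_real_of_nat by (auto simp: \<epsilon>_def[abs_def])
  define J where "J n = (LINT x|lborel. of_real (gauss (\<epsilon> n * x)) * (cis (- s * x * \<xi>) * FT s \<theta> x))" for n
  have "J \<longlonglongrightarrow> (LINT x|lborel. of_real (gauss 0) * (cis (- s * x * \<xi>) * FT s \<theta> x))"
    unfolding J_def
  proof (rule integral_dominated_convergence[where w="\<lambda>x. norm (FT s \<theta> x)"])
    show "AE x in lborel. (\<lambda>n. complex_of_real (gauss (\<epsilon> n * x)) * (cis (- s * x * \<xi>) * FT s \<theta> x))
        \<longlonglongrightarrow> of_real (gauss 0) * (cis (- s * x * \<xi>) * FT s \<theta> x)"
    proof (intro AE_I2 tendsto_intros)
      fix x
      have "isCont gauss 0" unfolding std_normal_density_def[abs_def] by (intro continuous_intros) auto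
      moreover have "(\<lambda>n. \<epsilon> n * x) \<longlonglongrightarrow> 0" using \<epsilon>(2) by (intro tendsto_mult_left_zero)
      ultimately show "(\<lambda>n. gauss (\<epsilon> n * x)) \<longlonglongrightarrow> gauss 0"
        by (rule isCont_tendsto_compose)
    qed
    show "AE x in lborel. norm (complex_of_real (gauss (\<epsilon> n * x)) * (cis (- s * x * \<xi>) * FT s \<theta> x)) \<le> norm (FT s \<theta> x)" for n
      using gauss_le by (auto simp: norm_mult normal_density_nonneg mult_left_le_one_le)
    show "integrable lborel (\<lambda>x. cmod (FT s \<theta> x))" using schwartzD(6)[OF E] by auto
  qed measurable
  moreover have "(LINT x|lborel. of_real (gauss 0) * (cis (- s * x * \<xi>) * FT s \<theta> x)) = of_real (gauss 0) * FT (- s) (FT s \<theta>) \<xi>"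
    by (simp add: FT_def)
  moreover have "J n = of_real (sqrt (2 * pi)) * (LINT w|lborel. \<theta> (\<xi> + \<epsilon> n * w) * of_real (gauss w))" for n
  proof -
    have ig: "integrable lborel (\<lambda>x. complex_of_real (gauss (\<epsilon> n * x)))"
      using lborel_integrable_real_affine[OF integrable_gauss, of "\<epsilon> n" 0] \<epsilon>(1)[of n] by (simp add: integrable_of_real)
    have "J n = (LINT x|lborel. LINT y|lborel. of_real (gauss (\<epsilon> n * x)) * (cis (- s * x * \<xi>) * (cis (s * y * x) * \<theta> y)))"
      unfolding J_def by (simp add: FT_def)
    also have "\<dots> = (LINT y|lborel. LINT x|lborel. of_real (gauss (\<epsilon> n * x)) * (cis (- s * x * \<xi>) * (cis (s * y * x) * \<theta> y)))"
    proof (rule Fubini_lborel_product[symmetric, OF _ _ ig schwartzD(6)[OF \<theta>]])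
      show "(\<lambda>(x, y). complex_of_real (gauss (\<epsilon> n * x)) * (cis (- s * x * \<xi>) * (cis (s * y * x) * \<theta> y))) \<in> borel_measurable (lborel \<Otimes>\<^sub>M lborel)"
        unfolding cis_conv_exp by measurable
    qed (auto simp: norm_mult)
    also have "\<dots> = (LINT y|lborel. \<theta> y * of_real (sqrt (2 * pi) / \<epsilon> n * gauss ((y - \<xi>) / \<epsilon> n)))"
    proof (rule Bochner_Integration.integral_cong[OF refl])
      fix y
      have e: "cis (- s * x * \<xi>) * cis (s * y * x) = cis (s * (y - \<xi>) * x)" for x
        by (simp add: cis_mult algebra_simps)
      have "(LINT x|lborel. of_real (gauss (\<epsilon> n * x)) * (cis (- s * x * \<xi>) * (cis (s * y * x) * \<theta> y)))
        = (LINT x|lborel. \<theta> y * (cis (s * (y - \<xi>) * x) * of_real (gauss (\<epsilon> n * x))))"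
        unfolding e[symmetric] by (simp add: mult_ac)
      also have "\<dots> = \<theta> y * of_real (sqrt (2 * pi) / \<epsilon> n * gauss (s * (y - \<xi>) / \<epsilon> n))"
        using FT_gauss_dilate[OF \<epsilon>(1)[of n], of "s * (y - \<xi>)"] by simp
      also have "gauss (s * (y - \<xi>) / \<epsilon> n) = gauss ((y - \<xi>) / \<epsilon> n)"
        using s by (simp add: std_normal_density_def power_divide power_mult_distrib power2_eq_square)
      finally show "(LINT x|lborel. of_real (gauss (\<epsilon> n * x)) * (cis (- s * x * \<xi>) * (cis (s * y * x) * \<theta> y)))
         = \<theta> y * of_real (sqrt (2 * pi) / \<epsilon> n * gauss ((y - \<xi>) / \<epsilon> n))" .
    qed
    also have "\<dots> = \<bar>\<epsilon> n\<bar> *\<^sub>R (LINT w|lborel. \<theta> (\<xi> + \<epsilon> n * w) * of_real (sqrt (2 * pi) / \<epsilon> n * gauss ((\<xi> + \<epsilon> n * w - \<xi>) / \<epsilon> n)))"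
      using \<epsilon>(1)[of n] by (intro lborel_integral_real_affine) simp
    also have "\<dots> = (LINT w|lborel. of_real (sqrt (2 * pi)) * (\<theta> (\<xi> + \<epsilon> n * w) * of_real (gauss w)))"
      using \<epsilon>(1)[of n] by (simp add: scaleR_conv_of_real flip: integral_mult_right_zero) (simp add: mult_ac)
    finally show ?thesis by simp
  qed
  moreover have "(\<lambda>n. LINT w|lborel. \<theta> (\<xi> + \<epsilon> n * w) * of_real (gauss w)) \<longlonglongrightarrow> (LINT w|lborel. \<theta> \<xi> * of_real (gauss w))"
  proof -
    obtain C where C: "\<And>x. norm (\<theta> x) \<le> C" using rapid_bounded[OF schwartzD(3)[OF \<theta>]] by blast
    show ?thesis
    proof (rule integral_dominated_convergence[where w="\<lambda>x. C * gauss x"])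
      show "AE w in lborel. (\<lambda>n. \<theta> (\<xi> + \<epsilon> n * w) * of_real (gauss w)) \<longlonglongrightarrow> \<theta> \<xi> * of_real (gauss w)"
      proof (intro AE_I2 tendsto_intros)
        fix w
        have "isCont \<theta> \<xi>" using schwartzD(4)[OF \<theta>] by (simp add: continuous_on_eq_continuous_at)
        moreover have "(\<lambda>n. \<xi> + \<epsilon> n * w) \<longlonglongrightarrow> \<xi>" using \<epsilon>(2) tendsto_add[OF tendsto_const tendsto_mult_left_zero] by fastforce
        ultimately show "(\<lambda>n. \<theta> (\<xi> + \<epsilon> n * w)) \<longlonglongrightarrow> \<theta> \<xi>"
          by (rule isCont_tendsto_compose)
      qed
      show "AE x in lborel. norm (\<theta> (\<xi> + \<epsilon> n * x) * of_real (gauss x)) \<le> C * gauss x" for n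
        using C by (auto simp: norm_mult normal_density_nonneg intro!: mult_right_mono)
    qed (auto intro!: integrable_mult_right integrable_gauss)
  qed
  moreover have "(LINT w|lborel. \<theta> \<xi> * of_real (gauss w)) = \<theta> \<xi>"
    by (simp add: integral_gauss)
  ultimately have "of_real (gauss 0) * FT (- s) (FT s \<theta>) \<xi> = of_real (sqrt (2 * pi)) * \<theta> \<xi>"
    using LIMSEQ_unique[OF _ tendsto_mult_left] by (metis (no_types, lifting) ext)
  then have "FT (- s) (FT s \<theta>) \<xi> = \<theta> \<xi> * complex_of_real (pi * 2)"
    by (simp add: std_normal_density_def field_simps flip: of_real_mult)
  then show ?thesis by (simp add: mult_ac)
qed

lemma inv_fourier_fourier: "\<theta> \<in> schwartz \<Longrightarrow> inv_fourier (fourier \<theta>) = \<theta>"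
  using FT_inversion[of \<theta> "-1"] by (simp add: fun_eq_iff inv_fourier_FT fourier_FT)

lemma fourier_schwartz: "\<psi> \<in> schwartz \<Longrightarrow> fourier \<psi> \<in> schwartz"
  by (simp add: fourier_FT FT_schwartz)

lemma inv_fourier_schwartz: "\<psi> \<in> schwartz \<Longrightarrow> inv_fourier \<psi> \<in> schwartz"
  unfolding inv_fourier_FT by (intro schwartz_cmult FT_schwartz) simp_all

text \<open>Conjugation by the transform turns a multiplier into a convolution. The order,
  \<open>fourier\<close> after \<open>inv_fourier\<close>, is the one in which a Littlewood-Paley
  block acts on test functions.\<close>

lemma fourier_mult_inv_fourier:
  assumes m: "integrable lborel m" and \<psi>: "\<psi> \<in> schwartz"
  shows "fourier (\<lambda>\<xi>. m \<xi> * inv_fourier \<psi> \<xi>) x = (LINT y|lborel. fourier m (x - y) / (2 * of_real pi) * \<psi> y)"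
proof -
  note [measurable] = borel_measurable_integrable[OF m] schwartzD(5)[OF \<psi>]
  have "fourier (\<lambda>\<xi>. m \<xi> * inv_fourier \<psi> \<xi>) x =
    (LINT \<xi>|lborel. LINT y|lborel. cis (- (\<xi> * x)) * m \<xi> * (cis (\<xi> * y) * \<psi> y) / (2 * of_real pi))"
    by (simp add: fourier_def inv_fourier_def mult.assoc)
  also have "\<dots> = (LINT y|lborel. LINT \<xi>|lborel. cis (- (\<xi> * x)) * m \<xi> * (cis (\<xi> * y) * \<psi> y) / (2 * of_real pi))"
  proof (rule Fubini_lborel_product[symmetric, OF _ _ m schwartzD(6)[OF \<psi>]])
    show "(\<lambda>(\<xi>, y). cis (- (\<xi> * x)) * m \<xi> * (cis (\<xi> * y) * \<psi> y) / (2 * of_real pi)) \<in> borel_measurable (lborel \<Otimes>\<^sub>M lborel)"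
      unfolding cis_conv_exp by measurable
    have "1 \<le> 2 * pi" using pi_gt3 by simp
    then show "norm (cis (- (\<xi> * x)) * m \<xi> * (cis (\<xi> * y) * \<psi> y) / (2 * of_real pi)) \<le> norm (m \<xi>) * norm (\<psi> y)" for \<xi> y
      using mult_left_mono[of 1 "2 * pi" "norm (m \<xi>) * norm (\<psi> y)"]
      by (simp add: norm_mult norm_divide pos_divide_le_eq)
  qed
  also have "\<dots> = (LINT y|lborel. fourier m (x - y) / (2 * of_real pi) * \<psi> y)"
  proof (rule Bochner_Integration.integral_cong[OF refl])
    fix y
    have e: "cis (- (\<xi> * (x - y))) = cis (- (\<xi> * x)) * cis (\<xi> * y)" for \<xi>
      by (simp add: cis_mult algebra_simps)
    show "(LINT \<xi>|lborel. cis (- (\<xi> * x)) * m \<xi> * (cis (\<xi> * y) * \<psi> y) / (2 * of_real pi)) = fourier m (x - y) / (2 * of_real pi) * \<psi> y"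
      unfolding fourier_def e
      by (simp add: mult_ac flip: integral_mult_left_zero integral_mult_right_zero integral_divide_zero)
  qed
  finally show ?thesis .
qed

section \<open>Correlation and mollification\<close>

lemma add_power_le:
  fixes a b :: real assumes "a \<ge> 0" "b \<ge> 0" shows "(a + b) ^ k \<le> 2 ^ k * (a ^ k + b ^ k)"
proof -
  have "(a + b) ^ k \<le> (2 * max a b) ^ k" using assms by (intro power_mono) auto
  also have "\<dots> = 2 ^ k * max (a ^ k) (b ^ k)"
    using assms power_mono[of a b k] power_mono[of b a k]
    by (cases "a \<le> b") (simp_all add: power_mult_distrib max_absorb1 max_absorb2)
  also have "\<dots> \<le> 2 ^ k * (a ^ k + b ^ k)" using assms by (intro mult_left_mono) auto
  finally show ?thesis .
qed

text \<open>The transpose of convolution with \<open>\<theta>\<close>: pairing \<open>g\<close> with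
  the convolution of a test function is pairing \<open>corr \<theta> g\<close> with the test
  function itself, as \<open>integral_corr\<close> shows. It replaces a bounded representative by a
  differentiable one.\<close>

definition corr :: "(real \<Rightarrow> complex) \<Rightarrow> (real \<Rightarrow> complex) \<Rightarrow> real \<Rightarrow> complex" where
  "corr \<theta> g x = (LINT y|lborel. \<theta> (y - x) * g y)"

lemma integrable_translate:
  fixes f :: "real \<Rightarrow> 'a::{banach, second_countable_topology}"
  assumes "integrable lborel f" shows "integrable lborel (\<lambda>y. f (y - x))" "integrable lborel (\<lambda>y. f (x - y))"
  using lborel_integrable_real_affine[OF assms, of 1 "-x"] lborel_integrable_real_affine[OF assms, of "-1" x]
  by simp_all

lemma integral_translate:
  fixes f :: "real \<Rightarrow> 'a::{banach, second_countable_topology}"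
  shows "(LINT y|lborel. f (y - x)) = (LINT y|lborel. f y)" "(LINT y|lborel. f (x - y)) = (LINT y|lborel. f y)"
  using lborel_integral_real_affine[of 1 f "-x"] lborel_integral_real_affine[of "-1" f x]
  by simp_all

lemma integrable_mult_bounded:
  fixes f g :: "real \<Rightarrow> complex"
  assumes "integrable lborel f" "g \<in> borel_measurable borel" "\<And>x. norm (g x) \<le> M"
  shows "integrable lborel (\<lambda>x. f x * g x)"
proof (rule Bochner_Integration.integrable_bound)
  show "integrable lborel (\<lambda>x. norm (f x) * M)" using assms(1) by (intro integrable_mult_left integrable_norm)
  have "0 \<le> M" using order_trans[OF norm_ge_zero assms(3)[of 0]] .
  then show "AE x in lborel. norm (f x * g x) \<le> norm (norm (f x) * M)"
    using assms(3) by (auto simp: norm_mult intro!: mult_left_mono)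
qed (use assms borel_measurable_integrable in auto)

lemma norm_integral_mult_bounded_le:
  fixes f g :: "real \<Rightarrow> complex"
  assumes "integrable lborel f" "g \<in> borel_measurable borel" "\<And>x. norm (g x) \<le> M"
  shows "norm (LINT x|lborel. f x * g x) \<le> (LINT x|lborel. norm (f x)) * M"
proof -
  have "norm (LINT x|lborel. f x * g x) \<le> (LINT x|lborel. norm (f x * g x))" by (rule integral_norm_bound)
  also have "\<dots> \<le> (LINT x|lborel. norm (f x) * M)"
    by (intro integral_mono integrable_norm integrable_mult_bounded integrable_mult_left)
      (use assms in \<open>auto simp: norm_mult intro!: mult_left_mono\<close>)
  finally show ?thesis by simp
qed

lemma integrable_corr_kernel:
  assumes "\<theta> \<in> schwartz" "g \<in> borel_measurable borel" "\<And>y. norm (g y) \<le> M"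
  shows "integrable lborel (\<lambda>y. \<theta> (y - x) * g y)"
  by (rule integrable_mult_bounded[OF integrable_translate(1)[OF schwartzD(6)[OF assms(1)]] assms(2,3)])

lemma norm_corr_le:
  assumes "\<theta> \<in> schwartz" "g \<in> borel_measurable borel" "\<And>y. norm (g y) \<le> M"
  shows "norm (corr \<theta> g x) \<le> (LINT y|lborel. norm (\<theta> y)) * M"
  using norm_integral_mult_bounded_le[OF integrable_translate(1)[OF schwartzD(6)[OF assms(1)], of x] assms(2,3)]
    integral_translate(1)[of "\<lambda>y. norm (\<theta> y)" x]
  by (simp add: corr_def)

lemma corr_has_vector_derivative:
  assumes \<theta>: "\<theta> \<in> schwartz" and g: "g \<in> borel_measurable borel" "\<And>y. norm (g y) \<le> M"
  shows "(corr \<theta> g has_vector_derivative - corr (ddx \<theta>) g x) (at x)"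
proof -
  note D = schwartzD(2)[OF \<theta>]
  obtain C where C: "C \<ge> 0" "\<And>x. norm (ddx \<theta> x) \<le> C * (1 / (1 + x\<^sup>2))"
    using rapid_weighted_bound[OF schwartzD(3)[OF D]] by blast
  have M: "M \<ge> 0" using order_trans[OF norm_ge_zero g(2)[of 0]] .
  have "((\<lambda>x. LINT y|lborel. \<theta> (y - x) * g y) has_vector_derivative
     (LINT y|lborel. - ddx \<theta> (y - x) * g y)) (at x)"
  \<comment> \<open>One majorant centred at \<open>x\<close> has to serve every \<open>z\<close>
    with \<open>\<bar>z - x\<bar> \<le> 1\<close>. The factor 3 comes from
    \<open>1 + (y - x)\<^sup>2 \<le> 3 * (1 + (y - z)\<^sup>2)\<close>, valid for such
    \<open>z\<close>.\<close>
  proof (rule has_vector_derivative_integral_param[where w="\<lambda>y. (C * 3) * (1 / (1 + (y - x)\<^sup>2)) * M"])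
    show "integrable lborel (\<lambda>y. \<theta> (y - x) * g y)" for x by (rule integrable_corr_kernel[OF \<theta> g])
    show "(\<lambda>y. - ddx \<theta> (y - x) * g y) \<in> borel_measurable lborel"
      using borel_measurable_integrable[OF integrable_corr_kernel[OF D g]] by simp
    show "((\<lambda>x. \<theta> (y - x) * g y) has_vector_derivative - ddx \<theta> (y - x) * g y) (at x)" for x y
    proof -
      have "((\<lambda>x. y - x) has_real_derivative -1) (at x)" by (auto intro!: derivative_eq_intros)
      from schwartz_chain[OF \<theta> this] show ?thesis by (intro has_vector_derivative_mult_left) simp
    qed
    show "integrable lborel (\<lambda>y. (C * 3) * (1 / (1 + (y - x)\<^sup>2)) * M)"
      by (intro integrable_mult_left integrable_mult_right integrable_translate(1)[OF integrable_inverse_quadratic])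
    show "norm (- ddx \<theta> (y - z) * g y) \<le> (C * 3) * (1 / (1 + (y - x)\<^sup>2)) * M" if "\<bar>z - x\<bar> \<le> 1" for z y
    proof -
      have zx: "(z - x)\<^sup>2 \<le> 1" using that by (simp add: abs_square_le_1)
      have q: "(y - x)\<^sup>2 \<le> 2 * (y - z)\<^sup>2 + 2 * (z - x)\<^sup>2"
        using zero_le_power2[of "(y - z) - (z - x)"] by (simp add: power2_eq_square algebra_simps)
      have "1 + (y - x)\<^sup>2 \<le> 3 * (1 + (y - z)\<^sup>2)"
      proof -
        have "1 + p \<le> 3 * (1 + a)" if "p \<le> 2 * a + 2 * b" "b \<le> 1" "0 \<le> a" for a b p :: real using that by simp
        from this[OF q zx zero_le_power2] show ?thesis .
      qed
      then have "1 / (1 + (y - z)\<^sup>2) \<le> 3 * (1 / (1 + (y - x)\<^sup>2))"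
        by (simp add: divide_simps add_pos_nonneg)
      then have "norm (ddx \<theta> (y - z)) \<le> (C * 3) * (1 / (1 + (y - x)\<^sup>2))"
        unfolding mult.assoc by (rule order_trans[OF C(2) mult_left_mono[OF _ C(1)]])
      then show ?thesis unfolding norm_mult norm_minus_cancel
        by (intro mult_mono g(2)) (use C in auto)
    qed
  qed
  then show ?thesis by (simp add: corr_def[abs_def])
qed

lemma continuous_corr:
  assumes "\<theta> \<in> schwartz" "g \<in> borel_measurable borel" "\<And>y. norm (g y) \<le> M"
  shows "continuous_on UNIV (corr \<theta> g)"
  using corr_has_vector_derivative[OF assms]
  by (metis continuous_at_imp_continuous_on has_vector_derivative_continuous)

lemma integral_corr:
  assumes \<theta>: "\<theta> \<in> schwartz" and g: "g \<in> borel_measurable borel" "\<And>y. norm (g y) \<le> M" and \<psi>: "\<psi> \<in> schwartz"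
  shows "(LINT y|lborel. g y * (LINT x|lborel. \<theta> (y - x) * \<psi> x)) = (LINT x|lborel. corr \<theta> g x * \<psi> x)"
proof -
  note [measurable] = schwartzD(5)[OF \<theta>] schwartzD(5)[OF \<psi>] g(1)
  have i: "integrable lborel (\<lambda>y. \<theta> (y - x) * g y * \<psi> x)" for x
    by (intro integrable_mult_left integrable_corr_kernel[OF \<theta> g])
  have f1: "(LINT y|lborel. LINT x|lborel. \<theta> (y - x) * g y * \<psi> x) = (LINT x|lborel. LINT y|lborel. \<theta> (y - x) * g y * \<psi> x)"
  proof (rule Fubini_lborel[OF _ i])
    show "(\<lambda>(x, y). \<theta> (y - x) * g y * \<psi> x) \<in> borel_measurable (lborel \<Otimes>\<^sub>M lborel)" by measurable
    show "(LINT y|lborel. norm (\<theta> (y - x) * g y * \<psi> x)) \<le> ((LINT y|lborel. norm (\<theta> y)) * M) * norm (\<psi> x)" for x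
    proof -
      have "(LINT y|lborel. norm (\<theta> (y - x) * g y * \<psi> x)) \<le> (LINT y|lborel. norm (\<theta> (y - x)) * (M * norm (\<psi> x)))"
        by (intro integral_mono integrable_norm i integrable_mult_left integrable_translate schwartzD(6)[OF \<theta>])
          (auto simp: norm_mult mult.assoc intro!: mult_left_mono mult_right_mono g)
      then show ?thesis using integral_translate(1)[of "\<lambda>y. norm (\<theta> y)" x] by (simp add: mult.assoc)
    qed
    show "integrable lborel (\<lambda>x. (LINT y|lborel. norm (\<theta> y)) * M * norm (\<psi> x))"
      using schwartzD(6)[OF \<psi>] by (intro integrable_mult_right integrable_norm)
  qed
  have f2: "(LINT x|lborel. \<theta> (y - x) * g y * \<psi> x) = g y * (LINT x|lborel. \<theta> (y - x) * \<psi> x)" for y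
    by (simp add: mult_ac flip: integral_mult_right_zero)
  have f3: "(LINT y|lborel. \<theta> (y - x) * g y * \<psi> x) = corr \<theta> g x * \<psi> x" for x
    by (simp add: corr_def)
  show ?thesis using f1 unfolding f2 f3 .
qed

section \<open>Schwartz seminorms and convergence of mollified test functions\<close>

lemma seminorm_le:
  assumes "\<And>x. norm (x ^ k *\<^sub>R (ddx ^^ m) \<psi> x) \<le> C" shows "schwartz_seminorm k m \<psi> \<le> C"
  unfolding schwartz_seminorm_def by (rule cSUP_least) (use assms in auto)

lemma schwartz_iter: "\<psi> \<in> schwartz \<Longrightarrow> (ddx ^^ m) \<psi> \<in> schwartz"
  by (induction m) (auto intro: schwartzD)

lemma seminorm_ge:
  assumes "\<psi> \<in> schwartz" shows "norm (x ^ k *\<^sub>R (ddx ^^ m) \<psi> x) \<le> schwartz_seminorm k m \<psi>"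
  unfolding schwartz_seminorm_def
proof (rule cSUP_upper)
  obtain C where C: "\<And>x. \<bar>x\<bar> ^ k * norm ((ddx ^^ m) \<psi> x) \<le> C"
    using rapidD[OF schwartzD(3)[OF schwartz_iter[OF assms]]] by blast
  show "bdd_above (range (\<lambda>x. norm (x ^ k *\<^sub>R (ddx ^^ m) \<psi> x)))"
    by (rule bdd_aboveI[of _ C]) (use C in \<open>auto simp: power_abs\<close>)
qed simp

lemma seminorm_nonneg: "\<psi> \<in> schwartz \<Longrightarrow> 0 \<le> schwartz_seminorm k m \<psi>"
  using order_trans[OF norm_ge_zero seminorm_ge[of \<psi> 0 k m]] .

text \<open>Convolution with the kernel compressed to width \<open>1 / L\<close>, already rescaled:
  \<open>\<kappa>\<close> stays fixed and \<open>L\<close> occurs only in the increment of the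
  argument, as the seminorm estimate needs it.\<close>

definition mollify :: "(real \<Rightarrow> complex) \<Rightarrow> real \<Rightarrow> (real \<Rightarrow> complex) \<Rightarrow> real \<Rightarrow> complex" where
  "mollify \<kappa> L \<psi> x = (LINT w|lborel. \<kappa> w * \<psi> (x - w / L))"

lemma mollify_has_vector_derivative:
  assumes \<kappa>: "\<kappa> \<in> schwartz" and \<psi>: "\<psi> \<in> schwartz"
  shows "(mollify \<kappa> L \<psi> has_vector_derivative mollify \<kappa> L (ddx \<psi>) x) (at x)"
proof -
  note D = schwartzD(2)[OF \<psi>]
  obtain C where C: "\<And>x. norm (ddx \<psi> x) \<le> C" using rapid_bounded[OF schwartzD(3)[OF D]] by blast
  obtain C0 where C0: "\<And>x. norm (\<psi> x) \<le> C0" using rapid_bounded[OF schwartzD(3)[OF \<psi>]] by blast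
  note [measurable] = schwartzD(5)[OF \<kappa>] schwartzD(5)[OF \<psi>] schwartzD(5)[OF D]
  show ?thesis unfolding mollify_def[abs_def]
  proof (rule has_vector_derivative_integral_param[where w="\<lambda>w. norm (\<kappa> w) * C"])
    show "integrable lborel (\<lambda>w. \<kappa> w * \<psi> (x - w / L))" for x
      by (rule integrable_mult_bounded[OF schwartzD(6)[OF \<kappa>] _ C0]) measurable
    show "((\<lambda>x. \<kappa> w * \<psi> (x - w / L)) has_vector_derivative \<kappa> w * ddx \<psi> (x - w / L)) (at x)" for x w
    proof -
      have "((\<lambda>x. x - w / L) has_real_derivative 1) (at x)" by (auto intro!: derivative_eq_intros)
      from schwartz_chain[OF \<psi> this] show ?thesis by (intro has_vector_derivative_mult_right) simp
    qed
    show "integrable lborel (\<lambda>w. norm (\<kappa> w) * C)"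
      using schwartzD(6)[OF \<kappa>] by (intro integrable_mult_left integrable_norm)
  qed (auto simp: norm_mult intro!: mult_left_mono C)
qed

text \<open>In the mean value inequality the weight at \<open>x\<close> is carried to the
  intermediate point by \<open>\<bar>x\<bar> \<le> \<bar>z\<bar> + \<bar>h\<bar>\<close>. This costs
  a polynomial factor in \<open>h\<close>, which the decay of the mollifier absorbs
  afterwards.\<close>

lemma schwartz_increment_bound:
  assumes \<psi>: "\<psi> \<in> schwartz"
  shows "\<exists>A\<ge>0. \<forall>x h. \<bar>x\<bar> ^ k * norm (\<psi> (x - h) - \<psi> x) \<le> A * (\<bar>h\<bar> * (1 + \<bar>h\<bar> ^ k))"
proof -
  note D = schwartzD(2)[OF \<psi>]
  obtain C0 Ck where C: "\<And>x. norm (ddx \<psi> x) \<le> C0" "\<And>x. \<bar>x\<bar> ^ k * norm (ddx \<psi> x) \<le> Ck"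
    using rapidD[OF schwartzD(3)[OF D], of k] rapid_bounded[OF schwartzD(3)[OF D]] by blast
  have n: "0 \<le> C0" "0 \<le> Ck"
    using order_trans[OF norm_ge_zero C(1)[of 0]] order_trans[OF mult_nonneg_nonneg C(2)[of 0]] by auto
  have "\<bar>x\<bar> ^ k * norm (\<psi> (x - h) - \<psi> x) \<le> 2 ^ k * (Ck + C0) * (\<bar>h\<bar> * (1 + \<bar>h\<bar> ^ k))" for x h
  proof -
    let ?B = "2 ^ k * (Ck + \<bar>h\<bar> ^ k * C0)"
    have "norm (\<bar>x\<bar> ^ k *\<^sub>R \<psi> (x - h) - \<bar>x\<bar> ^ k *\<^sub>R \<psi> x) \<le> ?B * norm (x - h - x)"
    proof (rule differentiable_bound[where S="closed_segment x (x - h)"])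
      fix z assume z: "z \<in> closed_segment x (x - h)"
      have "((\<lambda>z. \<bar>x\<bar> ^ k *\<^sub>R \<psi> z) has_vector_derivative \<bar>x\<bar> ^ k *\<^sub>R ddx \<psi> z) (at z)"
        unfolding has_vector_derivative_def
        using has_derivative_scaleR_right[OF schwartzD(1)[OF \<psi>, unfolded has_vector_derivative_def], of "\<bar>x\<bar> ^ k" z]
        by (simp add: mult.commute)
      then show "((\<lambda>z. \<bar>x\<bar> ^ k *\<^sub>R \<psi> z) has_derivative (\<lambda>h. h *\<^sub>R (\<bar>x\<bar> ^ k *\<^sub>R ddx \<psi> z))) (at z within closed_segment x (x - h))"
        unfolding has_vector_derivative_def by (rule has_derivative_at_withinI)
      have "\<bar>x\<bar> \<le> \<bar>z\<bar> + \<bar>h\<bar>" using z by (auto simp: closed_segment_eq_real_ivl split: if_splits)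
      then have "\<bar>x\<bar> ^ k \<le> (\<bar>z\<bar> + \<bar>h\<bar>) ^ k" by (intro power_mono) auto
      also have "\<dots> \<le> 2 ^ k * (\<bar>z\<bar> ^ k + \<bar>h\<bar> ^ k)" by (rule add_power_le) auto
      finally have "\<bar>x\<bar> ^ k * norm (ddx \<psi> z) \<le> 2 ^ k * (\<bar>z\<bar> ^ k + \<bar>h\<bar> ^ k) * norm (ddx \<psi> z)"
        by (intro mult_right_mono) auto
      also have "\<dots> = 2 ^ k * (\<bar>z\<bar> ^ k * norm (ddx \<psi> z) + \<bar>h\<bar> ^ k * norm (ddx \<psi> z))" by (simp add: algebra_simps)
      also have "\<dots> \<le> ?B" by (intro mult_left_mono add_mono C) auto
      finally have "norm (\<bar>x\<bar> ^ k *\<^sub>R ddx \<psi> z) \<le> ?B" by simp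
      then have "norm (t *\<^sub>R (\<bar>x\<bar> ^ k *\<^sub>R ddx \<psi> z)) \<le> ?B * norm t" for t
        unfolding norm_scaleR[of t] real_norm_def mult.commute[of _ "\<bar>t\<bar>"] by (rule mult_left_mono) simp
      then show "onorm (\<lambda>h. h *\<^sub>R (\<bar>x\<bar> ^ k *\<^sub>R ddx \<psi> z)) \<le> ?B"
        by (rule onorm_le)
    qed auto
    then have "\<bar>x\<bar> ^ k * norm (\<psi> (x - h) - \<psi> x) \<le> ?B * \<bar>h\<bar>"
      by (simp flip: scaleR_diff_right)
    also have "\<dots> \<le> 2 ^ k * ((Ck + C0) * (1 + \<bar>h\<bar> ^ k)) * \<bar>h\<bar>"
    proof (intro mult_right_mono mult_left_mono)
      show "Ck + \<bar>h\<bar> ^ k * C0 \<le> (Ck + C0) * (1 + \<bar>h\<bar> ^ k)"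
        using n by (simp add: algebra_simps)
    qed auto
    finally show ?thesis by (simp add: mult_ac)
  qed
  then show ?thesis using n by (intro exI[of _ "2 ^ k * (Ck + C0)"]) auto
qed

text \<open>Because the kernel has total mass 1, the error is an average of increments over
  \<open>h / L\<close>. One factor \<open>1 / L\<close> is kept; the remaining power of
  \<open>h / L\<close> is at most that of \<open>h\<close>, as \<open>L \<ge> 1\<close>.\<close>

lemma mollify_seminorm_bound:
  assumes \<kappa>: "\<kappa> \<in> schwartz" and one: "(LINT w|lborel. \<kappa> w) = 1" and \<psi>: "\<psi> \<in> schwartz"
  shows "\<exists>A. \<forall>L\<ge>1. schwartz_seminorm k m (\<lambda>x. mollify \<kappa> L \<psi> x - \<psi> x) \<le> A / L"
proof -
  define \<eta> where "\<eta> = (ddx ^^ m) \<psi>"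
  have \<eta>: "\<eta> \<in> schwartz" unfolding \<eta>_def by (rule schwartz_iter[OF \<psi>])
  obtain A where A: "A \<ge> 0" "\<And>x h. \<bar>x\<bar> ^ k * norm (\<eta> (x - h) - \<eta> x) \<le> A * (\<bar>h\<bar> * (1 + \<bar>h\<bar> ^ k))"
    using schwartz_increment_bound[OF \<eta>] by blast
  obtain C where C: "\<And>x. norm (\<eta> x) \<le> C" using rapid_bounded[OF schwartzD(3)[OF \<eta>]] by blast
  note [measurable] = schwartzD(5)[OF \<kappa>] schwartzD(5)[OF \<eta>]
  define w where "w = (\<lambda>h. norm (\<kappa> h) * (A * (\<bar>h\<bar> * (1 + \<bar>h\<bar> ^ k))))"
  have wi: "integrable lborel w"
  proof -
    have r: "integrable lborel (\<lambda>h. norm (h ^ j *\<^sub>R \<kappa> h))" for j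
      by (intro integrable_norm rapid_integrable rapid_power schwartzD(3)[OF \<kappa>]) measurable
    have "w = (\<lambda>h. A * (norm (h ^ 1 *\<^sub>R \<kappa> h) + norm (h ^ (Suc k) *\<^sub>R \<kappa> h)))"
      unfolding w_def by (auto simp: fun_eq_iff power_abs abs_mult algebra_simps)
    then show ?thesis by (simp only:) (intro integrable_mult_right Bochner_Integration.integrable_add r)
  qed
  have "schwartz_seminorm k m (\<lambda>x. mollify \<kappa> L \<psi> x - \<psi> x) \<le> (LINT h|lborel. w h) / L" if L: "L \<ge> 1" for L
  proof (rule seminorm_le)
    fix x
    have it: "(ddx ^^ m) (\<lambda>x. mollify \<kappa> L \<psi> x - \<psi> x) = (\<lambda>x. mollify \<kappa> L \<eta> x - \<eta> x)"
    proof -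
      have "(ddx ^^ n) (\<lambda>x. mollify \<kappa> L \<psi> x - \<psi> x) = (\<lambda>x. mollify \<kappa> L ((ddx ^^ n) \<psi>) x - (ddx ^^ n) \<psi> x)" for n
      proof (induction n)
        case (Suc n)
        show ?case unfolding funpow.simps comp_def Suc
          by (intro ddx_eqI has_vector_derivative_diff mollify_has_vector_derivative[OF \<kappa>] schwartzD(1) schwartz_iter \<psi>)
      qed simp
      then show ?thesis by (simp add: \<eta>_def)
    qed
    have i1: "integrable lborel (\<lambda>h. \<kappa> h * \<eta> (x - h / L))"
      by (rule integrable_mult_bounded[OF schwartzD(6)[OF \<kappa>] _ C]) measurable
    have i2: "integrable lborel (\<lambda>h. \<kappa> h * \<eta> x)" by (intro integrable_mult_left schwartzD(6)[OF \<kappa>])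
    have "mollify \<kappa> L \<eta> x - \<eta> x = (LINT h|lborel. \<kappa> h * \<eta> (x - h / L)) - (LINT h|lborel. \<kappa> h * \<eta> x)"
      using one by (simp add: mollify_def)
    also have "\<dots> = (LINT h|lborel. \<kappa> h * \<eta> (x - h / L) - \<kappa> h * \<eta> x)"
      using i1 i2 by simp
    also have "\<dots> = (LINT h|lborel. \<kappa> h * (\<eta> (x - h / L) - \<eta> x))" by (simp add: algebra_simps)
    finally have "norm (x ^ k *\<^sub>R (mollify \<kappa> L \<eta> x - \<eta> x)) = norm (LINT h|lborel. x ^ k *\<^sub>R (\<kappa> h * (\<eta> (x - h / L) - \<eta> x)))"
      by simp
    also have "\<dots> \<le> (LINT h|lborel. norm (x ^ k *\<^sub>R (\<kappa> h * (\<eta> (x - h / L) - \<eta> x))))"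
      by (rule integral_norm_bound)
    also have "\<dots> \<le> (LINT h|lborel. w h / L)"
    proof (rule integral_mono)
      show "integrable lborel (\<lambda>h. norm (x ^ k *\<^sub>R (\<kappa> h * (\<eta> (x - h / L) - \<eta> x))))"
        using Bochner_Integration.integrable_diff[OF i1 i2] by (intro integrable_norm integrable_scaleR_right) (simp add: algebra_simps)
      show "integrable lborel (\<lambda>h. w h / L)" using wi by simp
      fix h
      have h: "\<bar>h / L\<bar> \<le> \<bar>h\<bar>" using L by (simp add: divide_le_eq) (metis abs_ge_zero mult_left_mono mult.right_neutral)
      have "norm (x ^ k *\<^sub>R (\<kappa> h * (\<eta> (x - h / L) - \<eta> x))) = norm (\<kappa> h) * (\<bar>x\<bar> ^ k * norm (\<eta> (x - h / L) - \<eta> x))"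
        by (simp add: norm_mult power_abs)
      also have "\<dots> \<le> norm (\<kappa> h) * (A * (\<bar>h / L\<bar> * (1 + \<bar>h / L\<bar> ^ k)))"
        by (intro mult_left_mono A) auto
      also have "\<dots> \<le> norm (\<kappa> h) * (A * (\<bar>h / L\<bar> * (1 + \<bar>h\<bar> ^ k)))"
        using A(1) power_mono[OF h, of k] by (intro mult_left_mono add_left_mono) auto
      also have "\<dots> = w h / L" using L by (simp add: w_def)
      finally show "norm (x ^ k *\<^sub>R (\<kappa> h * (\<eta> (x - h / L) - \<eta> x))) \<le> w h / L" .
    qed
    finally show "norm (x ^ k *\<^sub>R (ddx ^^ m) (\<lambda>x. mollify \<kappa> L \<psi> x - \<psi> x) x) \<le> (LINT h|lborel. w h) / L"
      by (simp add: it)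
  qed
  then show ?thesis by blast
qed

lemma temperedD:
  assumes "u \<in> tempered"
  shows "\<psi> \<notin> schwartz \<Longrightarrow> u \<psi> = 0"
    "\<psi> \<in> schwartz \<Longrightarrow> \<eta> \<in> schwartz \<Longrightarrow> u (\<lambda>x. \<psi> x + \<eta> x) = u \<psi> + u \<eta>"
    "\<psi> \<in> schwartz \<Longrightarrow> u (\<lambda>x. c * \<psi> x) = c * u \<psi>"
    "\<exists>C N. \<forall>\<psi>\<in>schwartz. norm (u \<psi>) \<le> C * (\<Sum>k\<le>N. \<Sum>m\<le>N. schwartz_seminorm k m \<psi>)"
  using assms unfolding tempered_def by simp_all

lemma tempered_diff:
  assumes u: "u \<in> tempered" and S: "\<psi> \<in> schwartz" "\<eta> \<in> schwartz"
  shows "u (\<lambda>x. \<psi> x - \<eta> x) = u \<psi> - u \<eta>"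
proof -
  have "u (\<lambda>x. \<psi> x + - 1 * \<eta> x) = u \<psi> + u (\<lambda>x. - 1 * \<eta> x)"
    by (rule temperedD(2)[OF u S(1) schwartz_cmult[OF S(2)]])
  also have "u (\<lambda>x. - 1 * \<eta> x) = - 1 * u \<eta>" by (rule temperedD(3)[OF u S(2)])
  finally show ?thesis by simp
qed

text \<open>Temperedness bounds \<open>u\<close> by finitely many seminorms, and on the
  mollification error each of them is at most a constant times \<open>1 / 2 ^ J\<close>.\<close>

lemma tempered_mollify_tendsto:
  assumes u: "u \<in> tempered" and \<kappa>: "\<kappa> \<in> schwartz" and one: "(LINT w|lborel. \<kappa> w) = 1" and \<psi>: "\<psi> \<in> schwartz"
    and S: "\<And>J. mollify \<kappa> (2 ^ J) \<psi> \<in> schwartz"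
  shows "(\<lambda>J. u (mollify \<kappa> (2 ^ J) \<psi>)) \<longlonglongrightarrow> u \<psi>"
proof -
  obtain C N where C: "\<And>\<eta>. \<eta> \<in> schwartz \<Longrightarrow> norm (u \<eta>) \<le> C * (\<Sum>k\<le>N. \<Sum>m\<le>N. schwartz_seminorm k m \<eta>)"
    using temperedD(4)[OF u] by blast
  obtain A where A: "\<And>k m L. L \<ge> 1 \<Longrightarrow> schwartz_seminorm k m (\<lambda>x. mollify \<kappa> L \<psi> x - \<psi> x) \<le> A k m / L"
    using mollify_seminorm_bound[OF \<kappa> one \<psi>] by metis
  have b: "norm (u (mollify \<kappa> (2 ^ J) \<psi>) - u \<psi>) \<le> \<bar>C\<bar> * (\<Sum>k\<le>N. \<Sum>m\<le>N. A k m) * (1 / 2) ^ J" for J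
  proof -
    have d: "(\<lambda>x. mollify \<kappa> (2 ^ J) \<psi> x - \<psi> x) \<in> schwartz" by (rule schwartz_minus[OF S \<psi>])
    have "norm (u (mollify \<kappa> (2 ^ J) \<psi>) - u \<psi>) = norm (u (\<lambda>x. mollify \<kappa> (2 ^ J) \<psi> x - \<psi> x))"
      using tempered_diff[OF u S \<psi>] by simp
    also have "\<dots> \<le> C * (\<Sum>k\<le>N. \<Sum>m\<le>N. schwartz_seminorm k m (\<lambda>x. mollify \<kappa> (2 ^ J) \<psi> x - \<psi> x))"
      by (rule C[OF d])
    also have "\<dots> \<le> \<bar>C\<bar> * (\<Sum>k\<le>N. \<Sum>m\<le>N. schwartz_seminorm k m (\<lambda>x. mollify \<kappa> (2 ^ J) \<psi> x - \<psi> x))"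
      by (intro mult_right_mono sum_nonneg seminorm_nonneg d) auto
    also have "\<dots> \<le> \<bar>C\<bar> * (\<Sum>k\<le>N. \<Sum>m\<le>N. A k m / 2 ^ J)"
      by (intro mult_left_mono sum_mono A) auto
    finally show ?thesis by (simp add: sum_divide_distrib[symmetric] power_divide)
  qed
  have t: "(\<lambda>J. \<bar>C\<bar> * (\<Sum>k\<le>N. \<Sum>m\<le>N. A k m) * (1 / 2) ^ J) \<longlonglongrightarrow> 0"
    by (intro tendsto_mult_right_zero LIMSEQ_realpow_zero) auto
  have "(\<lambda>J. u (mollify \<kappa> (2 ^ J) \<psi>) - u \<psi>) \<longlonglongrightarrow> 0"
    by (rule Lim_null_comparison[OF always_eventually[OF allI[OF b]] t])
  then show ?thesis by (simp add: LIM_zero_iff)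
qed

section \<open>Representation by essentially bounded functions\<close>

lemma gauss_pos: "gauss x > 0"
  by (simp add: normal_density_pos)

lemma rapid_gauss: "rapid (\<lambda>x. complex_of_real (gauss x))"
proof (rule rapidI)
  fix k
  have "\<bar>x\<bar> ^ k * norm (complex_of_real (gauss x)) \<le> 1 + (2 * real (Suc k)) ^ Suc k" for x
  proof -
    define y where "y = x\<^sup>2 / 2"
    have y: "y \<ge> 0" by (simp add: y_def)
    \<comment> \<open>The exponential beats powers through
      \<open>exp y \<ge> (1 + y / n) ^ n\<close>, here with \<open>n = Suc k\<close>.\<close>
    have "(y / real (Suc k)) ^ Suc k \<le> (1 + y / real (Suc k)) ^ Suc k"
      using y by (intro power_mono) auto
    also have "\<dots> \<le> exp y" using y by (intro exp_ge_one_plus_x_over_n_power_n) auto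
    finally have "y ^ Suc k \<le> real (Suc k) ^ Suc k * exp y"
      by (simp add: power_divide pos_divide_le_eq mult.commute del: power_Suc of_nat_Suc)
    then have "y ^ Suc k * exp (- y) \<le> real (Suc k) ^ Suc k"
      by (simp add: exp_minus field_simps del: power_Suc of_nat_Suc)
    moreover have "(x\<^sup>2) ^ Suc k = 2 ^ Suc k * y ^ Suc k"
      by (simp add: y_def power_divide del: power_Suc)
    ultimately have 1: "(x\<^sup>2) ^ Suc k * exp (- y) \<le> (2 * real (Suc k)) ^ Suc k"
      by (simp add: power_mult_distrib mult.assoc del: power_Suc of_nat_Suc)
    have "gauss x \<le> exp (- y)"
    proof -
      have "1 \<le> sqrt (2 * pi)" using pi_gt3 by simp
      then have "1 / sqrt (2 * pi) * exp (- y) \<le> 1 * exp (- y)" by (intro mult_right_mono) auto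
      then show ?thesis by (simp add: std_normal_density_def y_def)
    qed
    moreover have "\<bar>x\<bar> ^ k \<le> 1 + (x\<^sup>2) ^ Suc k"
    proof (cases "\<bar>x\<bar> \<le> 1")
      case True
      have "0 \<le> (x\<^sup>2) ^ Suc k" by (rule zero_le_power) simp
      moreover have "\<bar>x\<bar> ^ k \<le> 1" using True by (intro power_le_one) auto
      ultimately show ?thesis by linarith
    next
      case False
      then have "\<bar>x\<bar> ^ k \<le> \<bar>x\<bar> ^ (2 * Suc k)" by (intro power_increasing) auto
      then show ?thesis by (simp only: power_mult power2_abs)
    qed
    ultimately have "\<bar>x\<bar> ^ k * gauss x \<le> (1 + (x\<^sup>2) ^ Suc k) * exp (- y)"
      by (intro mult_mono) (auto simp: normal_density_nonneg)
    also have "\<dots> \<le> 1 + (2 * real (Suc k)) ^ Suc k"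
      using 1 y by (simp add: distrib_right add_mono del: power_Suc of_nat_Suc)
    finally show ?thesis by (simp add: normal_density_nonneg)
  qed
  then show "\<exists>C. \<forall>x. \<bar>x\<bar> ^ k * norm (complex_of_real (gauss x)) \<le> C" by blast
qed

text \<open>Polynomials times the Gaussian, generated by exactly the operations that differentiation
  calls for.\<close>

inductive_set gauss_class :: "(real \<Rightarrow> complex) set" where
  base: "(\<lambda>x. of_real (gauss x)) \<in> gauss_class"
| id: "f \<in> gauss_class \<Longrightarrow> (\<lambda>x. of_real x * f x) \<in> gauss_class"
| cmult: "f \<in> gauss_class \<Longrightarrow> (\<lambda>x. c * f x) \<in> gauss_class"
| add: "f \<in> gauss_class \<Longrightarrow> g \<in> gauss_class \<Longrightarrow> (\<lambda>x. f x + g x) \<in> gauss_class"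

lemma schwartz_gauss: "(\<lambda>x. complex_of_real (gauss x)) \<in> schwartz"
proof (rule schwartz_coinduct[where A=gauss_class])
  fix f assume "f \<in> gauss_class"
  then show "rapid f \<and> (\<exists>f'\<in>gauss_class. \<forall>x. (f has_vector_derivative f' x) (at x))"
  proof induction
    case base
    have d: "((\<lambda>x. complex_of_real (gauss x)) has_vector_derivative (- 1) * (of_real x * of_real (gauss x))) (at x)" for x
    proof -
      have "(gauss has_real_derivative - x * gauss x) (at x)"
        unfolding std_normal_density_def[abs_def]
        by (rule DERIV_cmult[THEN DERIV_cong]) (auto intro!: derivative_eq_intros)
      then show ?thesis using has_vector_derivative_of_real by fastforce
    qed
    show ?case
      by (intro conjI rapid_gauss bexI[OF _ gauss_class.cmult[OF gauss_class.id[OF gauss_class.base], of "-1"]] allI d)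
  next
    case (id f)
    then obtain f' where f': "f' \<in> gauss_class" "\<And>x. (f has_vector_derivative f' x) (at x)" by blast
    have d: "((\<lambda>x. of_real x * f x) has_vector_derivative of_real x * f' x + f x) (at x)" for x
      using has_vector_derivative_mult[OF has_vector_derivative_of_real[OF DERIV_ident] f'(2)[of x]] by simp
    have "rapid f" using id by blast
    then show ?case
      by (intro conjI rapid_mult_id_complex bexI[OF _ gauss_class.add[OF gauss_class.id[OF f'(1)] id(1)]] allI d)
  next
    case (cmult f c)
    then obtain f' where f': "f' \<in> gauss_class" "\<And>x. (f has_vector_derivative f' x) (at x)" by blast
    have d: "((\<lambda>x. c * f x) has_vector_derivative c * f' x) (at x)" for x
      using f'(2) by (rule has_vector_derivative_mult_right)
    have "rapid f" using cmult by blast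
    then have "rapid (\<lambda>x. c * f x)" by (rule rapid_bound[where C="norm c"]) (simp add: norm_mult)
    then show ?case by (intro conjI bexI[OF _ gauss_class.cmult[OF f'(1), of c]] allI d)
  next
    case (add f g)
    then obtain f' g' where f': "f' \<in> gauss_class" "\<And>x. (f has_vector_derivative f' x) (at x)"
      and g': "g' \<in> gauss_class" "\<And>x. (g has_vector_derivative g' x) (at x)" by blast
    have d: "((\<lambda>x. f x + g x) has_vector_derivative f' x + g' x) (at x)" for x
      using f'(2) g'(2) by (rule has_vector_derivative_add)
    have "rapid f" "rapid g" using add by blast+
    then show ?case by (intro conjI rapid_add bexI[OF _ gauss_class.add[OF f'(1) g'(1)]] allI d)
  qed
qed (rule gauss_class.base)

lemma schwartz_modulate:
  assumes "\<psi> \<in> schwartz" shows "(\<lambda>x. cis (t * x) * \<psi> x) \<in> schwartz"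
proof (rule schwartz_coinduct[where A="(\<lambda>\<psi> x. cis (t * x) * \<psi> x) ` schwartz"])
  fix f assume "f \<in> (\<lambda>\<psi> x. cis (t * x) * \<psi> x) ` schwartz"
  then obtain \<psi> where f: "f = (\<lambda>x. cis (t * x) * \<psi> x)" "\<psi> \<in> schwartz" by blast
  have c: "((\<lambda>x. cis (t * x)) has_vector_derivative \<i> * of_real t * cis (t * x)) (at x)" for x
    using cis_linear_has_vector_derivative[of 1 t x] by simp
  have d: "(f has_vector_derivative cis (t * x) * (ddx \<psi> x + \<i> * of_real t * \<psi> x)) (at x)" for x
  proof -
    have "(f has_vector_derivative cis (t * x) * ddx \<psi> x + \<i> * of_real t * cis (t * x) * \<psi> x) (at x)"
      unfolding f(1) by (intro has_vector_derivative_mult schwartzD(1)[OF f(2)] c)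
    then show ?thesis by (simp add: algebra_simps)
  qed
  have r: "rapid f" unfolding f(1)
    by (rule rapid_bound[OF schwartzD(3)[OF f(2)], of _ 1]) (simp add: norm_mult)
  have m: "(\<lambda>x. cis (t * x) * (ddx \<psi> x + \<i> * of_real t * \<psi> x)) \<in> (\<lambda>\<psi> x. cis (t * x) * \<psi> x) ` schwartz"
    by (rule image_eqI[OF refl schwartz_add[OF schwartzD(2)[OF f(2)] schwartz_cmult[OF f(2)]]])
  show "rapid f \<and> (\<exists>f'\<in>(\<lambda>\<psi> x. cis (t * x) * \<psi> x) ` schwartz. \<forall>x. (f has_vector_derivative f' x) (at x))"
    by (intro conjI r bexI[OF _ m] allI d)
qed (use assms in blast)

lemma schwartz_gauss_trig:
  "(\<lambda>x. complex_of_real (cos (t * x) * gauss x)) \<in> schwartz"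
  "(\<lambda>x. complex_of_real (sin (t * x) * gauss x)) \<in> schwartz"
proof -
  have c: "complex_of_real (cos (t * x) * gauss x) = 1 / 2 * (cis (t * x) * of_real (gauss x) + cis (- t * x) * of_real (gauss x))"
    and s: "complex_of_real (sin (t * x) * gauss x) = 1 / (2 * \<i>) * (cis (t * x) * of_real (gauss x) - cis (- t * x) * of_real (gauss x))" for x
    by (simp_all add: complex_eq_iff)
  note m = schwartz_modulate[OF schwartz_gauss]
  show "(\<lambda>x. complex_of_real (cos (t * x) * gauss x)) \<in> schwartz"
    unfolding c by (intro schwartz_cmult schwartz_add m)
  show "(\<lambda>x. complex_of_real (sin (t * x) * gauss x)) \<in> schwartz"
    unfolding s by (intro schwartz_cmult schwartz_minus m)
qed

text \<open>If \<open>\<bar>h\<bar> \<le> M\<close> is orthogonal to all \<open>gauss * cos (t \<cdot>)\<close>, \<open>gauss * sin (t \<cdot>)\<close>, then \<open>(1 + h / M) * gauss\<close> is a probability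
  density with the characteristic function of the standard normal distribution.\<close>

lemma AE_zero_of_trig_moments:
  fixes h :: "real \<Rightarrow> real"
  assumes meas: "h \<in> borel_measurable borel" and bnd: "\<And>x. \<bar>h x\<bar> \<le> M"
    and c: "\<And>t. (LINT x|lborel. h x * (cos (t * x) * gauss x)) = 0"
    and s: "\<And>t. (LINT x|lborel. h x * (sin (t * x) * gauss x)) = 0"
  shows "AE x in lborel. h x = 0"
proof (cases "M > 0")
  case False
  then show ?thesis using bnd by (intro AE_I2) (metis abs_le_zero_iff order_trans not_less)
next
  case M: True
  note [measurable] = meas
  define p where "p x = (1 + h x / M) * gauss x" for x
  have p0: "p x \<ge> 0" for x
  proof -
    have "0 \<le> 1 + h x / M" using bnd[of x] M by (simp add: field_simps abs_le_iff)
    then show ?thesis by (simp add: p_def normal_density_nonneg)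
  qed
  have [measurable]: "p \<in> borel_measurable borel" unfolding p_def by measurable
  have hi: "integrable lborel (\<lambda>x. h x * (r x * gauss x))" if [measurable]: "r \<in> borel_measurable borel" and r: "\<And>x. \<bar>r x\<bar> \<le> 1" for r
  proof (rule Bochner_Integration.integrable_bound[OF integrable_mult_right[OF integrable_gauss, of M]])
    show "AE x in lborel. norm (h x * (r x * gauss x)) \<le> norm (M * gauss x)"
    proof (intro AE_I2)
      fix x
      have "\<bar>h x\<bar> * (\<bar>r x\<bar> * gauss x) \<le> M * (1 * gauss x)"
        using M gauss_pos[of x] by (intro mult_mono bnd r) auto
      then show "norm (h x * (r x * gauss x)) \<le> norm (M * gauss x)"
        using M by (simp add: abs_mult normal_density_nonneg)
    qed
  qed measurable
  have h0: "(LINT x|lborel. h x * gauss x) = 0" "integrable lborel (\<lambda>x. h x * gauss x)"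
    using c[of 0] hi[of "\<lambda>_. 1"] by simp_all
  have pe: "p x = gauss x + h x * gauss x / M" for x by (simp add: p_def algebra_simps)
  have pi: "integrable lborel p" and p1: "(LINT x|lborel. p x) = 1"
    unfolding pe using h0 integrable_gauss by (simp_all add: integral_gauss)
  have "density lborel p = density lborel gauss"
  proof (rule Levy_uniqueness)
    show "real_distribution (density lborel (\<lambda>x. ennreal (gauss x)))"
      by (simp add: real_distribution_def real_distribution_axioms_def prob_space_normal_density)
    have "prob_space (density lborel p)"
      by standard (simp add: emeasure_density nn_integral_eq_integral[OF pi] p0 p1)
    then show "real_distribution (density lborel (\<lambda>x. ennreal (p x)))"
      by (simp add: real_distribution_def real_distribution_axioms_def)
    show "char (density lborel p) = char (density lborel gauss)"
    proof
      fix t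
      have "char (density lborel p) t = (LINT x|lborel. p x *\<^sub>R iexp (t * x))"
        unfolding char_def using p0 by (subst integral_density) auto
      also have "\<dots> = (LINT x|lborel. gauss x *\<^sub>R iexp (t * x) +
          (of_real (h x * (cos (t * x) * gauss x)) + \<i> * of_real (h x * (sin (t * x) * gauss x))) / of_real M)"
      proof (rule Bochner_Integration.integral_cong[OF refl])
        fix x
        have "iexp (t * x) = cis (t * x)" by (simp add: cis_conv_exp)
        then show "p x *\<^sub>R iexp (t * x) = gauss x *\<^sub>R iexp (t * x) +
          (of_real (h x * (cos (t * x) * gauss x)) + \<i> * of_real (h x * (sin (t * x) * gauss x))) / of_real M"
          using M by (simp only:) (simp add: pe complex_eq_iff cis.ctr field_simps)
      qed
      also have "\<dots> = (LINT x|lborel. gauss x *\<^sub>R iexp (t * x))"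
      proof -
        have "integrable lborel (\<lambda>x. gauss x *\<^sub>R iexp (t * x))"
          by (rule Bochner_Integration.integrable_bound[OF integrable_gauss]) (auto simp: normal_density_nonneg)
        moreover have "integrable lborel (\<lambda>x. complex_of_real (h x * (cos (t * x) * gauss x)))"
            "integrable lborel (\<lambda>x. complex_of_real (h x * (sin (t * x) * gauss x)))"
          by (intro integrable_of_real hi; simp)+
        ultimately show ?thesis using c[of t] s[of t]
          by (simp del: of_real_mult)
      qed
      also have "\<dots> = char (density lborel gauss) t"
        unfolding char_def by (subst integral_density) (auto simp: normal_density_nonneg)
      finally show "char (density lborel p) t = char (density lborel gauss) t" .
    qed
  qed
  then have "AE x in lborel. ennreal (p x) = ennreal (gauss x)"
    by (subst (asm) sigma_finite_measure.density_unique_iff[OF sigma_finite_lborel]) auto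
  then show ?thesis
  proof (eventually_elim)
    case (elim x)
    then have "p x = gauss x" using p0[of x] by (simp add: normal_density_nonneg)
    then show ?case using M gauss_pos[of x] by (simp add: pe)
  qed
qed

text \<open>Restricted to real test functions because \<open>real_valued\<close> speaks of no
  others. Against them the real and imaginary parts of \<open>g\<close> integrate to 0
  separately.\<close>

lemma AE_zero_of_real_tests:
  assumes meas: "g \<in> borel_measurable borel" and bnd: "\<And>x. norm (g x) \<le> M"
    and z: "\<And>\<psi>. \<psi> \<in> schwartz \<Longrightarrow> range \<psi> \<subseteq> \<real> \<Longrightarrow> (LINT x|lborel. g x * \<psi> x) = 0"
  shows "AE x in lborel. g x = (0::complex)"
proof -
  have *: "(LINT x|lborel. Re (g x) * r x) = 0" "(LINT x|lborel. Im (g x) * r x) = 0"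
    if r: "(\<lambda>x. complex_of_real (r x)) \<in> schwartz" for r
  proof -
    have i: "integrable lborel (\<lambda>x. g x * of_real (r x))"
      using integrable_mult_bounded[OF schwartzD(6)[OF r] meas bnd] by (simp add: mult.commute)
    have 0: "(LINT x|lborel. g x * of_real (r x)) = 0" by (rule z[OF r]) auto
    show "(LINT x|lborel. Re (g x) * r x) = 0" using integral_Re[OF i] 0 by simp
    show "(LINT x|lborel. Im (g x) * r x) = 0" using integral_Im[OF i] 0 by simp
  qed
  have "AE x in lborel. Re (g x) = 0"
    by (rule AE_zero_of_trig_moments[of _ M])
      (use meas *(1)[OF schwartz_gauss_trig(1)] *(1)[OF schwartz_gauss_trig(2)] order_trans[OF abs_Re_le_cmod bnd] in auto)
  moreover have "AE x in lborel. Im (g x) = 0"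
    by (rule AE_zero_of_trig_moments[of _ M])
      (use meas *(2)[OF schwartz_gauss_trig(1)] *(2)[OF schwartz_gauss_trig(2)] order_trans[OF abs_Im_le_cmod bnd] in auto)
  ultimately show ?thesis by eventually_elim (simp add: complex_eq_iff)
qed

section \<open>Distributions given by bounded functions\<close>

lemma regular_distr_apply: "\<psi> \<in> schwartz \<Longrightarrow> regular_distr g \<psi> = (LINT x|lborel. g x * \<psi> x)"
  by (simp add: regular_distr_def mk_distr_def)

lemma regular_distr_off: "\<psi> \<notin> schwartz \<Longrightarrow> regular_distr g \<psi> = 0"
  by (simp add: regular_distr_def mk_distr_def)

lemma regular_distr_AE_cong:
  assumes [measurable]: "f \<in> borel_measurable borel" "g \<in> borel_measurable borel" and "AE x in lborel. f x = g x"
  shows "regular_distr f = regular_distr g"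
proof
  fix \<psi> show "regular_distr f \<psi> = regular_distr g \<psi>"
  proof (cases "\<psi> \<in> schwartz")
    case True
    note [measurable] = schwartzD(5)[OF True]
    show ?thesis unfolding regular_distr_apply[OF True]
      by (rule integral_cong_AE) (use assms(3) in auto)
  qed (simp add: regular_distr_off)
qed

lemma integrable_regular:
  assumes "g \<in> borel_measurable borel" "\<And>x. norm (g x) \<le> M" "\<psi> \<in> schwartz"
  shows "integrable lborel (\<lambda>x. g x * \<psi> x)"
  using integrable_mult_bounded[OF schwartzD(6)[OF assms(3)] assms(1,2)] by (simp add: mult.commute)

lemma regular_distr_unique:
  assumes f: "f \<in> borel_measurable borel" "\<And>x. norm (f x) \<le> M"
    and g: "g \<in> borel_measurable borel" "\<And>x. norm (g x) \<le> N"
    and eq: "\<And>\<psi>. \<psi> \<in> schwartz \<Longrightarrow> range \<psi> \<subseteq> \<real> \<Longrightarrow> regular_distr f \<psi> = regular_distr g \<psi>"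
  shows "AE x in lborel. f x = g x"
proof -
  have "AE x in lborel. f x - g x = 0"
  proof (rule AE_zero_of_real_tests[where M="M + N"])
    show "norm (f x - g x) \<le> M + N" for x using norm_triangle_ineq4[of "f x" "g x"] f(2)[of x] g(2)[of x] by linarith
    fix \<psi> assume \<psi>: "\<psi> \<in> schwartz" "range \<psi> \<subseteq> \<real>"
    show "(LINT x|lborel. (f x - g x) * \<psi> x) = 0"
      using eq[OF \<psi>] integrable_regular[OF f \<psi>(1)] integrable_regular[OF g \<psi>(1)]
      by (simp add: regular_distr_apply[OF \<psi>(1)] left_diff_distrib)
  qed (use f g in auto)
  then show ?thesis by simp
qed

text \<open>The set where the functions agree is closed and of full measure, hence
  everything.\<close>

lemma AE_eq_continuous:
  fixes f g :: "real \<Rightarrow> complex"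
  assumes "continuous_on UNIV f" "continuous_on UNIV g" "AE x in lborel. f x = g x"
  shows "f = g"
proof
  fix x
  have "closed {x. f x = g x}" by (rule closed_Collect_eq[OF assms(1,2)])
  then show "f x = g x"
    using mem_closed_if_AE_lebesgue[of "{x. f x = g x}" x] AE_completion[OF assms(3)] by simp
qed

text \<open>Setting \<open>g\<close> to 0 on the null set where it exceeds its essential bound gives
  a representative that obeys the bound at every point, the form in which all later integrability
  lemmas take it.\<close>

lemma represents_bounded:
  assumes "represents g u"
  obtains g' where "g' \<in> borel_measurable borel" "\<And>x. norm (g' x) \<le> enn2real (Linf_norm_fun g)"
    "AE x in lborel. g x = g' x" "u = regular_distr g'"
proof -
  have m: "g \<in> borel_measurable borel" and fin: "Linf_norm_fun g < \<infinity>" and u: "u = regular_distr g"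
    using assms by (auto simp: represents_def)
  define g' where "g' x = (if norm (g x) \<le> enn2real (Linf_norm_fun g) then g x else 0)" for x
  have m': "g' \<in> borel_measurable borel" unfolding g'_def using m by measurable
  have "AE x in lborel. ennreal (norm (g x)) \<le> Linf_norm_fun g"
    unfolding Linf_norm_fun_def by (rule esssup_AE)
  then have ae: "AE x in lborel. g x = g' x"
  proof eventually_elim
    case (elim x)
    then have "norm (g x) \<le> enn2real (Linf_norm_fun g)"
      using fin by (metis enn2real_ennreal enn2real_mono infinity_ennreal_def norm_ge_zero)
    then show ?case by (simp add: g'_def)
  qed
  show thesis
    by (rule that[OF m' _ ae]) (simp_all add: g'_def[symmetric] u regular_distr_AE_cong[OF m m' ae], simp add: g'_def)
qed

text \<open>Makes the infimum in \<open>Linf_norm\<close> and the choices in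
  \<open>prod_distr\<close> independent of the representative.\<close>

lemma represents_unique:
  assumes "represents f u" "represents g u" shows "AE x in lborel. f x = g x"
proof -
  obtain f' where f': "f' \<in> borel_measurable borel" "\<And>x. norm (f' x) \<le> enn2real (Linf_norm_fun f)"
    "AE x in lborel. f x = f' x" "u = regular_distr f'" using represents_bounded[OF assms(1)] by metis
  obtain g' where g': "g' \<in> borel_measurable borel" "\<And>x. norm (g' x) \<le> enn2real (Linf_norm_fun g)"
    "AE x in lborel. g x = g' x" "u = regular_distr g'" using represents_bounded[OF assms(2)] by metis
  have "AE x in lborel. f' x = g' x"
    by (rule regular_distr_unique[OF f'(1,2) g'(1,2)]) (use f'(4) g'(4) in simp)
  then show ?thesis using f'(3) g'(3) by eventually_elim simp
qed

lemma Linf_norm_eq: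
  assumes "represents g u" shows "Linf_norm u = Linf_norm_fun g"
proof -
  have *: "Linf_norm_fun f = Linf_norm_fun g" if f: "represents f u" for f
    unfolding Linf_norm_fun_def using represents_unique[OF f assms]
    by (intro esssup_AE_cong) (use f assms in \<open>auto simp: represents_def\<close>)
  show ?thesis unfolding Linf_norm_def
  proof (rule antisym)
    show "(INF g\<in>{g. represents g u}. Linf_norm_fun g) \<le> Linf_norm_fun g"
      by (rule INF_lower) (simp add: assms)
    show "Linf_norm_fun g \<le> (INF g\<in>{g. represents g u}. Linf_norm_fun g)"
      by (rule INF_greatest) (simp add: *)
  qed
qed

lemma representsI:
  assumes "g \<in> borel_measurable borel" "\<And>x. norm (g x) \<le> M" "u = regular_distr g"
  shows "represents g u" "Linf_norm u \<le> ennreal M"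
proof -
  have le: "Linf_norm_fun g \<le> ennreal M" unfolding Linf_norm_fun_def
    using assms(1,2) by (intro esssup_I) (auto intro!: AE_I2 ennreal_leI)
  then show r: "represents g u"
    using assms by (auto simp: represents_def intro: le_less_trans)
  show "Linf_norm u \<le> ennreal M" using Linf_norm_eq[OF r] le by simp
qed

lemma Linf_norm_finite_obtain:
  assumes "Linf_norm u < \<infinity>"
  obtains g where "g \<in> borel_measurable borel" "\<And>x. norm (g x) \<le> enn2real (Linf_norm u)" "u = regular_distr g"
proof -
  \<comment> \<open>An infimum over the empty set is infinite, so finiteness provides a
    representative.\<close>
  obtain f where f: "represents f u"
    using assms unfolding Linf_norm_def INF_less_iff by blast
  show thesis using represents_bounded[OF f] that unfolding Linf_norm_eq[OF f] by metis
qed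

lemma regular_distr_add:
  assumes f: "f \<in> borel_measurable borel" "\<And>x. norm (f x) \<le> M" and g: "g \<in> borel_measurable borel" "\<And>x. norm (g x) \<le> N"
  shows "regular_distr f + regular_distr g = regular_distr (\<lambda>x. f x + g x)"
proof
  fix \<psi> show "(regular_distr f + regular_distr g) \<psi> = regular_distr (\<lambda>x. f x + g x) \<psi>"
    using integrable_regular[OF f] integrable_regular[OF g]
    by (cases "\<psi> \<in> schwartz") (simp_all add: regular_distr_apply regular_distr_off distrib_right)
qed

lemma regular_distr_diff:
  assumes f: "f \<in> borel_measurable borel" "\<And>x. norm (f x) \<le> M" and g: "g \<in> borel_measurable borel" "\<And>x. norm (g x) \<le> N"
  shows "regular_distr f - regular_distr g = regular_distr (\<lambda>x. f x - g x)"
proof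
  fix \<psi> show "(regular_distr f - regular_distr g) \<psi> = regular_distr (\<lambda>x. f x - g x) \<psi>"
    using integrable_regular[OF f] integrable_regular[OF g]
    by (cases "\<psi> \<in> schwartz") (simp_all add: regular_distr_apply regular_distr_off left_diff_distrib)
qed

lemma regular_distr_scale: "scale_distr c (regular_distr f) = regular_distr (\<lambda>x. of_real c * f x)"
proof
  fix \<psi> show "scale_distr c (regular_distr f) \<psi> = regular_distr (\<lambda>x. of_real c * f x) \<psi>"
    by (cases "\<psi> \<in> schwartz") (simp_all add: scale_distr_def regular_distr_apply regular_distr_off mult.assoc)
qed

lemma Linf_norm_triangle: "Linf_norm (u + v) \<le> Linf_norm u + Linf_norm v"
proof (cases "Linf_norm u < \<infinity> \<and> Linf_norm v < \<infinity>")
  case True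
  obtain f where f: "f \<in> borel_measurable borel" "\<And>x. norm (f x) \<le> enn2real (Linf_norm u)" "u = regular_distr f"
    using Linf_norm_finite_obtain True by metis
  obtain g where g: "g \<in> borel_measurable borel" "\<And>x. norm (g x) \<le> enn2real (Linf_norm v)" "v = regular_distr g"
    using Linf_norm_finite_obtain True by metis
  have "Linf_norm (u + v) \<le> ennreal (enn2real (Linf_norm u) + enn2real (Linf_norm v))"
  proof (rule representsI(2))
    show "(\<lambda>x. f x + g x) \<in> borel_measurable borel" using f(1) g(1) by simp
    show "norm (f x + g x) \<le> enn2real (Linf_norm u) + enn2real (Linf_norm v)" for x
      by (rule order_trans[OF norm_triangle_ineq add_mono[OF f(2) g(2)]])
    have "regular_distr f + regular_distr g = regular_distr (\<lambda>x. f x + g x)"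
      by (rule regular_distr_add[OF f(1,2) g(1,2)])
    then show "u + v = regular_distr (\<lambda>x. f x + g x)" using f(3) g(3) by simp
  qed
  also have "\<dots> = Linf_norm u + Linf_norm v" using True by (simp add: ennreal_plus)
  finally show ?thesis .
next
  case False
  then have "Linf_norm u + Linf_norm v = \<top>" by (auto simp: less_top[symmetric])
  then show ?thesis by (metis top_greatest)
qed

section \<open>Littlewood--Paley decomposition and embeddings\<close>

locale lp_pair =
  fixes chi phi :: "real \<Rightarrow> real"
  assumes lp: "littlewood_paley chi phi"
begin

lemma chi_smooth: "smooth chi" and phi_smooth: "smooth phi"
  and chi_range: "chi \<xi> \<in> {0..1}" and phi_range: "phi \<xi> \<in> {0..1}"
  and chi_even: "chi (- \<xi>) = chi \<xi>" and phi_even: "phi (- \<xi>) = phi \<xi>"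
  and partition: "chi \<xi> + (\<Sum>j. phi (\<xi> / 2 ^ j)) = 1"
  using lp by (auto simp: littlewood_paley_def)

lemma chi_zero: "\<bar>\<xi>\<bar> > 4 / 3 \<Longrightarrow> chi \<xi> = 0"
proof (rule ccontr)
  assume "\<bar>\<xi>\<bar> > 4 / 3" "chi \<xi> \<noteq> 0"
  then have "\<xi> \<in> closure {\<xi>. chi \<xi> \<noteq> 0}" by (intro subsetD[OF closure_subset]) simp
  then show False using lp \<open>\<bar>\<xi>\<bar> > 4 / 3\<close> by (auto simp: littlewood_paley_def)
qed

lemma phi_zero: assumes "\<bar>\<xi>\<bar> > 8 / 3 \<or> \<bar>\<xi>\<bar> < 3 / 4" shows "phi \<xi> = 0"
proof (rule ccontr)
  assume "phi \<xi> \<noteq> 0"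
  then have "\<xi> \<in> closure {\<xi>. phi \<xi> \<noteq> 0}" by (intro subsetD[OF closure_subset]) simp
  moreover have "closure {\<xi>. phi \<xi> \<noteq> 0} \<subseteq> {\<xi>. 3 / 4 \<le> \<bar>\<xi>\<bar> \<and> \<bar>\<xi>\<bar> \<le> 8 / 3}"
    using lp by (simp add: littlewood_paley_def)
  ultimately have "3 / 4 \<le> \<bar>\<xi>\<bar> \<and> \<bar>\<xi>\<bar> \<le> 8 / 3" by blast
  then show False using assms by auto
qed

lemma summable_phi: "summable (\<lambda>j. phi (\<xi> / 2 ^ j))"
proof -
  have l: "(\<lambda>j. \<bar>\<xi>\<bar> * (1 / 2) ^ j) \<longlonglongrightarrow> 0"
    by (intro tendsto_mult_right_zero LIMSEQ_realpow_zero) auto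
  have "eventually (\<lambda>j. \<bar>\<xi>\<bar> * (1 / 2) ^ j < 3 / 4) sequentially"
    by (rule order_tendstoD(2)[OF l]) simp
  then have "eventually (\<lambda>j. phi (\<xi> / 2 ^ j) = 0) sequentially"
    by (rule eventually_mono) (auto intro!: phi_zero simp: power_divide)
  then show ?thesis using summable_cong summable_zero by fastforce
qed

text \<open>The partitions of unity at \<open>\<xi>\<close> and at \<open>\<xi> / 2\<close> differ
  by a shift of the index, so only the leading term survives the comparison. This makes sums of
  blocks telescope into a single dilated \<open>chi\<close>.\<close>

lemma chi_half: "chi (\<xi> / 2) = chi \<xi> + phi \<xi>"
proof -
  have "(\<Sum>j. phi (\<xi> / 2 / 2 ^ j)) = (\<Sum>j. phi (\<xi> / 2 ^ Suc j))" by simp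
  also have "\<dots> = (\<Sum>j. phi (\<xi> / 2 ^ j)) - phi (\<xi> / 2 ^ 0)"
    by (rule suminf_split_head[OF summable_phi])
  finally show ?thesis using partition[of \<xi>] partition[of "\<xi> / 2"] by simp
qed

lemma chi_one: assumes "\<bar>\<xi>\<bar> < 3 / 4" shows "chi \<xi> = 1"
proof -
  have "phi (\<xi> / 2 ^ j) = 0" for j
  proof (rule phi_zero, rule disjI2)
    have "\<bar>\<xi>\<bar> / 2 ^ j \<le> \<bar>\<xi>\<bar> / 1" by (intro divide_left_mono) auto
    then have "\<bar>\<xi>\<bar> / 2 ^ j < 3 / 4" using assms by linarith
    then show "\<bar>\<xi> / 2 ^ j\<bar> < 3 / 4" by (simp only: abs_divide power_abs abs_numeral)
  qed
  then show ?thesis using partition[of \<xi>] by simp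
qed

text \<open>Index \<open>k\<close> stands for the block \<open>j = k - 1\<close>, as in the
  summation of \<open>besov_norm\<close>; the truncated subtraction is evaluated only for
  \<open>k > 0\<close>.\<close>

definition lp_mult :: "nat \<Rightarrow> real \<Rightarrow> real" where
  "lp_mult k \<xi> = (if k = 0 then chi \<xi> else phi (\<xi> / 2 ^ (k - 1)))"

lemma lp_mult_smooth: "smooth (lp_mult k)"
proof (cases k)
  case 0 then show ?thesis using chi_smooth by (simp add: lp_mult_def[abs_def])
next
  case (Suc i)
  then show ?thesis using smooth_dilate[OF phi_smooth, of "1 / 2 ^ i"] by (simp add: lp_mult_def[abs_def])
qed

lemma lp_mult_zero: assumes "\<bar>\<xi>\<bar> > 4 / 3 * 2 ^ k" shows "lp_mult k \<xi> = 0"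
proof (cases k)
  case 0 then show ?thesis using chi_zero assms by (simp add: lp_mult_def)
next
  case (Suc i)
  then have "\<bar>\<xi> / 2 ^ i\<bar> > 8 / 3" using assms by (simp add: field_simps)
  then show ?thesis using Suc phi_zero by (simp add: lp_mult_def)
qed

lemma lp_mult_range: "0 \<le> lp_mult k \<xi>" "lp_mult k \<xi> \<le> 1"
  using chi_range phi_range by (auto simp: lp_mult_def)

lemma lp_mult_even: "lp_mult k (- \<xi>) = lp_mult k \<xi>"
  using chi_even phi_even by (simp add: lp_mult_def)

text \<open>The multiplier vanishes beyond \<open>4 / 3 * 2 ^ k\<close>, while the wider cut-off is
  1 up to \<open>3 / 2 * 2 ^ k\<close>. By this reproducing property a block can be smoothed without
  being changed.\<close>

lemma lp_mult_chi: "lp_mult k \<xi> * chi (\<xi> / 2 ^ Suc k) = lp_mult k \<xi>"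
proof (cases "\<bar>\<xi>\<bar> > 4 / 3 * 2 ^ k")
  case True then show ?thesis using lp_mult_zero by simp
next
  case False
  moreover have "(0::real) < 2 ^ k" by simp
  ultimately have "\<bar>\<xi>\<bar> < 3 / 2 * 2 ^ k" by linarith
  then have "chi (\<xi> / 2 ^ Suc k) = 1" by (intro chi_one) (simp add: field_simps)
  then show ?thesis by simp
qed

lemma chi_Suc: "chi (\<xi> / 2 ^ Suc J) = chi (\<xi> / 2 ^ J) + lp_mult (Suc J) \<xi>"
  using chi_half[of "\<xi> / 2 ^ J"] by (simp add: lp_mult_def mult.commute)

text \<open>The action of a block on test functions. Duality reverses the order of the three
  operations, which puts \<open>inv_fourier\<close> first and \<open>fourier\<close> last.\<close>

definition fourier_mult :: "(real \<Rightarrow> real) \<Rightarrow> (real \<Rightarrow> complex) \<Rightarrow> real \<Rightarrow> complex" where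
  "fourier_mult m \<psi> = fourier (\<lambda>\<xi>. of_real (m \<xi>) * inv_fourier \<psi> \<xi>)"

lemma lp_mult_inv_fourier_schwartz:
  "\<psi> \<in> schwartz \<Longrightarrow> (\<lambda>\<xi>. of_real (lp_mult k \<xi>) * inv_fourier \<psi> \<xi>) \<in> schwartz"
  by (rule schwartz_mult_compact_support[OF lp_mult_smooth lp_mult_zero inv_fourier_schwartz])

lemma fourier_mult_mul_schwartz: "\<psi> \<in> schwartz \<Longrightarrow> fourier_mult (lp_mult k) \<psi> \<in> schwartz"
  unfolding fourier_mult_def by (intro fourier_schwartz lp_mult_inv_fourier_schwartz)

lemma lp_block_mul: "lp_block chi phi (int k - 1) u = mk_distr (\<lambda>\<psi>. u (fourier_mult (lp_mult k) \<psi>))"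
proof -
  have *: "inv_fourier_distr (mult_distr (lp_mult k) (fourier_distr u)) = mk_distr (\<lambda>\<psi>. u (fourier_mult (lp_mult k) \<psi>))"
    unfolding inv_fourier_distr_def mult_distr_def fourier_distr_def
    by (auto simp: mk_distr_def fun_eq_iff fourier_mult_def inv_fourier_schwartz lp_mult_inv_fourier_schwartz)
  show ?thesis
  proof (cases k)
    case 0
    have "lp_mult 0 = chi" by (auto simp: lp_mult_def)
    then show ?thesis using * 0 by (simp add: lp_block_def)
  next
    case (Suc i)
    have "lp_mult (Suc i) = (\<lambda>\<xi>. phi (2 powr (- of_int (int i)) * \<xi>))"
      by (auto simp: lp_mult_def fun_eq_iff powr_minus powr_realpow divide_inverse mult.commute)
    then show ?thesis using * Suc by (simp add: lp_block_def)
  qed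
qed

lemma lp_block_apply:
  "\<psi> \<in> schwartz \<Longrightarrow> lp_block chi phi (int k - 1) u \<psi> = u (fourier_mult (lp_mult k) \<psi>)"
  "\<psi> \<notin> schwartz \<Longrightarrow> lp_block chi phi (int k - 1) u \<psi> = 0"
  by (simp_all add: lp_block_mul mk_distr_def)

lemma lp_block_add: "lp_block chi phi (int k - 1) (u + v) = lp_block chi phi (int k - 1) u + lp_block chi phi (int k - 1) v"
  by (auto simp: lp_block_mul mk_distr_def fun_eq_iff)

text \<open>The inverse transform of \<open>chi\<close>, written with \<open>fourier\<close> because
  \<open>fourier_mult_inv_fourier\<close> produces it so; the two agree as \<open>chi\<close> is
  even. The total mass is \<open>chi 0 = 1\<close>.\<close>

definition chi_kernel :: "real \<Rightarrow> complex" where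
  "chi_kernel x = 1 / (2 * of_real pi) * fourier (\<lambda>\<xi>. of_real (chi \<xi>)) x"

lemma chi_schwartz: "(\<lambda>\<xi>. complex_of_real (chi \<xi>)) \<in> schwartz"
  by (rule schwartz_compact_support[OF chi_smooth chi_zero])

lemma chi_kernel_schwartz: "chi_kernel \<in> schwartz"
  unfolding chi_kernel_def[abs_def] by (intro schwartz_cmult fourier_schwartz chi_schwartz)

lemma chi_kernel_integral: "(LINT w|lborel. chi_kernel w) = 1"
proof -
  have "(LINT w|lborel. chi_kernel w) = inv_fourier (fourier (\<lambda>\<xi>. of_real (chi \<xi>))) 0"
    by (simp add: chi_kernel_def inv_fourier_def)
  also have "\<dots> = of_real (chi 0)" using inv_fourier_fourier[OF chi_schwartz] by simp
  finally show ?thesis by (simp add: chi_one)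
qed

definition chi_kernel_at :: "real \<Rightarrow> real \<Rightarrow> complex" where
  "chi_kernel_at L x = of_real L * chi_kernel (L * x)"

lemma chi_kernel_at_schwartz: "L > 0 \<Longrightarrow> chi_kernel_at L \<in> schwartz"
  unfolding chi_kernel_at_def[abs_def] by (intro schwartz_cmult schwartz_dilate chi_kernel_schwartz) simp

lemma integral_dilate:
  fixes f :: "real \<Rightarrow> 'a::{banach, second_countable_topology}"
  assumes "L > 0" shows "(LINT x|lborel. L *\<^sub>R f (L * x)) = (LINT x|lborel. f x)"
  using lborel_integral_real_affine[of L f 0] assms by simp

lemma chi_kernel_at_L1:
  assumes "L > 0" shows "(LINT x|lborel. norm (chi_kernel_at L x)) = (LINT x|lborel. norm (chi_kernel x))"
proof -
  have "(LINT x|lborel. norm (chi_kernel_at L x)) = (LINT x|lborel. L *\<^sub>R norm (chi_kernel (L * x)))"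
    using assms by (simp add: chi_kernel_at_def norm_mult)
  also have "\<dots> = (LINT x|lborel. norm (chi_kernel x))" by (rule integral_dilate[OF assms])
  finally show ?thesis .
qed

lemma chi_kernel_at_ddx_L1:
  assumes "L > 0" shows "(LINT x|lborel. norm (ddx (chi_kernel_at L) x)) = L * (LINT x|lborel. norm (ddx chi_kernel x))"
proof -
  have "(chi_kernel_at L has_vector_derivative of_real (L * L) * ddx chi_kernel (L * x)) (at x)" for x
  proof -
    have "((\<lambda>x. of_real L * chi_kernel (L * x)) has_vector_derivative of_real L * (of_real L * ddx chi_kernel (L * x))) (at x)"
      by (intro has_vector_derivative_mult_right schwartz_chain[OF chi_kernel_schwartz] DERIV_cmult_Id)
    then show ?thesis by (simp add: chi_kernel_at_def[abs_def] mult.assoc)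
  qed
  then have "ddx (chi_kernel_at L) = (\<lambda>x. of_real (L * L) * ddx chi_kernel (L * x))" by (rule ddx_eqI)
  then have "(LINT x|lborel. norm (ddx (chi_kernel_at L) x)) = (LINT x|lborel. L *\<^sub>R (L * norm (ddx chi_kernel (L * x))))"
    using assms by (simp add: norm_mult mult.assoc)
  also have "\<dots> = (LINT x|lborel. L * norm (ddx chi_kernel x))" by (rule integral_dilate[OF assms])
  finally show ?thesis by simp
qed

lemma mollify_chi_kernel_at:
  assumes "L > 0" shows "mollify chi_kernel L \<psi> x = (LINT y|lborel. chi_kernel_at L (x - y) * \<psi> y)"
proof -
  have "(LINT y|lborel. chi_kernel_at L (x - y) * \<psi> y) =
     \<bar>- 1 / L\<bar> *\<^sub>R (LINT w|lborel. chi_kernel_at L (x - (x + (- 1 / L) * w)) * \<psi> (x + (- 1 / L) * w))"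
    using assms by (intro lborel_integral_real_affine) simp
  also have "\<dots> = (LINT w|lborel. (1 / L) *\<^sub>R (chi_kernel_at L (x - (x + (- 1 / L) * w)) * \<psi> (x + (- 1 / L) * w)))"
    using assms by simp
  also have "\<dots> = mollify chi_kernel L \<psi> x" unfolding mollify_def
    by (rule Bochner_Integration.integral_cong[OF refl]) (use assms in \<open>simp add: chi_kernel_at_def scaleR_conv_of_real\<close>)
  finally show ?thesis by simp
qed

lemma chi_dilate_schwartz: "L > 0 \<Longrightarrow> (\<lambda>\<xi>. complex_of_real (chi (\<xi> / L))) \<in> schwartz"
  using schwartz_dilate[OF chi_schwartz, of "1 / L"] by simp

lemma chi_dilate_inv_fourier_schwartz:
  assumes "L > 0" "\<psi> \<in> schwartz" shows "(\<lambda>\<xi>. of_real (chi (\<xi> / L)) * inv_fourier \<psi> \<xi>) \<in> schwartz"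
proof (rule schwartz_mult_compact_support[OF _ _ inv_fourier_schwartz[OF assms(2)]])
  show "smooth (\<lambda>\<xi>. chi (\<xi> / L))" using smooth_dilate[OF chi_smooth, of "1 / L"] by simp
  show "chi (\<xi> / L) = 0" if "\<bar>\<xi>\<bar> > 4 / 3 * L" for \<xi>
    using that assms(1) by (intro chi_zero) (simp add: field_simps)
qed

text \<open>Dilating the multiplier by \<open>L\<close> compresses its kernel to
  \<open>chi_kernel_at L\<close> with the same L1 norm, so a frequency cut-off becomes a
  mollification.\<close>

lemma fourier_mult_chi:
  assumes L: "L > 0" and \<psi>: "\<psi> \<in> schwartz" shows "fourier_mult (\<lambda>\<xi>. chi (\<xi> / L)) \<psi> = mollify chi_kernel L \<psi>"
proof
  fix x
  have "fourier (\<lambda>\<xi>. of_real (chi (\<xi> / L))) z / (2 * of_real pi) = chi_kernel_at L z" for z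
  proof -
    have "fourier (\<lambda>\<xi>. of_real (chi (\<xi> / L))) z =
      \<bar>L\<bar> *\<^sub>R (LINT \<xi>|lborel. cis (- ((0 + L * \<xi>) * z)) * of_real (chi ((0 + L * \<xi>) / L)))"
      unfolding fourier_def using L by (intro lborel_integral_real_affine) simp
    also have "\<dots> = of_real L * fourier (\<lambda>\<xi>. of_real (chi \<xi>)) (L * z)"
      using L by (simp add: fourier_def scaleR_conv_of_real mult_ac)
    finally show ?thesis by (simp add: chi_kernel_at_def chi_kernel_def)
  qed
  then show "fourier_mult (\<lambda>\<xi>. chi (\<xi> / L)) \<psi> x = mollify chi_kernel L \<psi> x"
    using fourier_mult_inv_fourier[OF schwartzD(6)[OF chi_dilate_schwartz[OF L]] \<psi>, of x]
    by (simp add: fourier_mult_def mollify_chi_kernel_at[OF L])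
qed

lemma mollify_schwartz: "L > 0 \<Longrightarrow> \<psi> \<in> schwartz \<Longrightarrow> mollify chi_kernel L \<psi> \<in> schwartz"
  unfolding fourier_mult_chi[symmetric] unfolding fourier_mult_def
  by (intro fourier_schwartz chi_dilate_inv_fourier_schwartz)

text \<open>The form in which \<open>lp_mult_chi\<close> is used: on the frequency side, this
  mollification multiplies by the wider cut-off.\<close>

lemma fourier_mult_mollify:
  assumes \<psi>: "\<psi> \<in> schwartz" shows "fourier_mult (lp_mult k) (mollify chi_kernel (2 ^ Suc k) \<psi>) = fourier_mult (lp_mult k) \<psi>"
proof -
  have "inv_fourier (mollify chi_kernel (2 ^ Suc k) \<psi>) = (\<lambda>\<xi>. of_real (chi (\<xi> / 2 ^ Suc k)) * inv_fourier \<psi> \<xi>)"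
  proof -
    have L: "(0::real) < 2 ^ Suc k" by simp
    show ?thesis unfolding fourier_mult_chi[OF L \<psi>, symmetric] unfolding fourier_mult_def
      by (rule inv_fourier_fourier[OF chi_dilate_inv_fourier_schwartz[OF L \<psi>]])
  qed
  then have "(\<lambda>\<xi>. of_real (lp_mult k \<xi>) * inv_fourier (mollify chi_kernel (2 ^ Suc k) \<psi>) \<xi>) = (\<lambda>\<xi>. of_real (lp_mult k \<xi>) * inv_fourier \<psi> \<xi>)"
    using lp_mult_chi[of k] by (simp add: fun_eq_iff flip: mult.assoc of_real_mult)
  then show ?thesis by (simp add: fourier_mult_def)
qed

text \<open>By \<open>chi_Suc\<close> the multipliers with index up to \<open>J\<close> add up to
  \<open>chi (\<xi> / 2 ^ J)\<close>, which acts on the test function as a mollification.\<close>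

lemma sum_lp_block:
  assumes u: "u \<in> tempered" and \<psi>: "\<psi> \<in> schwartz"
  shows "(\<Sum>k\<le>J. lp_block chi phi (int k - 1) u \<psi>) = u (mollify chi_kernel (2 ^ J) \<psi>)"
proof (induction J)
  case 0
  have "lp_mult 0 = (\<lambda>\<xi>. chi (\<xi> / 2 ^ 0))" by (auto simp: lp_mult_def)
  then show ?case using lp_block_apply(1)[OF \<psi>, of 0 u] fourier_mult_chi[OF _ \<psi>, of 1] by simp
next
  case (Suc J)
  have i: "integrable lborel (\<lambda>\<xi>. cis (- (\<xi> * x)) * (of_real (chi (\<xi> / 2 ^ J)) * inv_fourier \<psi> \<xi>))"
    "integrable lborel (\<lambda>\<xi>. cis (- (\<xi> * x)) * (of_real (lp_mult (Suc J) \<xi>) * inv_fourier \<psi> \<xi>))" for x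
    using integrable_cis_mult[OF schwartzD(6)[OF chi_dilate_inv_fourier_schwartz[OF _ \<psi>, of "2 ^ J"]], of "-1" x]
      integrable_cis_mult[OF schwartzD(6)[OF lp_mult_inv_fourier_schwartz[OF \<psi>]], of "-1" x] by simp_all
  have "fourier_mult (\<lambda>\<xi>. chi (\<xi> / 2 ^ Suc J)) \<psi> = (\<lambda>x. fourier_mult (\<lambda>\<xi>. chi (\<xi> / 2 ^ J)) \<psi> x + fourier_mult (lp_mult (Suc J)) \<psi> x)"
    unfolding fourier_mult_def chi_Suc fourier_def fun_eq_iff
    using i by (simp add: algebra_simps)
  then have "mollify chi_kernel (2 ^ Suc J) \<psi> = (\<lambda>x. mollify chi_kernel (2 ^ J) \<psi> x + fourier_mult (lp_mult (Suc J)) \<psi> x)"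
    using fourier_mult_chi[OF _ \<psi>, of "2 ^ Suc J"] fourier_mult_chi[OF _ \<psi>, of "2 ^ J"] by simp
  then have "u (mollify chi_kernel (2 ^ Suc J) \<psi>) = u (mollify chi_kernel (2 ^ J) \<psi>) + u (fourier_mult (lp_mult (Suc J)) \<psi>)"
    using temperedD(2)[OF u mollify_schwartz[OF _ \<psi>] fourier_mult_mul_schwartz[OF \<psi>], of "2 ^ J" "Suc J"] by simp
  then show ?case using Suc lp_block_apply(1)[OF \<psi>, of "Suc J" u] by simp
qed

lemma tempered_eq_sum_lp_block:
  assumes u: "u \<in> tempered" and \<psi>: "\<psi> \<in> schwartz"
  shows "(\<lambda>J. \<Sum>k\<le>J. lp_block chi phi (int k - 1) u \<psi>) \<longlonglongrightarrow> u \<psi>"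
  unfolding sum_lp_block[OF assms]
  by (rule tempered_mollify_tendsto[OF u chi_kernel_schwartz chi_kernel_integral \<psi> mollify_schwartz[OF _ \<psi>]]) simp

text \<open>The factor 2 arises because block \<open>k\<close> is smoothed at scale
  \<open>2 ^ Suc k\<close>, whereas its derivative is measured against \<open>2 ^ k\<close>. The
  summand 1 keeps the constant positive, since it is divided by later.\<close>

definition emb_const :: real where
  "emb_const = (LINT x|lborel. norm (chi_kernel x)) + (LINT x|lborel. norm (ddx chi_kernel x)) * 2 + 1"

lemma emb_const_ge: "emb_const \<ge> 1" "(LINT x|lborel. norm (chi_kernel x)) \<le> emb_const"
  "(LINT x|lborel. norm (ddx chi_kernel x)) * 2 \<le> emb_const"
proof -
  have "0 \<le> (LINT x|lborel. norm (chi_kernel x))" "0 \<le> (LINT x|lborel. norm (ddx chi_kernel x))" by simp_all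
  then show "emb_const \<ge> 1" "(LINT x|lborel. norm (chi_kernel x)) \<le> emb_const" "(LINT x|lborel. norm (ddx chi_kernel x)) * 2 \<le> emb_const"
    unfolding emb_const_def by linarith+
qed

text \<open>Bernstein's inequality. The block reproduces itself under the wider cut-off, so its
  bounded representative may be replaced by the correlation with a kernel of fixed L1 norm. A
  derivative falls on that kernel and costs the inverse of its width.\<close>

lemma lp_block_representation:
  assumes "Linf_norm (lp_block chi phi (int k - 1) u) < \<infinity>"
  defines "a \<equiv> enn2real (Linf_norm (lp_block chi phi (int k - 1) u))"
  shows "\<exists>G G'. (\<forall>x. (G has_vector_derivative G' x) (at x)) \<and> continuous_on UNIV G' \<and>
     (\<forall>x. norm (G x) \<le> emb_const * a) \<and> (\<forall>x. norm (G' x) \<le> emb_const * (2 ^ k * a)) \<and>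
     lp_block chi phi (int k - 1) u = regular_distr G"
proof -
  obtain g where g: "g \<in> borel_measurable borel" "\<And>x. norm (g x) \<le> a" "lp_block chi phi (int k - 1) u = regular_distr g"
    using Linf_norm_finite_obtain[OF assms(1)] unfolding a_def by metis
  define L :: real where "L = 2 ^ Suc k"
  have L: "L > 0" by (simp add: L_def)
  note K = chi_kernel_at_schwartz[OF L]
  have a0: "a \<ge> 0" by (simp add: a_def)
  have "lp_block chi phi (int k - 1) u = regular_distr (corr (chi_kernel_at L) g)"
  proof
    fix \<psi> show "lp_block chi phi (int k - 1) u \<psi> = regular_distr (corr (chi_kernel_at L) g) \<psi>"
    proof (cases "\<psi> \<in> schwartz")
      case True
      note M = mollify_schwartz[OF L True]
      have "lp_block chi phi (int k - 1) u \<psi> = lp_block chi phi (int k - 1) u (mollify chi_kernel L \<psi>)"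
        unfolding lp_block_apply(1)[OF True] lp_block_apply(1)[OF M] using fourier_mult_mollify[OF True, of k] by (simp add: L_def)
      also have "\<dots> = (LINT y|lborel. g y * mollify chi_kernel L \<psi> y)" unfolding g(3) by (rule regular_distr_apply[OF M])
      also have "\<dots> = (LINT x|lborel. corr (chi_kernel_at L) g x * \<psi> x)"
        unfolding mollify_chi_kernel_at[OF L] by (rule integral_corr[OF K g(1,2) True])
      also have "\<dots> = regular_distr (corr (chi_kernel_at L) g) \<psi>" by (simp add: regular_distr_apply[OF True])
      finally show ?thesis .
    qed (simp add: lp_block_apply regular_distr_off)
  qed
  moreover have "norm (corr (chi_kernel_at L) g x) \<le> emb_const * a" for x
    using norm_corr_le[OF K g(1,2), of x] mult_right_mono[OF emb_const_ge(2) a0] unfolding chi_kernel_at_L1[OF L] by linarith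
  moreover have "norm (- corr (ddx (chi_kernel_at L)) g x) \<le> emb_const * (2 ^ k * a)" for x
  proof -
    have "norm (- corr (ddx (chi_kernel_at L)) g x) \<le> L * (LINT x|lborel. norm (ddx chi_kernel x)) * a"
      using norm_corr_le[OF schwartzD(2)[OF K] g(1,2), of x] unfolding chi_kernel_at_ddx_L1[OF L] by simp
    also have "\<dots> = ((LINT x|lborel. norm (ddx chi_kernel x)) * 2) * (2 ^ k * a)" by (simp add: L_def mult_ac)
    also have "\<dots> \<le> emb_const * (2 ^ k * a)" by (rule mult_right_mono[OF emb_const_ge(3)]) (simp add: a0)
    finally show ?thesis .
  qed
  moreover have "continuous_on UNIV (\<lambda>x. - corr (ddx (chi_kernel_at L)) g x)"
    by (intro continuous_intros continuous_corr[OF schwartzD(2)[OF K] g(1,2)])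
  ultimately show ?thesis using corr_has_vector_derivative[OF K g(1,2)]
    by (intro exI[of _ "corr (chi_kernel_at L) g"] exI[of _ "\<lambda>x. - corr (ddx (chi_kernel_at L)) g x"] conjI allI)
qed

lemma besov_norm_finiteD:
  assumes "besov_norm chi phi s u < \<infinity>"
  defines "a \<equiv> \<lambda>k. enn2real (Linf_norm (lp_block chi phi (int k - 1) u))"
  shows "Linf_norm (lp_block chi phi (int k - 1) u) < \<infinity>"
    "summable (\<lambda>k. 2 powr ((real k - 1) * s) * a k)"
    "besov_norm chi phi s u = ennreal (\<Sum>k. 2 powr ((real k - 1) * s) * a k)"
proof -
  let ?t = "\<lambda>k. ennreal (2 powr ((real k - 1) * s)) * Linf_norm (lp_block chi phi (int k - 1) u)"
  have f: "?t k < \<infinity>" for k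
  proof -
    have "?t k \<le> (\<Sum>k. ?t k)" using sum_le_suminf[of ?t "{k}"] by (simp add: summableI)
    then show ?thesis using assms(1) unfolding besov_norm_def by (rule le_less_trans)
  qed
  show fin: "Linf_norm (lp_block chi phi (int k - 1) u) < \<infinity>" for k
    using f[of k] by (auto simp: ennreal_mult_less_top)
  have t: "?t k = ennreal (2 powr ((real k - 1) * s) * a k)" for k
    using fin[of k] by (simp add: a_def ennreal_mult)
  have b: "besov_norm chi phi s u = (\<Sum>k. ennreal (2 powr ((real k - 1) * s) * a k))"
    unfolding besov_norm_def t ..
  have n: "0 \<le> 2 powr ((real k - 1) * s) * a k" for k by (simp add: a_def)
  show s: "summable (\<lambda>k. 2 powr ((real k - 1) * s) * a k)"
    using assms(1) n unfolding b by (intro summable_suminf_not_top) auto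
  show "besov_norm chi phi s u = ennreal (\<Sum>k. 2 powr ((real k - 1) * s) * a k)"
    unfolding b by (rule suminf_ennreal2[OF n s])
qed

text \<open>Uniform convergence gives continuity. Integrated against a test function, the partial
  sums converge to the integral of the sum by dominated convergence and to \<open>u\<close> by the
  Littlewood-Paley decomposition.\<close>

lemma series_representation:
  assumes u: "u \<in> tempered"
    and G: "\<And>k. lp_block chi phi (int k - 1) u = regular_distr (G k)" "\<And>k. continuous_on UNIV (G k)"
    and b: "\<And>k x. norm (G k x) \<le> b k" "summable b"
  shows "continuous_on UNIV (\<lambda>x. \<Sum>k. G k x)" "u = regular_distr (\<lambda>x. \<Sum>k. G k x)" "norm (\<Sum>k. G k x) \<le> (\<Sum>k. b k)"
proof -
  have sG: "summable (\<lambda>k. G k x)" for x by (rule summable_comparison_test'[OF b(2)]) (rule b(1))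
  have b0: "b k \<ge> 0" for k using order_trans[OF norm_ge_zero b(1)[of k 0]] .
  show c: "continuous_on UNIV (\<lambda>x. \<Sum>k. G k x)"
  proof (rule uniform_limit_theorem[OF _ Weierstrass_m_test])
    show "\<forall>\<^sub>F n in sequentially. continuous_on UNIV (\<lambda>x. \<Sum>i<n. G i x)"
      by (intro always_eventually allI continuous_intros G(2))
  qed (use b in auto)
  show "norm (\<Sum>k. G k x) \<le> (\<Sum>k. b k)"
    by (rule order_trans[OF summable_norm suminf_le])
      (use b in \<open>auto intro: summable_comparison_test'[OF b(2)]\<close>)
  show "u = regular_distr (\<lambda>x. \<Sum>k. G k x)"
  proof
    fix \<psi> show "u \<psi> = regular_distr (\<lambda>x. \<Sum>k. G k x) \<psi>"
    proof (cases "\<psi> \<in> schwartz")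
      case True
      have [measurable]: "G k \<in> borel_measurable borel" for k by (rule borel_measurable_continuous_onI[OF G(2)])
      have cm [measurable]: "(\<lambda>x. \<Sum>k. G k x) \<in> borel_measurable borel" by (rule borel_measurable_continuous_onI[OF c])
      note [measurable] = schwartzD(5)[OF True]
      have "(\<lambda>J. LINT x|lborel. (\<Sum>k\<le>J. G k x) * \<psi> x) \<longlonglongrightarrow> (LINT x|lborel. (\<Sum>k. G k x) * \<psi> x)"
      proof (rule integral_dominated_convergence[where w="\<lambda>x. (\<Sum>k. b k) * norm (\<psi> x)"])
        show "integrable lborel (\<lambda>x. (\<Sum>k. b k) * norm (\<psi> x))"
          using schwartzD(6)[OF True] by (intro integrable_mult_right integrable_norm)
        show "AE x in lborel. (\<lambda>J. (\<Sum>k\<le>J. G k x) * \<psi> x) \<longlonglongrightarrow> (\<Sum>k. G k x) * \<psi> x"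
          by (intro AE_I2 tendsto_mult tendsto_const summable_LIMSEQ' sG)
        show "AE x in lborel. norm ((\<Sum>k\<le>J. G k x) * \<psi> x) \<le> (\<Sum>k. b k) * norm (\<psi> x)" for J
        proof (intro AE_I2)
          fix x
          have "norm (\<Sum>k\<le>J. G k x) \<le> (\<Sum>k\<le>J. b k)" by (rule order_trans[OF norm_sum sum_mono[OF b(1)]])
          also have "\<dots> \<le> (\<Sum>k. b k)" by (rule sum_le_suminf[OF b(2)]) (use b0 in auto)
          finally show "norm ((\<Sum>k\<le>J. G k x) * \<psi> x) \<le> (\<Sum>k. b k) * norm (\<psi> x)"
            by (simp add: norm_mult mult_right_mono)
        qed
      qed measurable
      moreover have "(LINT x|lborel. (\<Sum>k\<le>J. G k x) * \<psi> x) = (\<Sum>k\<le>J. lp_block chi phi (int k - 1) u \<psi>)" for J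
      proof -
        have "integrable lborel (\<lambda>x. G k x * \<psi> x)" for k
          by (rule integrable_regular[OF _ b(1) True]) measurable
        then show ?thesis by (simp add: sum_distrib_right G(1) regular_distr_apply[OF True])
      qed
      ultimately show ?thesis
        using LIMSEQ_unique[OF tempered_eq_sum_lp_block[OF u True]] by (simp add: regular_distr_apply[OF True])
    qed (simp add: temperedD(1)[OF u] regular_distr_off)
  qed
qed

theorem besov_0_embedding:
  assumes u: "u \<in> tempered" and fin: "besov_norm chi phi 0 u < \<infinity>"
  shows "\<exists>U. continuous_on UNIV U \<and> u = regular_distr U \<and>
     (\<forall>x. ennreal (norm (U x)) \<le> ennreal emb_const * besov_norm chi phi 0 u)"
proof -
  define a where "a k = enn2real (Linf_norm (lp_block chi phi (int k - 1) u))" for k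
  note B = besov_norm_finiteD[OF fin, folded a_def, simplified]
  have "\<forall>k. \<exists>G G'. (\<forall>x. (G has_vector_derivative G' x) (at x)) \<and> (\<forall>x. norm (G x) \<le> emb_const * a k) \<and>
     lp_block chi phi (int k - 1) u = regular_distr G"
    using lp_block_representation[of _ u, folded a_def] B(1) by (metis infinity_ennreal_def)
  then obtain G G' where G: "\<And>k x. (G k has_vector_derivative G' k x) (at x)" "\<And>k x. norm (G k x) \<le> emb_const * a k"
     "\<And>k. lp_block chi phi (int k - 1) u = regular_distr (G k)" by metis
  have c: "continuous_on UNIV (G k)" for k
    using G(1) by (metis continuous_at_imp_continuous_on has_vector_derivative_continuous)
  note R = series_representation[OF u G(3) c G(2) summable_mult[OF B(2)]]
  have "ennreal (norm (\<Sum>k. G k x)) \<le> ennreal emb_const * besov_norm chi phi 0 u" for x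
  proof -
    have "ennreal (norm (\<Sum>k. G k x)) \<le> ennreal (emb_const * (\<Sum>k. a k))"
      using R(3)[of x] B(2) by (intro ennreal_leI) (simp add: suminf_mult)
    also have "\<dots> = ennreal emb_const * besov_norm chi phi 0 u"
      unfolding B(3) using emb_const_ge(1) B(2) by (intro ennreal_mult suminf_nonneg) (auto simp: a_def)
    finally show ?thesis .
  qed
  then show ?thesis using R(1,2) by blast
qed

text \<open>The derivative of block \<open>k\<close> is at most \<open>emb_const * 2 ^ k\<close>
  times its sup norm, and \<open>2 ^ k\<close> is twice the weight of that block in the norm; hence
  the factor 2.\<close>

theorem besov_1_embedding:
  assumes u: "u \<in> tempered" and fin: "besov_norm chi phi 1 u < \<infinity>"
  shows "\<exists>U U'. (\<forall>x. (U has_vector_derivative U' x) (at x)) \<and> continuous_on UNIV U' \<and> u = regular_distr U \<and>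
     (\<forall>x. ennreal (norm (U x)) \<le> ennreal (2 * emb_const) * besov_norm chi phi 1 u) \<and>
     (\<forall>x. ennreal (norm (U' x)) \<le> ennreal (2 * emb_const) * besov_norm chi phi 1 u)"
proof -
  define a where "a k = enn2real (Linf_norm (lp_block chi phi (int k - 1) u))" for k
  note B = besov_norm_finiteD[OF fin, folded a_def]
  have a0: "a k \<ge> 0" for k by (simp add: a_def)
  have p: "2 powr ((real k - 1) * 1) = 2 ^ k / (2::real)" for k
    by (simp add: powr_diff powr_realpow)
  have sm: "summable (\<lambda>k. 2 ^ k * a k)"
    using summable_mult[OF B(2), of 2] unfolding p by simp
  have bn: "ennreal (2 * emb_const) * besov_norm chi phi 1 u = ennreal (\<Sum>k. emb_const * (2 ^ k * a k))"
  proof -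
    have "2 * (\<Sum>k. 2 ^ k / 2 * a k) = (\<Sum>k. 2 * (2 ^ k / 2 * a k))"
      using sm by (intro suminf_mult[symmetric]) (simp add: summable_divide mult.commute)
    then have "(2 * emb_const) * (\<Sum>k. 2 powr ((real k - 1) * 1) * a k) = (\<Sum>k. emb_const * (2 ^ k * a k))"
      unfolding p using suminf_mult[OF sm, of emb_const] by simp
    then show ?thesis unfolding B(3)
      by (subst ennreal_mult[symmetric]) (use emb_const_ge(1) a0 B(2) in \<open>auto intro!: suminf_nonneg\<close>)
  qed
  have "\<forall>k. \<exists>G G'. (\<forall>x. (G has_vector_derivative G' x) (at x)) \<and> continuous_on UNIV G' \<and>
     (\<forall>x. norm (G x) \<le> emb_const * a k) \<and> (\<forall>x. norm (G' x) \<le> emb_const * (2 ^ k * a k)) \<and>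
     lp_block chi phi (int k - 1) u = regular_distr G"
    using lp_block_representation[of _ u, folded a_def] B(1) by metis
  then obtain G G' where G: "\<And>k x. (G k has_vector_derivative G' k x) (at x)" "\<And>k. continuous_on UNIV (G' k)"
     "\<And>k x. norm (G k x) \<le> emb_const * a k" "\<And>k x. norm (G' k x) \<le> emb_const * (2 ^ k * a k)"
     "\<And>k. lp_block chi phi (int k - 1) u = regular_distr (G k)" by metis
  have c: "continuous_on UNIV (G k)" for k
    using G(1) by (metis continuous_at_imp_continuous_on has_vector_derivative_continuous)
  have sm': "summable (\<lambda>k. emb_const * (2 ^ k * a k))" by (rule summable_mult[OF sm])
  have le: "emb_const * a k \<le> emb_const * (2 ^ k * a k)" for k
    using emb_const_ge(1) a0[of k] by (intro mult_left_mono) (auto simp: mult_le_cancel_right1)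
  have b0: "norm (G k x) \<le> emb_const * (2 ^ k * a k)" for k x
    by (rule order_trans[OF G(3) le])
  note R = series_representation[OF u G(5) c b0 sm']
  have sG: "summable (\<lambda>k. G k x)" for x by (rule summable_comparison_test'[OF sm']) (rule b0)
  have sG': "summable (\<lambda>k. G' k x)" for x by (rule summable_comparison_test'[OF sm']) (rule G(4))
  have i: "integrable (count_space UNIV) (\<lambda>k. G k x)" "integrable (count_space UNIV) (\<lambda>k. G' k x)" for x
    unfolding integrable_count_space_nat_iff
    by (rule summable_comparison_test'[OF sm']; simp add: b0 G(4))+
  \<comment> \<open>Termwise differentiation, with the series read as an integral over the counting
    measure.\<close>
  have "((\<lambda>x. LINT k|count_space UNIV. G k x) has_vector_derivative (LINT k|count_space UNIV. G' k x)) (at x)" for x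
    by (rule has_vector_derivative_integral_param[where w="\<lambda>k. emb_const * (2 ^ k * a k)"])
      (use i G emb_const_ge(1) a0 sm' in \<open>auto simp: integrable_count_space_nat_iff abs_mult\<close>)
  then have d: "((\<lambda>x. \<Sum>k. G k x) has_vector_derivative (\<Sum>k. G' k x)) (at x)" for x
    using i by (simp add: integral_count_space_nat)
  have c': "continuous_on UNIV (\<lambda>x. \<Sum>k. G' k x)"
  proof (rule uniform_limit_theorem[OF _ Weierstrass_m_test])
    show "\<forall>\<^sub>F n in sequentially. continuous_on UNIV (\<lambda>x. \<Sum>i<n. G' i x)"
      by (intro always_eventually allI continuous_intros G(2))
  qed (use G(4) sm' in auto)
  have n': "norm (\<Sum>k. G' k x) \<le> (\<Sum>k. emb_const * (2 ^ k * a k))" for x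
    by (rule order_trans[OF summable_norm suminf_le])
      (use G(4) sm' in \<open>auto intro: summable_comparison_test'[OF sm']\<close>)
  show ?thesis unfolding bn
    by (intro exI[of _ "\<lambda>x. \<Sum>k. G k x"] exI[of _ "\<lambda>x. \<Sum>k. G' k x"] conjI allI d c' R(2) ennreal_leI R(3) n')
qed

end

text \<open>The seminorms with weights of order 0 and 2 already control the L1 norm of the test
  function.\<close>

lemma regular_tempered:
  assumes g: "g \<in> borel_measurable borel" "\<And>x. norm (g x) \<le> M"
  shows "regular_distr g \<in> tempered"
proof -
  define I where "I = (LINT x|lborel. 1 / (1 + x\<^sup>2) :: real)"
  have I0: "I \<ge> 0" unfolding I_def by (intro Bochner_Integration.integral_nonneg) simp
  have M0: "M \<ge> 0" using order_trans[OF norm_ge_zero g(2)[of 0]] .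
  have bound: "norm (regular_distr g \<psi>) \<le> (I * M) * (\<Sum>k\<le>2. \<Sum>m\<le>2. schwartz_seminorm k m \<psi>)" if \<psi>: "\<psi> \<in> schwartz" for \<psi>
  proof -
    let ?s = "schwartz_seminorm 0 0 \<psi> + schwartz_seminorm 2 0 \<psi>"
    have n: "0 \<le> schwartz_seminorm k m \<psi>" for k m by (rule seminorm_nonneg[OF \<psi>])
    have p: "norm (\<psi> x) \<le> ?s * (1 / (1 + x\<^sup>2))" for x
    proof -
      have "norm (\<psi> x) * (1 + x\<^sup>2) \<le> ?s"
        using seminorm_ge[OF \<psi>, of x 0 0] seminorm_ge[OF \<psi>, of x 2 0] by (simp add: algebra_simps)
      then have "norm (\<psi> x) \<le> ?s / (1 + x\<^sup>2)" by (simp add: pos_le_divide_eq add_pos_nonneg)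
      then show ?thesis by simp
    qed
    have "(LINT x|lborel. norm (\<psi> x)) \<le> (LINT x|lborel. ?s * (1 / (1 + x\<^sup>2)))"
      by (intro integral_mono integrable_norm integrable_mult_right schwartzD(6)[OF \<psi>] integrable_inverse_quadratic p)
    also have "\<dots> = ?s * I" unfolding I_def by (rule integral_mult_right_zero)
    finally have i: "(LINT x|lborel. norm (\<psi> x)) \<le> ?s * I" .
    have "norm (regular_distr g \<psi>) \<le> (LINT x|lborel. norm (\<psi> x)) * M"
      using norm_integral_mult_bounded_le[OF schwartzD(6)[OF \<psi>] g] by (simp add: regular_distr_apply[OF \<psi>] mult.commute)
    also have "\<dots> \<le> ?s * I * M" by (rule mult_right_mono[OF i M0])
    also have "\<dots> = (I * M) * ?s" by simp
    also have "\<dots> \<le> (I * M) * (\<Sum>k\<le>2. \<Sum>m\<le>2. schwartz_seminorm k m \<psi>)"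
    proof (rule mult_left_mono)
      show "?s \<le> (\<Sum>k\<le>2. \<Sum>m\<le>2. schwartz_seminorm k m \<psi>)"
        using n by (simp add: numeral_2_eq_2 add_nonneg_nonneg add_increasing add_increasing2)
    qed (use I0 M0 in simp)
    finally show ?thesis .
  qed
  have add: "regular_distr g (\<lambda>x. \<psi> x + \<eta> x) = regular_distr g \<psi> + regular_distr g \<eta>"
    if "\<psi> \<in> schwartz" "\<eta> \<in> schwartz" for \<psi> \<eta>
    using integrable_regular[OF g] that by (simp add: regular_distr_apply schwartz_add distrib_left)
  have cm: "regular_distr g (\<lambda>x. c * \<psi> x) = c * regular_distr g \<psi>" if "\<psi> \<in> schwartz" for \<psi> c
    using that by (simp add: regular_distr_apply schwartz_cmult mult.left_commute)
  show ?thesis unfolding tempered_def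
    using bound add cm regular_distr_off by blast
qed

lemma regular_real_valued: "real_valued (regular_distr (\<lambda>x. complex_of_real (r x)))"
  unfolding real_valued_def
proof (intro ballI impI)
  fix \<psi> assume \<psi>: "\<psi> \<in> schwartz" "range \<psi> \<subseteq> \<real>"
  then have e: "\<psi> x = of_real (Re (\<psi> x))" for x by (metis of_real_Re rangeI subsetD)
  have "regular_distr (\<lambda>x. complex_of_real (r x)) \<psi> = (LINT x|lborel. of_real (r x * Re (\<psi> x)))"
    unfolding regular_distr_apply[OF \<psi>(1)] of_real_mult e[symmetric] ..
  then show "regular_distr (\<lambda>x. complex_of_real (r x)) \<psi> \<in> \<real>" by (simp only: integral_complex_of_real Reals_of_real)
qed

section \<open>Besov norms of constants and dyadic cosines\<close>

context lp_pair
begin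

lemma besov_norm_triangle: "besov_norm chi phi s (u + v) \<le> besov_norm chi phi s u + besov_norm chi phi s v"
proof -
  have "besov_norm chi phi s (u + v) \<le> (\<Sum>k. ennreal (2 powr ((real k - 1) * s)) * Linf_norm (lp_block chi phi (int k - 1) u)
      + ennreal (2 powr ((real k - 1) * s)) * Linf_norm (lp_block chi phi (int k - 1) v))"
    unfolding besov_norm_def lp_block_add distrib_left[symmetric]
    by (intro suminf_le summableI mult_left_mono Linf_norm_triangle) simp
  also have "\<dots> = besov_norm chi phi s u + besov_norm chi phi s v"
    unfolding besov_norm_def by (rule suminf_add[symmetric]) (rule summableI)+
  finally show ?thesis .
qed

text \<open>Frequency 0 gives the constants, so one family serves both sequences of data.\<close>

definition cos_distr :: "real \<Rightarrow> real \<Rightarrow> distr" where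
  "cos_distr a \<omega> = regular_distr (\<lambda>x. complex_of_real (a * cos (\<omega> * x)))"

lemma cos_distr_bound: "norm (complex_of_real (a * cos (\<omega> * x))) \<le> \<bar>a\<bar>"
  unfolding norm_of_real abs_mult by (rule mult_left_le) simp_all

lemma cos_distr_measurable: "(\<lambda>x. complex_of_real (a * cos (\<omega> * x))) \<in> borel_measurable borel"
  by measurable

text \<open>A cosine lives on the frequencies \<open>\<omega>\<close> and \<open>-\<omega>\<close>,
  where an even multiplier takes the same value; it is therefore an eigenfunction of every
  block.\<close>

lemma lp_block_cos_distr: "lp_block chi phi (int k - 1) (cos_distr a \<omega>) = cos_distr (lp_mult k \<omega> * a) \<omega>"
proof
  fix \<psi> show "lp_block chi phi (int k - 1) (cos_distr a \<omega>) \<psi> = cos_distr (lp_mult k \<omega> * a) \<omega> \<psi>"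
  proof (cases "\<psi> \<in> schwartz")
    case True
    define \<theta> where "\<theta> = (\<lambda>\<xi>. of_real (lp_mult k \<xi>) * inv_fourier \<psi> \<xi>)"
    have \<theta>: "\<theta> \<in> schwartz" unfolding \<theta>_def by (rule lp_mult_inv_fourier_schwartz[OF True])
    have pairing: "(LINT x|lborel. complex_of_real (b * cos (\<omega> * x)) * \<eta> x) =
        of_real (b * pi) * (inv_fourier \<eta> \<omega> + inv_fourier \<eta> (- \<omega>))" if \<eta>: "\<eta> \<in> schwartz" for \<eta> b
    proof -
      have i: "integrable lborel (\<lambda>x. cis (x * \<xi>) * \<eta> x)" for \<xi>
        using integrable_cis_mult[OF schwartzD(6)[OF \<eta>], of 1] by simp
      have "complex_of_real (b * cos (\<omega> * x)) = of_real (b / 2) * (cis (x * \<omega>) + cis (x * - \<omega>))" for x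
        by (simp add: complex_eq_iff mult.commute)
      then have "(LINT x|lborel. complex_of_real (b * cos (\<omega> * x)) * \<eta> x) =
         (LINT x|lborel. of_real (b / 2) * (cis (x * \<omega>) * \<eta> x + cis (x * - \<omega>) * \<eta> x))"
        by (simp only: mult.assoc distrib_right)
      also have "\<dots> = of_real (b / 2) * ((LINT x|lborel. cis (x * \<omega>) * \<eta> x) + (LINT x|lborel. cis (x * - \<omega>) * \<eta> x))"
        using i[of \<omega>] i[of "- \<omega>"] by (simp del: mult_minus_right)
      finally show ?thesis by (simp add: inv_fourier_def field_simps)
    qed
    have "lp_block chi phi (int k - 1) (cos_distr a \<omega>) \<psi> = (LINT x|lborel. complex_of_real (a * cos (\<omega> * x)) * fourier \<theta> x)"
      unfolding lp_block_apply(1)[OF True] cos_distr_def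
      using regular_distr_apply[OF fourier_mult_mul_schwartz[OF True]] by (simp add: fourier_mult_def \<theta>_def)
    also have "\<dots> = of_real (a * pi) * (\<theta> \<omega> + \<theta> (- \<omega>))"
      unfolding pairing[OF fourier_schwartz[OF \<theta>]] inv_fourier_fourier[OF \<theta>] ..
    also have "\<dots> = of_real (lp_mult k \<omega> * a * pi) * (inv_fourier \<psi> \<omega> + inv_fourier \<psi> (- \<omega>))"
      by (simp add: \<theta>_def lp_mult_even algebra_simps)
    also have "\<dots> = cos_distr (lp_mult k \<omega> * a) \<omega> \<psi>"
      unfolding cos_distr_def regular_distr_apply[OF True] pairing[OF True] ..
    finally show ?thesis .
  qed (simp add: lp_block_apply cos_distr_def regular_distr_off)
qed

text \<open>The multipliers are at most 1, and the weights \<open>2 ^ k / 2\<close> for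
  \<open>k \<le> N\<close> sum to less than \<open>2 ^ N\<close>.\<close>

lemma besov_norm_cos_distr_le:
  assumes z: "\<And>k. k > N \<Longrightarrow> lp_mult k \<omega> = 0"
  shows "besov_norm chi phi 1 (cos_distr a \<omega>) \<le> ennreal (2 ^ N * \<bar>a\<bar>)"
proof -
  have L: "Linf_norm (cos_distr b \<omega>) \<le> ennreal \<bar>b\<bar>" for b
    by (rule representsI(2)[OF cos_distr_measurable cos_distr_bound]) (simp add: cos_distr_def)
  have "besov_norm chi phi 1 (cos_distr a \<omega>) = (\<Sum>k\<le>N. ennreal (2 powr ((real k - 1) * 1)) * Linf_norm (cos_distr (lp_mult k \<omega> * a) \<omega>))"
    unfolding besov_norm_def lp_block_cos_distr
    by (rule suminf_finite) (use z L[of 0] in \<open>auto simp: le_zero_eq\<close>)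
  also have "\<dots> \<le> (\<Sum>k\<le>N. ennreal (2 ^ k / 2 * \<bar>a\<bar>))"
  proof (rule sum_mono)
    fix k
    have "Linf_norm (cos_distr (lp_mult k \<omega> * a) \<omega>) \<le> ennreal \<bar>a\<bar>"
      by (rule order_trans[OF L ennreal_leI]) (use lp_mult_range[of k \<omega>] in \<open>simp add: abs_mult mult_left_le_one_le\<close>)
    then have "ennreal (2 ^ k / 2) * Linf_norm (cos_distr (lp_mult k \<omega> * a) \<omega>) \<le> ennreal (2 ^ k / 2) * ennreal \<bar>a\<bar>"
      by (rule mult_left_mono) simp
    also have "\<dots> = ennreal (2 ^ k / 2 * \<bar>a\<bar>)" by (rule ennreal_mult[symmetric]) auto
    finally show "ennreal (2 powr ((real k - 1) * 1)) * Linf_norm (cos_distr (lp_mult k \<omega> * a) \<omega>) \<le> ennreal (2 ^ k / 2 * \<bar>a\<bar>)"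
      by (simp add: powr_diff powr_realpow)
  qed
  also have "\<dots> = ennreal (\<Sum>k\<le>N. 2 ^ k / 2 * \<bar>a\<bar>)" by (rule sum_ennreal) simp
  also have "\<dots> \<le> ennreal (2 ^ N * \<bar>a\<bar>)"
  proof (rule ennreal_leI)
    have "(\<Sum>k\<le>N. 2 ^ k :: real) = 2 ^ Suc N - 1" by (induction N) simp_all
    then have "(\<Sum>k\<le>N. 2 ^ k / 2 * \<bar>a\<bar>) = (2 ^ Suc N - 1) / 2 * \<bar>a\<bar>"
      by (simp flip: sum_distrib_right sum_divide_distrib)
    also have "\<dots> \<le> 2 ^ N * \<bar>a\<bar>" by (intro mult_right_mono) auto
    finally show "(\<Sum>k\<le>N. 2 ^ k / 2 * \<bar>a\<bar>) \<le> 2 ^ N * \<bar>a\<bar>" .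
  qed
  finally show ?thesis .
qed

lemma besov_norm_const_le: "besov_norm chi phi 1 (cos_distr a 0) \<le> ennreal \<bar>a\<bar>"
  using besov_norm_cos_distr_le[of 0 0 a] phi_zero[of 0] by (simp add: lp_mult_def)

text \<open>For \<open>k = Suc i\<close> with \<open>i > n\<close> the rescaled frequency is at most
  1/2, inside the hole of radius 3/4 in the support of \<open>phi\<close>. So
  \<open>N = Suc n\<close> works.\<close>

lemma besov_norm_dyadic_le: "besov_norm chi phi 1 (cos_distr a (2 ^ n)) \<le> ennreal (2 ^ Suc n * \<bar>a\<bar>)"
proof (rule besov_norm_cos_distr_le)
  fix k assume "Suc n < k"
  then obtain i where k: "k = Suc i" "i > n" by (cases k) auto
  have "(2::real) ^ Suc n \<le> 2 ^ i" using k by (intro power_increasing) auto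
  then have "(2::real) ^ n / 2 ^ i \<le> 1 / 2" by (simp add: field_simps)
  then have "\<bar>2 ^ n / 2 ^ i :: real\<bar> < 3 / 4" by (subst abs_of_nonneg) (simp, linarith)
  then show "lp_mult k (2 ^ n) = 0" using phi_zero k by (simp add: lp_mult_def)
qed

lemma cos_distr_besov:
  assumes "besov_norm chi phi 1 (cos_distr a \<omega>) \<le> ennreal C" shows "cos_distr a \<omega> \<in> besov chi phi 1"
proof -
  have "cos_distr a \<omega> \<in> tempered" "real_valued (cos_distr a \<omega>)"
    unfolding cos_distr_def by (rule regular_tempered[OF cos_distr_measurable cos_distr_bound]) (rule regular_real_valued)
  then show ?thesis using le_less_trans[OF assms] by (simp add: besov_def)
qed

lemma cos_distr_add: "cos_distr a \<omega> + cos_distr b \<upsilon> = regular_distr (\<lambda>x. complex_of_real (a * cos (\<omega> * x) + b * cos (\<upsilon> * x)))"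
  unfolding cos_distr_def using regular_distr_add[OF cos_distr_measurable cos_distr_bound cos_distr_measurable cos_distr_bound, of a \<omega> b \<upsilon>] by simp

lemma cos_distr_add_besov:
  assumes "cos_distr a \<omega> \<in> besov chi phi 1" "cos_distr b \<upsilon> \<in> besov chi phi 1"
  shows "cos_distr a \<omega> + cos_distr b \<upsilon> \<in> besov chi phi 1"
proof -
  have "norm (complex_of_real (a * cos (\<omega> * x) + b * cos (\<upsilon> * x))) \<le> \<bar>a\<bar> + \<bar>b\<bar>" for x
    using norm_triangle_ineq[of "complex_of_real (a * cos (\<omega> * x))" "complex_of_real (b * cos (\<upsilon> * x))"]
      cos_distr_bound[of a \<omega> x] cos_distr_bound[of b \<upsilon> x] unfolding of_real_add by linarith
  then have "cos_distr a \<omega> + cos_distr b \<upsilon> \<in> tempered" unfolding cos_distr_add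
    by (intro regular_tempered) measurable
  moreover have "besov_norm chi phi 1 (cos_distr a \<omega> + cos_distr b \<upsilon>) < \<infinity>"
    using assms by (intro le_less_trans[OF besov_norm_triangle]) (auto simp: besov_def)
  moreover have "real_valued (cos_distr a \<omega> + cos_distr b \<upsilon>)" unfolding cos_distr_add by (rule regular_real_valued)
  ultimately show ?thesis by (simp add: besov_def)
qed

end

section \<open>The nonlocal term\<close>

lemma rapid_exp_abs: "rapid (\<lambda>x::real. exp (- \<bar>x\<bar>))"
proof (rule rapidI)
  fix k
  have "\<bar>x\<bar> ^ k * norm (exp (- \<bar>x\<bar>)) \<le> 1 + real (Suc k) ^ Suc k" for x :: real
  proof -
    have "(\<bar>x\<bar> / real (Suc k)) ^ Suc k \<le> (1 + \<bar>x\<bar> / real (Suc k)) ^ Suc k"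
      by (intro power_mono) auto
    also have "\<dots> \<le> exp \<bar>x\<bar>" by (intro exp_ge_one_plus_x_over_n_power_n) auto
    finally have "\<bar>x\<bar> ^ Suc k \<le> real (Suc k) ^ Suc k * exp \<bar>x\<bar>"
      by (simp add: power_divide pos_divide_le_eq mult.commute del: power_Suc of_nat_Suc)
    then have 1: "\<bar>x\<bar> ^ Suc k * exp (- \<bar>x\<bar>) \<le> real (Suc k) ^ Suc k"
      by (simp add: exp_minus field_simps del: power_Suc of_nat_Suc)
    have "\<bar>x\<bar> ^ k \<le> 1 + \<bar>x\<bar> ^ Suc k"
    proof (cases "\<bar>x\<bar> \<le> 1")
      case True
      then have "\<bar>x\<bar> ^ k \<le> 1" by (intro power_le_one) auto
      moreover have "0 \<le> \<bar>x\<bar> ^ Suc k" by (rule zero_le_power) simp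
      ultimately show ?thesis by linarith
    next
      case False
      then have "\<bar>x\<bar> ^ k \<le> \<bar>x\<bar> ^ Suc k" by (intro power_increasing) auto
      then show ?thesis by linarith
    qed
    then have "\<bar>x\<bar> ^ k * exp (- \<bar>x\<bar>) \<le> (1 + \<bar>x\<bar> ^ Suc k) * exp (- \<bar>x\<bar>)" by (rule mult_right_mono) simp
    also have "\<dots> = exp (- \<bar>x\<bar>) + \<bar>x\<bar> ^ Suc k * exp (- \<bar>x\<bar>)" by (simp add: distrib_right)
    also have "\<dots> \<le> 1 + real (Suc k) ^ Suc k" by (rule add_mono[OF _ 1]) simp
    finally show ?thesis by simp
  qed
  then show "\<exists>C. \<forall>x::real. \<bar>x\<bar> ^ k * norm (exp (- \<bar>x\<bar>)) \<le> C" by blast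
qed

lemma fw_kernel_measurable [measurable]: "fw_kernel \<in> borel_measurable borel"
  unfolding fw_kernel_def[abs_def] by measurable

lemma rapid_fw_kernel: "rapid fw_kernel"
proof (rule rapid_bound[OF rapid_exp_abs, where C="1"])
  fix x :: real
  show "norm (fw_kernel x) \<le> 1 * norm (exp (- \<bar>x\<bar>))" by (simp add: fw_kernel_def)
qed

lemma fw_kernel_bound: "\<bar>fw_kernel x\<bar> \<le> 1" "0 \<le> fw_kernel x"
proof -
  have "exp (- \<bar>x\<bar>) \<le> 1" by simp
  then have "exp (- \<bar>x\<bar>) \<le> 2" by linarith
  then show "\<bar>fw_kernel x\<bar> \<le> 1" "0 \<le> fw_kernel x" by (simp_all add: fw_kernel_def)
qed

lemma fw_kernel_even: "fw_kernel (- x) = fw_kernel x"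
  by (simp add: fw_kernel_def)

lemma integrable_fw_kernel: "integrable lborel fw_kernel"
  by (rule rapid_integrable[OF rapid_fw_kernel]) measurable

text \<open>The test function to which \<open>conv_distr fw_kernel\<close> applies its distribution;
  since the kernel is even, this is ordinary convolution.\<close>

definition fw_conv :: "(real \<Rightarrow> complex) \<Rightarrow> real \<Rightarrow> complex" where
  "fw_conv \<psi> y = (LINT x|lborel. of_real (fw_kernel (x - y)) * \<psi> x)"

lemma fw_conv_shift: "fw_conv \<psi> y = (LINT z|lborel. of_real (fw_kernel z) * \<psi> (y + z))"
  unfolding fw_conv_def using lborel_integral_real_affine[of 1 "\<lambda>x. of_real (fw_kernel (x - y)) * \<psi> x" y] by simp

lemma fw_conv_has_vector_derivative:
  assumes \<psi>: "\<psi> \<in> schwartz" shows "(fw_conv \<psi> has_vector_derivative fw_conv (ddx \<psi>) y) (at y)"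
proof -
  note D = schwartzD(2)[OF \<psi>]
  obtain C where C: "\<And>x. norm (ddx \<psi> x) \<le> C" using rapid_bounded[OF schwartzD(3)[OF D]] by blast
  obtain C0 where C0: "\<And>x. norm (\<psi> x) \<le> C0" using rapid_bounded[OF schwartzD(3)[OF \<psi>]] by blast
  note [measurable] = schwartzD(5)[OF \<psi>] schwartzD(5)[OF D]
  show ?thesis unfolding fw_conv_shift[abs_def]
  proof (rule has_vector_derivative_integral_param[where w="\<lambda>z. fw_kernel z * C"])
    show "integrable lborel (\<lambda>z. complex_of_real (fw_kernel z) * \<psi> (y + z))" for y
      by (rule integrable_mult_bounded[OF _ _ C0]) (auto intro: integrable_of_real integrable_fw_kernel)
    show "((\<lambda>y. of_real (fw_kernel z) * \<psi> (y + z)) has_vector_derivative of_real (fw_kernel z) * ddx \<psi> (y + z)) (at y)" for y z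
    proof -
      have "((\<lambda>y. y + z) has_real_derivative 1) (at y)" by (auto intro!: derivative_eq_intros)
      from schwartz_chain[OF \<psi> this] show ?thesis by (intro has_vector_derivative_mult_right) simp
    qed
    show "integrable lborel (\<lambda>z. fw_kernel z * C)" by (intro integrable_mult_left integrable_fw_kernel)
  qed (auto simp: norm_mult fw_kernel_bound intro!: mult_left_mono C)
qed

text \<open>The weight at \<open>y\<close> is split between \<open>y + z\<close>, where
  \<open>\<psi>\<close> decays, and the shift \<open>z\<close>, where the kernel decays.\<close>

lemma fw_conv_rapid:
  assumes \<psi>: "\<psi> \<in> schwartz" shows "rapid (fw_conv \<psi>)"
proof (rule rapidI)
  fix k
  obtain C0 Ck where C: "\<And>x. norm (\<psi> x) \<le> C0" "\<And>x. \<bar>x\<bar> ^ k * norm (\<psi> x) \<le> Ck"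
    using rapidD[OF schwartzD(3)[OF \<psi>], of k] rapid_bounded[OF schwartzD(3)[OF \<psi>]] by blast
  note [measurable] = schwartzD(5)[OF \<psi>]
  define w where "w z = 2 ^ k * (fw_kernel z * Ck + norm (z ^ k *\<^sub>R fw_kernel z) * C0)" for z
  have "integrable lborel (\<lambda>z. z ^ k *\<^sub>R fw_kernel z)"
    by (rule rapid_integrable[OF rapid_power[OF rapid_fw_kernel]]) measurable
  then have wi: "integrable lborel w" unfolding w_def
    by (intro integrable_mult_right Bochner_Integration.integrable_add integrable_mult_left integrable_fw_kernel integrable_norm)
  have i: "integrable lborel (\<lambda>z. complex_of_real (fw_kernel z) * \<psi> (y + z))" for y
    by (rule integrable_mult_bounded[OF _ _ C(1)]) (auto intro: integrable_of_real integrable_fw_kernel)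
  have "\<bar>y\<bar> ^ k * norm (fw_conv \<psi> y) \<le> (LINT z|lborel. w z)" for y
  proof -
    have "\<bar>y\<bar> ^ k * norm (fw_conv \<psi> y) \<le> \<bar>y\<bar> ^ k * (LINT z|lborel. norm (complex_of_real (fw_kernel z) * \<psi> (y + z)))"
      unfolding fw_conv_shift by (intro mult_left_mono integral_norm_bound) auto
    also have "\<dots> = (LINT z|lborel. \<bar>y\<bar> ^ k * norm (complex_of_real (fw_kernel z) * \<psi> (y + z)))" by simp
    also have "\<dots> \<le> (LINT z|lborel. w z)"
    proof (intro integral_mono integrable_mult_right integrable_norm i wi)
      fix z
      have "\<bar>y\<bar> ^ k \<le> (\<bar>y + z\<bar> + \<bar>z\<bar>) ^ k" by (intro power_mono) auto
      also have "\<dots> \<le> 2 ^ k * (\<bar>y + z\<bar> ^ k + \<bar>z\<bar> ^ k)" by (rule add_power_le) auto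
      finally have "\<bar>y\<bar> ^ k * (fw_kernel z * norm (\<psi> (y + z))) \<le> 2 ^ k * (\<bar>y + z\<bar> ^ k + \<bar>z\<bar> ^ k) * (fw_kernel z * norm (\<psi> (y + z)))"
        by (intro mult_right_mono) (simp_all add: fw_kernel_bound)
      also have "\<dots> = 2 ^ k * (fw_kernel z * (\<bar>y + z\<bar> ^ k * norm (\<psi> (y + z))) + norm (z ^ k *\<^sub>R fw_kernel z) * norm (\<psi> (y + z)))"
        by (simp add: algebra_simps fw_kernel_bound power_abs abs_mult)
      also have "\<dots> \<le> w z" unfolding w_def
        by (intro mult_left_mono add_mono C) (simp_all add: fw_kernel_bound)
      finally show "\<bar>y\<bar> ^ k * norm (complex_of_real (fw_kernel z) * \<psi> (y + z)) \<le> w z"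
        by (simp add: norm_mult fw_kernel_bound)
    qed
    finally show ?thesis .
  qed
  then show "\<exists>C. \<forall>y. \<bar>y\<bar> ^ k * norm (fw_conv \<psi> y) \<le> C" by blast
qed

lemma fw_conv_schwartz: assumes "\<psi> \<in> schwartz" shows "fw_conv \<psi> \<in> schwartz"
proof (rule schwartz_coinduct[where A="fw_conv ` schwartz"])
  fix f assume "f \<in> fw_conv ` schwartz"
  then obtain \<psi> where f: "f = fw_conv \<psi>" "\<psi> \<in> schwartz" by blast
  show "rapid f \<and> (\<exists>f'\<in>fw_conv ` schwartz. \<forall>x. (f has_vector_derivative f' x) (at x))" unfolding f(1)
    by (intro conjI fw_conv_rapid bexI[OF _ imageI[OF schwartzD(2)[OF f(2)]]] allI fw_conv_has_vector_derivative f(2))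
qed (use assms in blast)

text \<open>The derivative of \<open>fw_kernel\<close> away from its corner. At the corner
  \<open>sgn 0 = 0\<close> gives the value 0, so the function is odd at every point.\<close>

definition fw_dkernel :: "real \<Rightarrow> real" where
  "fw_dkernel x = - sgn x * fw_kernel x"

lemma fw_dkernel_measurable [measurable]: "fw_dkernel \<in> borel_measurable borel"
  unfolding fw_dkernel_def[abs_def] by measurable

lemma fw_dkernel_abs_le: "\<bar>fw_dkernel x\<bar> \<le> fw_kernel x"
  by (simp add: fw_dkernel_def abs_mult fw_kernel_bound sgn_if)

lemma rapid_fw_dkernel: "rapid fw_dkernel"
  by (rule rapid_bound[OF rapid_fw_kernel, where C="1"]) (use fw_dkernel_abs_le in \<open>simp add: fw_kernel_bound\<close>)

lemma integrable_fw_dkernel: "integrable lborel fw_dkernel"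
  by (rule rapid_integrable[OF rapid_fw_dkernel]) measurable

lemma integrable_fw_dkernel_mult:
  fixes w :: "real \<Rightarrow> real"
  assumes [measurable]: "w \<in> borel_measurable borel" and b: "\<And>x. \<bar>w x\<bar> \<le> M"
  shows "integrable lborel (\<lambda>z. fw_dkernel z * w (x - z))"
proof (rule Bochner_Integration.integrable_bound)
  show "integrable lborel (\<lambda>z. \<bar>fw_dkernel z\<bar> * M)" by (intro integrable_mult_left integrable_abs integrable_fw_dkernel)
  have "M \<ge> 0" using order_trans[OF abs_ge_zero b[of 0]] .
  then show "AE z in lborel. norm (fw_dkernel z * w (x - z)) \<le> norm (\<bar>fw_dkernel z\<bar> * M)"
    using b by (auto simp: abs_mult intro!: mult_left_mono)
qed measurable

lemma integral_fw_dkernel: "(LINT z|lborel. fw_dkernel z) = 0"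
proof -
  have "(LINT z|lborel. fw_dkernel z) = (LINT z|lborel. fw_dkernel (0 - z))"
    by (rule integral_translate(2)[symmetric])
  also have "\<dots> = - (LINT z|lborel. fw_dkernel z)" by (simp add: fw_dkernel_def fw_kernel_even sgn_minus)
  finally show ?thesis by simp
qed

lemma norm_of_real_mult_add_le:
  assumes "0 \<le> c" "c \<le> 1"
  shows "norm (of_real c * a + of_real c * b) \<le> norm a + norm (b :: complex)"
    "norm (of_real c * a - of_real c * b) \<le> norm a + norm b"
proof -
  have "c * norm a \<le> norm a" "c * norm b \<le> norm b"
    using assms by (auto intro: mult_left_le_one_le)
  then show "norm (of_real c * a + of_real c * b) \<le> norm a + norm b" "norm (of_real c * a - of_real c * b) \<le> norm a + norm b"
    using norm_triangle_ineq[of "of_real c * a" "of_real c * b"] norm_triangle_ineq4[of "of_real c * a" "of_real c * b"] assms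
    by (simp_all add: norm_mult)
qed

text \<open>The kernel has a corner at \<open>y\<close>, so the integration by parts is done on each
  half-line. The boundary terms \<open>- \<psi> y\<close> and \<open>\<psi> y\<close> cancel, which
  is why no point mass remains.\<close>

lemma fw_conv_ddx:
  assumes \<psi>: "\<psi> \<in> schwartz"
  shows "fw_conv (ddx \<psi>) y = - (LINT x|lborel. of_real (fw_dkernel (x - y)) * \<psi> x)"
proof -
  note S = schwartzD[OF \<psi>] and S' = schwartzD[OF schwartzD(2)[OF \<psi>]]
  note [measurable] = S(5) S'(5)
  \<comment> \<open>\<open>?p\<close> and \<open>?q\<close> are the derivatives of twice the kernel
    times \<open>\<psi>\<close>, on the right and on the left of \<open>y\<close>.\<close>
  let ?p = "\<lambda>x. of_real (exp (- (x - y))) * ddx \<psi> x - of_real (exp (- (x - y))) * \<psi> x"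
  let ?q = "\<lambda>x. of_real (exp (x - y)) * ddx \<psi> x + of_real (exp (x - y)) * \<psi> x"
  have e: "((\<lambda>x. exp (- (x - y))) has_real_derivative - exp (- (x - y))) (at x)"
    "((\<lambda>x. exp (x - y)) has_real_derivative exp (x - y)) (at x)" for x
    by (auto intro!: derivative_eq_intros)
  have i1: "integrable lborel (\<lambda>x. indicator {y<..} x *\<^sub>R ?p x)"
    by (rule Bochner_Integration.integrable_bound[OF Bochner_Integration.integrable_add[OF integrable_norm[OF S'(6)] integrable_norm[OF S(6)]]])
      (auto simp: indicator_def simp del: of_real_mult minus_diff_eq intro!: AE_I2 norm_of_real_mult_add_le)
  have i2: "integrable lborel (\<lambda>x. indicator {..<y} x *\<^sub>R ?q x)"
    by (rule Bochner_Integration.integrable_bound[OF Bochner_Integration.integrable_add[OF integrable_norm[OF S'(6)] integrable_norm[OF S(6)]]])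
      (auto simp: indicator_def simp del: of_real_mult minus_diff_eq intro!: AE_I2 norm_of_real_mult_add_le)
  have r1: "((\<lambda>x. of_real (exp (- (x - y))) * \<psi> x) \<longlongrightarrow> 0) at_top"
  proof (rule Lim_null_comparison[OF _ tendsto_norm_zero[OF rapid_tendsto(1)[OF S(3)]]])
    show "\<forall>\<^sub>F x in at_top. norm (of_real (exp (- (x - y))) * \<psi> x) \<le> norm (\<psi> x)"
      by (rule eventually_mono[OF eventually_gt_at_top[of y]]) (auto simp: norm_mult intro!: mult_left_le_one_le)
  qed
  have r2: "((\<lambda>x. of_real (exp (x - y)) * \<psi> x) \<longlongrightarrow> 0) at_bot"
  proof (rule Lim_null_comparison[OF _ tendsto_norm_zero[OF rapid_tendsto(2)[OF S(3)]]])
    show "\<forall>\<^sub>F x in at_bot. norm (of_real (exp (x - y)) * \<psi> x) \<le> norm (\<psi> x)"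
      by (rule eventually_mono[OF eventually_gt_at_bot[of y]]) (auto simp: norm_mult intro!: mult_left_le_one_le)
  qed
  have ct: "isCont \<psi> x" "isCont (ddx \<psi>) x" for x
    using S(4) S'(4) by (auto simp: continuous_on_eq_continuous_at)
  have "(LBINT x=ereal y..\<infinity>. ?p x) = 0 - \<psi> y"
  proof (rule interval_integral_FTC_integrable[where F="\<lambda>x. of_real (exp (- (x - y))) * \<psi> x"])
    show "((\<lambda>x. of_real (exp (- (x - y))) * \<psi> x) has_vector_derivative ?p x) (at x)" for x
      using has_vector_derivative_mult[OF has_vector_derivative_of_real[OF e(1)] S(1), of x] by simp
    show "(((\<lambda>x. of_real (exp (- (x - y))) * \<psi> x) \<circ> real_of_ereal) \<longlongrightarrow> \<psi> y) (at_right (ereal y))"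
    proof -
      have "((\<lambda>x. of_real (exp (- (x - y))) * \<psi> x) \<longlongrightarrow> of_real (exp (- (y - y))) * \<psi> y) (at_right y)"
        using ct(1)[of y] by (intro tendsto_intros) (auto simp: isCont_def intro: tendsto_within_subset)
      then show ?thesis by (simp add: ereal_tendsto_simps)
    qed
    show "(((\<lambda>x. of_real (exp (- (x - y))) * \<psi> x) \<circ> real_of_ereal) \<longlongrightarrow> 0) (at_left \<infinity>)"
      using r1 by (simp add: ereal_tendsto_simps)
    show "set_integrable lborel (einterval (ereal y) \<infinity>) ?p"
      using i1 by (simp add: set_integrable_def einterval_eq)
  qed (auto intro!: continuous_intros ct)
  then have p: "(LINT x|lborel. indicator {y<..} x *\<^sub>R ?p x) = - \<psi> y"
    by (simp add: interval_lebesgue_integral_def set_lebesgue_integral_def einterval_eq)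
  have "(LBINT x=-\<infinity>..(ereal y). ?q x) = \<psi> y - 0"
  proof (rule interval_integral_FTC_integrable[where F="\<lambda>x. of_real (exp (x - y)) * \<psi> x"])
    show "((\<lambda>x. of_real (exp (x - y)) * \<psi> x) has_vector_derivative ?q x) (at x)" for x
      using has_vector_derivative_mult[OF has_vector_derivative_of_real[OF e(2)] S(1), of x] by simp
    show "(((\<lambda>x. of_real (exp (x - y)) * \<psi> x) \<circ> real_of_ereal) \<longlongrightarrow> \<psi> y) (at_left (ereal y))"
    proof -
      have "((\<lambda>x. of_real (exp (x - y)) * \<psi> x) \<longlongrightarrow> of_real (exp (y - y)) * \<psi> y) (at_left y)"
        using ct(1)[of y] by (intro tendsto_intros) (auto simp: isCont_def intro: tendsto_within_subset)
      then show ?thesis by (simp add: ereal_tendsto_simps)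
    qed
    show "(((\<lambda>x. of_real (exp (x - y)) * \<psi> x) \<circ> real_of_ereal) \<longlongrightarrow> 0) (at_right (-\<infinity>))"
      using r2 by (simp add: ereal_tendsto_simps)
    show "set_integrable lborel (einterval (-\<infinity>) (ereal y)) ?q"
      using i2 by (simp add: set_integrable_def einterval_eq)
  qed (auto intro!: continuous_intros ct)
  then have q: "(LINT x|lborel. indicator {..<y} x *\<^sub>R ?q x) = \<psi> y"
    by (simp add: interval_lebesgue_integral_def set_lebesgue_integral_def einterval_eq)
  have k1: "integrable lborel (\<lambda>x. of_real (fw_kernel (x - y)) * ddx \<psi> x)"
  proof (rule Bochner_Integration.integrable_bound[OF integrable_norm[OF S'(6)]])
    show "AE x in lborel. norm (of_real (fw_kernel (x - y)) * ddx \<psi> x) \<le> norm (norm (ddx \<psi> x))"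
      using fw_kernel_bound by (auto simp: norm_mult intro!: mult_left_le_one_le)
  qed measurable
  have k2: "integrable lborel (\<lambda>x. of_real (fw_dkernel (x - y)) * \<psi> x)"
  proof (rule Bochner_Integration.integrable_bound[OF integrable_norm[OF S(6)]])
    show "AE x in lborel. norm (of_real (fw_dkernel (x - y)) * \<psi> x) \<le> norm (norm (\<psi> x))"
      using order_trans[OF fw_dkernel_abs_le order_trans[OF abs_ge_self fw_kernel_bound(1)]]
      by (auto simp: norm_mult intro!: mult_left_le_one_le)
  qed measurable
  have "fw_conv (ddx \<psi>) y + (LINT x|lborel. of_real (fw_dkernel (x - y)) * \<psi> x)
    = (LINT x|lborel. of_real (fw_kernel (x - y)) * ddx \<psi> x + of_real (fw_dkernel (x - y)) * \<psi> x)"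
    unfolding fw_conv_def using k1 k2 by simp
  also have "\<dots> = (LINT x|lborel. (indicator {y<..} x *\<^sub>R ?p x + indicator {..<y} x *\<^sub>R ?q x) / 2)"
  proof (rule integral_cong_AE)
    have "AE x in lborel. x \<noteq> y" by (rule AE_lborel_singleton)
    then show "AE x in lborel. of_real (fw_kernel (x - y)) * ddx \<psi> x + of_real (fw_dkernel (x - y)) * \<psi> x
        = (indicator {y<..} x *\<^sub>R ?p x + indicator {..<y} x *\<^sub>R ?q x) / 2"
    proof eventually_elim
      case (elim x)
      then consider "x > y" | "x < y" by linarith
      then show ?case
        by cases (simp_all add: fw_kernel_def fw_dkernel_def field_simps)
    qed
  qed measurable
  also have "\<dots> = 0" using i1 i2 p q by simp
  finally show ?thesis by (simp add: add_eq_0_iff)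
qed

text \<open>The nonlocal term with the derivative placed on the kernel, so that bounds on
  \<open>w\<close> alone control it.\<close>

definition fw_force :: "(real \<Rightarrow> real) \<Rightarrow> real \<Rightarrow> real" where
  "fw_force w x = (LINT z|lborel. fw_dkernel z * w (x - z))"

lemma fw_force_shift: "fw_force w x = (LINT y|lborel. fw_dkernel (x - y) * w y)"
  unfolding fw_force_def using integral_translate(2)[of "\<lambda>z. fw_dkernel z * w (x - z)" x] by simp

text \<open>The sign of the distributional derivative cancels the one in \<open>fw_conv_ddx\<close>,
  and Fubini moves the kernel from the test function to \<open>U\<close>.\<close>

lemma dx_conv_regular:
  fixes U :: "real \<Rightarrow> real"
  assumes [measurable]: "U \<in> borel_measurable borel" and M: "\<And>x. \<bar>U x\<bar> \<le> M"
  shows "dx_distr (conv_distr fw_kernel (regular_distr (\<lambda>x. of_real (U x)))) = regular_distr (\<lambda>x. of_real (fw_force U x))"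
proof
  fix \<psi>
  show "dx_distr (conv_distr fw_kernel (regular_distr (\<lambda>x. of_real (U x)))) \<psi> = regular_distr (\<lambda>x. of_real (fw_force U x)) \<psi>"
  proof (cases "\<psi> \<in> schwartz")
    case \<psi>: True
    note D = schwartzD(2)[OF \<psi>]
    note [measurable] = schwartzD(5)[OF \<psi>]
    have M0: "M \<ge> 0" using order_trans[OF abs_ge_zero M[of 0]] .
    have "dx_distr (conv_distr fw_kernel (regular_distr (\<lambda>x. of_real (U x)))) \<psi> = - regular_distr (\<lambda>x. of_real (U x)) (fw_conv (ddx \<psi>))"
      using \<psi> D by (simp add: dx_distr_def conv_distr_def mk_distr_def fw_conv_def[abs_def])
    also have "\<dots> = (LINT y|lborel. of_real (U y) * (LINT x|lborel. of_real (fw_dkernel (x - y)) * \<psi> x))"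
      unfolding regular_distr_apply[OF fw_conv_schwartz[OF D]] fw_conv_ddx[OF \<psi>] by simp
    also have "\<dots> = (LINT y|lborel. LINT x|lborel. of_real (fw_dkernel (x - y) * U y) * \<psi> x)"
      by (simp add: mult_ac flip: integral_mult_right_zero)
    also have "\<dots> = (LINT x|lborel. LINT y|lborel. of_real (fw_dkernel (x - y) * U y) * \<psi> x)"
    proof (rule Fubini_lborel)
      have dk: "integrable lborel (\<lambda>y. fw_dkernel (x - y))" for x by (rule integrable_translate(2)[OF integrable_fw_dkernel])
      show i: "integrable lborel (\<lambda>y. complex_of_real (fw_dkernel (x - y) * U y) * \<psi> x)" for x
      proof (rule Bochner_Integration.integrable_bound)
        show "integrable lborel (\<lambda>y. \<bar>fw_dkernel (x - y)\<bar> * (M * norm (\<psi> x)))"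
          by (intro integrable_mult_left integrable_abs dk)
        show "AE y in lborel. norm (complex_of_real (fw_dkernel (x - y) * U y) * \<psi> x) \<le> norm (\<bar>fw_dkernel (x - y)\<bar> * (M * norm (\<psi> x)))"
          using M M0 by (auto simp: norm_mult abs_mult mult.assoc intro!: mult_left_mono mult_right_mono)
      qed measurable
      show "(LINT y|lborel. norm (complex_of_real (fw_dkernel (x - y) * U y) * \<psi> x)) \<le> (LINT y|lborel. \<bar>fw_dkernel y\<bar>) * M * norm (\<psi> x)" for x
      proof -
        have "(LINT y|lborel. norm (complex_of_real (fw_dkernel (x - y) * U y) * \<psi> x)) \<le> (LINT y|lborel. \<bar>fw_dkernel (x - y)\<bar> * (M * norm (\<psi> x)))"
        proof (rule integral_mono[OF integrable_norm[OF i]])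
          show "integrable lborel (\<lambda>y. \<bar>fw_dkernel (x - y)\<bar> * (M * norm (\<psi> x)))"
            by (intro integrable_mult_left integrable_abs dk)
        qed (use M in \<open>auto simp: norm_mult abs_mult mult.assoc intro!: mult_left_mono mult_right_mono\<close>)
        then show ?thesis using integral_translate(2)[of "\<lambda>z. \<bar>fw_dkernel z\<bar>" x] by (simp add: mult.assoc)
      qed
      show "integrable lborel (\<lambda>x. (LINT y|lborel. \<bar>fw_dkernel y\<bar>) * M * norm (\<psi> x))"
        using schwartzD(6)[OF \<psi>] by (intro integrable_mult_right integrable_norm)
    qed measurable
    also have "\<dots> = (LINT x|lborel. of_real (fw_force U x) * \<psi> x)"
    proof (rule Bochner_Integration.integral_cong[OF refl])
      fix x
      have "(LINT y|lborel. of_real (fw_dkernel (x - y) * U y) * \<psi> x) = (LINT y|lborel. of_real (fw_dkernel (x - y) * U y)) * \<psi> x"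
        by (rule integral_mult_left_zero)
      also have "(LINT y|lborel. complex_of_real (fw_dkernel (x - y) * U y)) = of_real (fw_force U x)"
        unfolding fw_force_shift by (rule integral_complex_of_real)
      finally show "(LINT y|lborel. of_real (fw_dkernel (x - y) * U y) * \<psi> x) = of_real (fw_force U x) * \<psi> x" .
    qed
    also have "\<dots> = regular_distr (\<lambda>x. of_real (fw_force U x)) \<psi>" by (simp add: regular_distr_apply[OF \<psi>])
    finally show ?thesis .
  qed (simp add: dx_distr_def mk_distr_def regular_distr_off)
qed

lemma dx_regular:
  assumes der: "\<And>x. (U has_vector_derivative U' x) (at x)" and c: "continuous_on UNIV U'"
    and b: "\<And>x. norm (U x) \<le> M" "\<And>x. norm (U' x) \<le> N"
  shows "dx_distr (regular_distr U) = regular_distr U'"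
proof
  fix \<psi> show "dx_distr (regular_distr U) \<psi> = regular_distr U' \<psi>"
  proof (cases "\<psi> \<in> schwartz")
    case \<psi>: True
    note S = schwartzD[OF \<psi>] and S' = schwartzD[OF schwartzD(2)[OF \<psi>]]
    have cU: "continuous_on UNIV U"
      using der by (metis continuous_at_imp_continuous_on has_vector_derivative_continuous)
    note m = borel_measurable_continuous_onI[OF cU] borel_measurable_continuous_onI[OF c]
    note i = integrable_regular[OF m(1) b(1) S(2)] integrable_regular[OF m(2) b(2) \<psi>]
    have r: "rapid (\<lambda>x. U x * \<psi> x)"
      by (rule rapid_bound[OF S(3), where C=M]) (simp add: norm_mult mult_right_mono b)
    have "(LINT x|lborel. U x * ddx \<psi> x + U' x * \<psi> x) = 0"
    proof (rule integral_derivative_eq_0[where f="\<lambda>x. U x * \<psi> x"])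
      show "((\<lambda>x. U x * \<psi> x) has_vector_derivative U x * ddx \<psi> x + U' x * \<psi> x) (at x)" for x
        by (rule has_vector_derivative_mult[OF der S(1)])
      show "continuous_on UNIV (\<lambda>x. U x * ddx \<psi> x + U' x * \<psi> x)"
        by (intro continuous_intros cU c S(4) S'(4))
      show "integrable lborel (\<lambda>x. U x * ddx \<psi> x + U' x * \<psi> x)" by (rule Bochner_Integration.integrable_add[OF i])
    qed (rule rapid_tendsto[OF r])+
    then have "(LINT x|lborel. U x * ddx \<psi> x) + (LINT x|lborel. U' x * \<psi> x) = 0" using i by simp
    then show ?thesis using \<psi> S(2)
      by (simp add: dx_distr_def mk_distr_def regular_distr_apply add_eq_0_iff)
  qed (simp add: dx_distr_def mk_distr_def regular_distr_off)
qed

text \<open>The chosen representatives agree almost everywhere with \<open>f\<close> and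
  \<open>g\<close>, and a regular distribution sees no more than that.\<close>

lemma prod_regular:
  assumes f: "f \<in> borel_measurable borel" "\<And>x. norm (f x) \<le> M" and g: "g \<in> borel_measurable borel" "\<And>x. norm (g x) \<le> N"
  shows "prod_distr (regular_distr f) (regular_distr g) = regular_distr (\<lambda>x. f x * g x)"
proof -
  let ?F = "SOME h. represents h (regular_distr f)" and ?G = "SOME h. represents h (regular_distr g)"
  have rf: "represents f (regular_distr f)" and rg: "represents g (regular_distr g)"
    using representsI(1)[OF f refl] representsI(1)[OF g refl] .
  have F: "represents ?F (regular_distr f)" and G: "represents ?G (regular_distr g)"
    using someI[of "\<lambda>h. represents h (regular_distr f)", OF rf] someI[of "\<lambda>h. represents h (regular_distr g)", OF rg] .
  have [measurable]: "?F \<in> borel_measurable borel" "?G \<in> borel_measurable borel"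
    using F G by (simp_all add: represents_def)
  note [measurable] = f(1) g(1)
  show ?thesis unfolding prod_distr_def
  proof (rule regular_distr_AE_cong)
    show "AE x in lborel. ?F x * ?G x = f x * g x"
      using represents_unique[OF F rf] represents_unique[OF G rg] by eventually_elim simp
  qed measurable
qed

section \<open>Solutions as classical functions\<close>

text \<open>Continuity and differentiability in time are required uniformly in \<open>x\<close>.
  This is what B^0 convergence yields, and the uniformity is what gives joint continuity, a bound
  over all of space, and derivatives of spatial integrals.\<close>

definition fw_classical :: "real \<Rightarrow> (real \<Rightarrow> real \<Rightarrow> real) \<Rightarrow> (real \<Rightarrow> real \<Rightarrow> real) \<Rightarrow> bool" where
  "fw_classical T U Ux \<longleftrightarrow> (\<forall>t\<in>{0..T}.
     (\<forall>x. (U t has_real_derivative Ux t x) (at x)) \<and> continuous_on UNIV (Ux t) \<and>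
     bounded (range (U t)) \<and> bounded (range (Ux t)) \<and>
     (\<forall>e>0. \<forall>\<^sub>F \<tau> in at t within {0..T}. \<forall>x. \<bar>U \<tau> x - U t x\<bar> \<le> e) \<and>
     (\<forall>e>0. \<forall>\<^sub>F \<tau> in at t within {0..T}. \<forall>x.
        \<bar>(U \<tau> x - U t x) / (\<tau> - t) - (fw_force (U t) x - 3 / 2 * U t x * Ux t x)\<bar> \<le> e))"

text \<open>On real test functions the distribution takes real values, so \<open>W\<close> and its
  conjugate act alike there and must coincide.\<close>

lemma regular_real:
  assumes c: "continuous_on UNIV W" and b: "\<And>x. norm (W x) \<le> M" and r: "real_valued (regular_distr W)"
  shows "W x = of_real (Re (W x))"
proof -
  note m = borel_measurable_continuous_onI[OF c]
  have c': "continuous_on UNIV (\<lambda>x. cnj (W x))" by (intro continuous_intros c)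
  have "AE x in lborel. W x = cnj (W x)"
  proof (rule regular_distr_unique[OF m b])
    show "(\<lambda>x. cnj (W x)) \<in> borel_measurable borel" by (rule borel_measurable_continuous_onI[OF c'])
    show "norm (cnj (W x)) \<le> M" for x using b by simp
    fix \<psi> assume \<psi>: "\<psi> \<in> schwartz" "range \<psi> \<subseteq> \<real>"
    have e: "cnj (\<psi> x) = \<psi> x" for x using \<psi>(2) by (simp add: image_subset_iff Reals_cnj_iff)
    have "regular_distr W \<psi> \<in> \<real>" using r \<psi> by (simp add: real_valued_def)
    then have "regular_distr W \<psi> = cnj (LINT x|lborel. W x * \<psi> x)"
      by (simp add: regular_distr_apply[OF \<psi>(1)] Reals_cnj_iff)
    also have "\<dots> = (LINT x|lborel. cnj (W x * \<psi> x))" by (rule integral_bounded_linear'[OF bounded_linear_cnj bounded_linear_cnj, symmetric]) simp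
    also have "\<dots> = regular_distr (\<lambda>x. cnj (W x)) \<psi>" by (simp add: regular_distr_apply[OF \<psi>(1)] e)
    finally show "regular_distr W \<psi> = regular_distr (\<lambda>x. cnj (W x)) \<psi>" .
  qed
  then have "W = (\<lambda>x. cnj (W x))" by (rule AE_eq_continuous[OF c c'])
  then have "W x = cnj (W x)" by metis
  then show ?thesis by (metis Reals_cnj_iff of_real_Re)
qed

lemma ennreal_bound_real:
  assumes "ennreal r \<le> B" "B < \<infinity>" shows "r \<le> enn2real B"
  using assms by (cases "r \<ge> 0") (metis enn2real_ennreal enn2real_mono infinity_ennreal_def, metis enn2real_nonneg linear order_trans)

lemma eventually_at_within_mem: "\<forall>\<^sub>F \<tau> in at t within S. \<tau> \<in> S \<and> \<tau> \<noteq> t"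
  by (simp add: eventually_at_filter)

lemma fw_force_bound:
  assumes [measurable]: "w \<in> borel_measurable borel" and b: "\<And>x. \<bar>w x\<bar> \<le> M"
  shows "\<bar>fw_force w x\<bar> \<le> (LINT z|lborel. \<bar>fw_dkernel z\<bar>) * M"
proof -
  have "complex_of_real (fw_force w x) = (LINT z|lborel. complex_of_real (fw_dkernel z) * complex_of_real (w (x - z)))"
    unfolding fw_force_def of_real_mult[symmetric] by (simp only: integral_complex_of_real)
  moreover have "norm (LINT z|lborel. complex_of_real (fw_dkernel z) * complex_of_real (w (x - z)))
      \<le> (LINT z|lborel. norm (complex_of_real (fw_dkernel z))) * M"
    by (rule norm_integral_mult_bounded_le) (use b in \<open>auto intro: integrable_of_real integrable_fw_dkernel\<close>)
  ultimately show ?thesis by (metis (no_types, lifting) norm_of_real Bochner_Integration.integral_cong)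
qed

lemma continuous_fw_force:
  assumes der: "\<And>x. (U has_real_derivative Ux x) (at x)" and c: "continuous_on UNIV Ux"
    and b: "\<And>x. \<bar>U x\<bar> \<le> M" "\<And>x. \<bar>Ux x\<bar> \<le> N"
  shows "continuous_on UNIV (\<lambda>x. complex_of_real (fw_force U x))"
proof -
  have cU: "continuous_on UNIV U" using der by (meson DERIV_isCont continuous_at_imp_continuous_on)
  note [measurable] = borel_measurable_continuous_onI[OF cU] borel_measurable_continuous_onI[OF c]
  have "((\<lambda>x. LINT z|lborel. complex_of_real (fw_dkernel z * U (x - z))) has_vector_derivative
      (LINT z|lborel. complex_of_real (fw_dkernel z * Ux (x - z)))) (at x)" for x
  proof (rule has_vector_derivative_integral_param[where w="\<lambda>z. \<bar>fw_dkernel z\<bar> * N"])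
    show "integrable lborel (\<lambda>z. complex_of_real (fw_dkernel z * U (x - z)))" for x
      unfolding of_real_mult
      by (rule integrable_mult_bounded[where M=M]) (use b in \<open>auto intro: integrable_of_real integrable_fw_dkernel\<close>)
    show "((\<lambda>x. complex_of_real (fw_dkernel z * U (x - z))) has_vector_derivative complex_of_real (fw_dkernel z * Ux (x - z))) (at x)" for x z
    proof -
      have "((\<lambda>x. x - z) has_real_derivative 1) (at x)" by (auto intro!: derivative_eq_intros)
      from DERIV_chain2[OF der this] have "((\<lambda>x. U (x - z)) has_real_derivative Ux (x - z)) (at x)" by simp
      then show ?thesis by (intro has_vector_derivative_of_real DERIV_cmult)
    qed
    show "integrable lborel (\<lambda>z. \<bar>fw_dkernel z\<bar> * N)" by (intro integrable_mult_left integrable_abs integrable_fw_dkernel)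
  qed (use b in \<open>auto simp: norm_mult abs_mult intro!: mult_left_mono\<close>)
  then have "continuous_on UNIV (\<lambda>x. LINT z|lborel. complex_of_real (fw_dkernel z * U (x - z)))"
    by (meson continuous_at_imp_continuous_on has_vector_derivative_continuous)
  then show ?thesis by (simp add: fw_force_def del: of_real_mult)
qed

context lp_pair
begin

text \<open>The embedding provides a continuous representative, and two continuous representatives
  agree at every point. If the norm is infinite the bound is trivial, the constant being
  positive.\<close>

lemma sup_norm_le_besov_0:
  assumes c: "continuous_on UNIV W" and b: "\<And>x. norm (W x) \<le> M"
  shows "ennreal (norm (W x)) \<le> ennreal emb_const * besov_norm chi phi 0 (regular_distr W)"
proof (cases "besov_norm chi phi 0 (regular_distr W) < \<infinity>")
  case True
  note m = borel_measurable_continuous_onI[OF c]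
  obtain V where V: "continuous_on UNIV V" "regular_distr W = regular_distr V"
    "\<And>x. ennreal (norm (V x)) \<le> ennreal emb_const * besov_norm chi phi 0 (regular_distr W)"
    using besov_0_embedding[OF regular_tempered[OF m b] True] by blast
  have fin: "ennreal emb_const * besov_norm chi phi 0 (regular_distr W) < \<infinity>"
    using True by (simp add: ennreal_mult_less_top)
  have "AE x in lborel. W x = V x"
    by (rule regular_distr_unique[OF m b borel_measurable_continuous_onI[OF V(1)] ennreal_bound_real[OF V(3) fin]])
      (use V(2) in simp)
  then have "W = V" by (rule AE_eq_continuous[OF c V(1)])
  then show ?thesis using V(3) by simp
next
  case False
  then have "besov_norm chi phi 0 (regular_distr W) = \<top>" by (simp add: less_top[symmetric])
  then show ?thesis using emb_const_ge(1) by (simp add: ennreal_mult_top)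
qed

text \<open>Read from right to left, the B^1 norm is bounded below by a Lipschitz constant. This is
  how the separation of two solutions becomes visible in the norm.\<close>

lemma increment_le_besov_1:
  assumes c: "continuous_on UNIV W" and b: "\<And>x. norm (W x) \<le> M"
  shows "ennreal (norm (W x - W y)) \<le> ennreal (2 * emb_const) * besov_norm chi phi 1 (regular_distr W) * ennreal \<bar>x - y\<bar>"
proof (cases "besov_norm chi phi 1 (regular_distr W) < \<infinity>")
  case True
  note m = borel_measurable_continuous_onI[OF c]
  let ?B = "ennreal (2 * emb_const) * besov_norm chi phi 1 (regular_distr W)"
  obtain V V' where V: "\<And>x. (V has_vector_derivative V' x) (at x)" "regular_distr W = regular_distr V"
    "\<And>x. ennreal (norm (V x)) \<le> ?B" "\<And>x. ennreal (norm (V' x)) \<le> ?B"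
    using besov_1_embedding[OF regular_tempered[OF m b] True] by blast
  have cV: "continuous_on UNIV V"
    using V(1) by (metis continuous_at_imp_continuous_on has_vector_derivative_continuous)
  have fin: "?B < \<infinity>" using True by (simp add: ennreal_mult_less_top)
  have "AE x in lborel. W x = V x"
    by (rule regular_distr_unique[OF m b borel_measurable_continuous_onI[OF cV] ennreal_bound_real[OF V(3) fin]])
      (use V(2) in simp)
  then have WV: "W = V" by (rule AE_eq_continuous[OF c cV])
  have "norm (V x - V y) \<le> enn2real ?B * norm (x - y)"
  proof (rule differentiable_bound[where S=UNIV])
    fix z
    show "(V has_derivative (\<lambda>h. h *\<^sub>R V' z)) (at z within UNIV)"
      using V(1)[of z] by (simp add: has_vector_derivative_def)
    have "norm (V' z) \<le> enn2real ?B" by (rule ennreal_bound_real[OF V(4) fin])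
    then have "norm (h *\<^sub>R V' z) \<le> enn2real ?B * norm h" for h
      unfolding norm_scaleR real_norm_def mult.commute[of _ "\<bar>h\<bar>"] by (rule mult_left_mono) simp
    then show "onorm (\<lambda>h. h *\<^sub>R V' z) \<le> enn2real ?B" by (rule onorm_le)
  qed auto
  then have "ennreal (norm (W x - W y)) \<le> ennreal (enn2real ?B * \<bar>x - y\<bar>)"
    unfolding WV by (intro ennreal_leI) simp
  also have "\<dots> = ennreal (enn2real ?B) * ennreal \<bar>x - y\<bar>" by (rule ennreal_mult) auto
  also have "ennreal (enn2real ?B) = ?B" using fin by simp
  finally show ?thesis .
next
  case False
  then have i: "besov_norm chi phi 1 (regular_distr W) = \<top>" by (simp add: less_top[symmetric])
  show ?thesis
  \<comment> \<open>On the diagonal the infinite norm is multiplied by 0 and the product is 0, so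
    that case is separate.\<close>
  proof (cases "x = y")
    case False
    then have "ennreal (2 * emb_const) * \<top> * ennreal \<bar>x - y\<bar> = \<top>"
      using emb_const_ge(1) by (simp add: ennreal_mult_top ennreal_top_mult)
    then show ?thesis unfolding i by simp
  qed simp
qed

lemma besov_1_real_representation:
  assumes "u \<in> besov chi phi 1"
  shows "\<exists>U Ux :: real \<Rightarrow> real. (\<forall>x. (U has_real_derivative Ux x) (at x)) \<and> continuous_on UNIV Ux \<and>
    bounded (range U) \<and> bounded (range Ux) \<and> u = regular_distr (\<lambda>x. of_real (U x))"
proof -
  have u: "u \<in> tempered" "real_valued u" and fin: "besov_norm chi phi 1 u < \<infinity>"
    using assms by (auto simp: besov_def)
  let ?B = "ennreal (2 * emb_const) * besov_norm chi phi 1 u"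
  obtain V V' where V: "\<And>x. (V has_vector_derivative V' x) (at x)" "continuous_on UNIV V'" "u = regular_distr V"
    "\<And>x. ennreal (norm (V x)) \<le> ?B" "\<And>x. ennreal (norm (V' x)) \<le> ?B"
    using besov_1_embedding[OF u(1) fin] by blast
  have fin': "?B < \<infinity>" using fin by (simp add: ennreal_mult_less_top)
  note b = ennreal_bound_real[OF V(4) fin'] ennreal_bound_real[OF V(5) fin']
  have cV: "continuous_on UNIV V"
    using V(1) by (metis continuous_at_imp_continuous_on has_vector_derivative_continuous)
  have r: "V x = of_real (Re (V x))" for x
    by (rule regular_real[OF cV b(1)]) (use u(2) V(3) in simp)
  have "((\<lambda>x. Re (V x)) has_real_derivative Re (V' x)) (at x)" for x
    using bounded_linear.has_vector_derivative[OF bounded_linear_Re V(1)[of x]]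
    by (simp add: has_real_derivative_iff_has_vector_derivative)
  moreover have "continuous_on UNIV (\<lambda>x. Re (V' x))" by (intro continuous_intros V(2))
  moreover have "bounded (range (\<lambda>x. Re (V x)))" "bounded (range (\<lambda>x. Re (V' x)))"
    unfolding bounded_iff using order_trans[OF abs_Re_le_cmod b(1)] order_trans[OF abs_Re_le_cmod b(2)] by auto
  moreover have "u = regular_distr (\<lambda>x. of_real (Re (V x)))" using V(3) r by (metis ext)
  ultimately show ?thesis by (intro exI[of _ "\<lambda>x. Re (V x)"] exI[of _ "\<lambda>x. Re (V' x)"]) blast
qed

text \<open>Turns Besov convergence in time into uniform convergence in space. The representation is
  demanded only eventually, because a solution is constrained only at times in
  \<open>[0, T]\<close>.\<close>

lemma eventually_sup_norm_le:
  assumes lim: "((\<lambda>\<tau>. besov_norm chi phi 0 (w \<tau>)) \<longlongrightarrow> 0) F" and e: "e > 0"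
    and W: "\<forall>\<^sub>F \<tau> in F. w \<tau> = regular_distr (W \<tau>) \<and> continuous_on UNIV (W \<tau>) \<and> bounded (range (W \<tau>))"
  shows "\<forall>\<^sub>F \<tau> in F. \<forall>x. norm (W \<tau> x) \<le> e"
proof -
  have c0: "emb_const > 0" using emb_const_ge(1) by simp
  have "\<forall>\<^sub>F \<tau> in F. besov_norm chi phi 0 (w \<tau>) < ennreal (e / emb_const)"
    by (rule order_tendstoD(2)[OF lim]) (use e c0 in simp)
  with W show ?thesis
  proof eventually_elim
    case (elim \<tau>)
    then obtain M where M: "\<And>x. norm (W \<tau> x) \<le> M" by (auto simp: bounded_iff)
    show ?case
    proof
      fix x
      have "ennreal (norm (W \<tau> x)) \<le> ennreal emb_const * besov_norm chi phi 0 (w \<tau>)"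
        using sup_norm_le_besov_0[of "W \<tau>" M x] M elim by simp
      also have "\<dots> \<le> ennreal emb_const * ennreal (e / emb_const)"
        using elim by (intro mult_left_mono) (auto intro: less_imp_le)
      also have "\<dots> = ennreal e" using c0 e by (simp add: ennreal_mult[symmetric])
      finally show "norm (W \<tau> x) \<le> e" using e by (simp add: ennreal_le_iff)
    qed
  qed
qed

text \<open>Every term of the equation other than \<open>v\<close> is a regular distribution with an
  explicit function, so the equation can be solved for \<open>v\<close>.\<close>

lemma fw_solution_equation:
  assumes v: "v \<in> besov chi phi 0"
    and der: "\<And>x. (U has_real_derivative Ux x) (at x)" and c: "continuous_on UNIV Ux"
    and b: "\<And>x. \<bar>U x\<bar> \<le> M" "\<And>x. \<bar>Ux x\<bar> \<le> N"
    and u: "u = regular_distr (\<lambda>x. of_real (U x))"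
    and eq: "v + scale_distr (3 / 2) (prod_distr u (dx_distr u)) = dx_distr (conv_distr fw_kernel u)"
  shows "v = regular_distr (\<lambda>x. of_real (fw_force U x - 3 / 2 * U x * Ux x))"
proof -
  have cU: "continuous_on UNIV U" using der by (meson DERIV_isCont continuous_at_imp_continuous_on)
  note [measurable] = borel_measurable_continuous_onI[OF cU] borel_measurable_continuous_onI[OF c]
  have cu: "(\<lambda>x. complex_of_real (U x)) \<in> borel_measurable borel" "(\<lambda>x. complex_of_real (Ux x)) \<in> borel_measurable borel"
    by measurable
  have bc: "norm (complex_of_real (U x)) \<le> M" "norm (complex_of_real (Ux x)) \<le> N" for x using b by simp_all
  have M0: "M \<ge> 0" using order_trans[OF abs_ge_zero b(1)[of 0]] .
  have dx: "dx_distr u = regular_distr (\<lambda>x. of_real (Ux x))" unfolding u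
    by (rule dx_regular[OF has_vector_derivative_of_real[OF der] _ bc]) (intro continuous_intros c)
  have pr: "prod_distr u (dx_distr u) = regular_distr (\<lambda>x. of_real (U x * Ux x))"
    unfolding dx using prod_regular[OF cu(1) bc(1) cu(2) bc(2)] by (simp add: u)
  have cv: "dx_distr (conv_distr fw_kernel u) = regular_distr (\<lambda>x. of_real (fw_force U x))"
    unfolding u by (rule dx_conv_regular[OF _ b(1)]) measurable
  have cF: "continuous_on UNIV (\<lambda>x. complex_of_real (fw_force U x))"
    by (rule continuous_fw_force[OF der c b])
  have bF: "norm (complex_of_real (fw_force U x)) \<le> (LINT z|lborel. \<bar>fw_dkernel z\<bar>) * M" for x
    using fw_force_bound[OF _ b(1)] by simp
  have "v = dx_distr (conv_distr fw_kernel u) - scale_distr (3 / 2) (prod_distr u (dx_distr u))"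
    unfolding eq[symmetric] by simp
  also have "\<dots> = regular_distr (\<lambda>x. of_real (fw_force U x) - of_real (3 / 2) * of_real (U x * Ux x))"
    unfolding cv pr regular_distr_scale
  proof (rule regular_distr_diff[OF borel_measurable_continuous_onI[OF cF] bF])
    show "(\<lambda>x. complex_of_real (3 / 2) * of_real (U x * Ux x)) \<in> borel_measurable borel" by measurable
    show "norm (complex_of_real (3 / 2) * of_real (U x * Ux x)) \<le> 3 / 2 * (M * N)" for x
      using mult_mono[OF b(1)[of x] b(2)[of x] M0] by (simp add: norm_mult abs_mult)
  qed
  finally show ?thesis by (simp add: mult.assoc)
qed

text \<open>Membership in B^1 gives a differentiable real representative at each time. Once the
  equation has identified the time derivative, B^0 convergence of the difference quotients becomes
  their uniform convergence.\<close>

theorem fw_solution_classical: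
  assumes sol: "fw_solution chi phi T u0 u"
  shows "\<exists>U Ux. fw_classical T U Ux \<and> (\<forall>t\<in>{0..T}. u t = regular_distr (\<lambda>x. of_real (U t x)))"
proof -
  obtain v where C1: "\<And>t. t \<in> {0..T} \<Longrightarrow> u t \<in> besov chi phi 1"
    and C0: "\<And>t. t \<in> {0..T} \<Longrightarrow> ((\<lambda>\<tau>. besov_norm chi phi 0 (u \<tau> - u t)) \<longlongrightarrow> 0) (at t within {0..T})"
    and v: "\<And>t. t \<in> {0..T} \<Longrightarrow> v t \<in> besov chi phi 0"
    and dv: "\<And>t. t \<in> {0..T} \<Longrightarrow> ((\<lambda>\<tau>. besov_norm chi phi 0 (scale_distr (1 / (\<tau> - t)) (u \<tau> - u t) - v t)) \<longlongrightarrow> 0) (at t within {0..T})"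
    and eq: "\<And>t. t \<in> {0..T} \<Longrightarrow> v t + scale_distr (3 / 2) (prod_distr (u t) (dx_distr (u t))) = dx_distr (conv_distr fw_kernel (u t))"
    using sol unfolding fw_solution_def C_besov_def has_besov_time_derivative_def by blast
  have "\<forall>t\<in>{0..T}. \<exists>U Ux :: real \<Rightarrow> real. (\<forall>x. (U has_real_derivative Ux x) (at x)) \<and> continuous_on UNIV Ux \<and>
    bounded (range U) \<and> bounded (range Ux) \<and> u t = regular_distr (\<lambda>x. of_real (U x))"
    using besov_1_real_representation[OF C1] by blast
  then obtain U Ux where U: "\<And>t x. t \<in> {0..T} \<Longrightarrow> (U t has_real_derivative Ux t x) (at x)"
    "\<And>t. t \<in> {0..T} \<Longrightarrow> continuous_on UNIV (Ux t)" "\<And>t. t \<in> {0..T} \<Longrightarrow> bounded (range (U t))"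
    "\<And>t. t \<in> {0..T} \<Longrightarrow> bounded (range (Ux t))" "\<And>t. t \<in> {0..T} \<Longrightarrow> u t = regular_distr (\<lambda>x. of_real (U t x))"
    unfolding bchoice_iff by (metis (no_types))
  have cU: "continuous_on UNIV (U t)" if "t \<in> {0..T}" for t
    using U(1)[OF that] by (meson DERIV_isCont continuous_at_imp_continuous_on)
  have mU: "(\<lambda>x. complex_of_real (U t x)) \<in> borel_measurable borel" if "t \<in> {0..T}" for t
    by (intro borel_measurable_continuous_onI continuous_intros cU[OF that])
  obtain M N where b: "\<And>t x. t \<in> {0..T} \<Longrightarrow> \<bar>U t x\<bar> \<le> M t" "\<And>t x. t \<in> {0..T} \<Longrightarrow> \<bar>Ux t x\<bar> \<le> N t"
    using U(3,4) unfolding bounded_iff by (metis rangeI real_norm_def)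
  define V where "V t x = fw_force (U t) x - 3 / 2 * U t x * Ux t x" for t x
  have vV: "v t = regular_distr (\<lambda>x. of_real (V t x))" if t: "t \<in> {0..T}" for t
    unfolding V_def by (rule fw_solution_equation[OF v[OF t] U(1)[OF t] U(2)[OF t] b(1)[OF t] b(2)[OF t] U(5)[OF t] eq[OF t]])
  have cV: "continuous_on UNIV (\<lambda>x. complex_of_real (V t x))" if t: "t \<in> {0..T}" for t
    unfolding V_def of_real_diff of_real_mult
    by (intro continuous_intros continuous_fw_force[OF U(1)[OF t] U(2)[OF t] b(1)[OF t] b(2)[OF t]] cU[OF t] U(2)[OF t])
  have bV: "\<exists>K. \<forall>x. \<bar>V t x\<bar> \<le> K" if t: "t \<in> {0..T}" for t
  proof -
    obtain W where W: "continuous_on UNIV W" "v t = regular_distr W"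
      "\<And>x. ennreal (norm (W x)) \<le> ennreal emb_const * besov_norm chi phi 0 (v t)"
      using besov_0_embedding[of "v t"] v[OF t] by (auto simp: besov_def)
    have M0: "M t \<ge> 0" using order_trans[OF abs_ge_zero b(1)[OF t, of 0]] .
    have 1: "\<bar>fw_force (U t) x\<bar> \<le> (LINT z|lborel. \<bar>fw_dkernel z\<bar>) * M t" for x
      by (rule fw_force_bound[OF borel_measurable_continuous_onI[OF cU[OF t]] b(1)[OF t]])
    have 2: "\<bar>U t x * Ux t x\<bar> \<le> M t * N t" for x
      unfolding abs_mult by (rule mult_mono[OF b(1)[OF t] b(2)[OF t] M0]) simp
    have "\<bar>V t x\<bar> \<le> (LINT z|lborel. \<bar>fw_dkernel z\<bar>) * M t + 3 / 2 * (M t * N t)" for x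
      using 1[of x] 2[of x] unfolding V_def abs_le_iff by (simp add: mult.assoc)
    then show ?thesis by blast
  qed
  have "fw_classical T U Ux" unfolding fw_classical_def V_def[symmetric]
  proof (intro ballI conjI allI impI U(1,2,3,4))
    fix t e :: real assume t: "t \<in> {0..T}" and e: "e > 0"
    have d: "u \<tau> - u t = regular_distr (\<lambda>x. of_real (U \<tau> x) - of_real (U t x))" if "\<tau> \<in> {0..T}" for \<tau>
      unfolding U(5)[OF that] U(5)[OF t]
      by (rule regular_distr_diff[where M="M \<tau>" and N="M t"]) (use mU b that t in auto)
    have "\<forall>\<^sub>F \<tau> in at t within {0..T}. \<forall>x. norm (complex_of_real (U \<tau> x) - of_real (U t x)) \<le> e"
    proof (rule eventually_sup_norm_le[OF C0[OF t] e])
      show "\<forall>\<^sub>F \<tau> in at t within {0..T}. u \<tau> - u t = regular_distr (\<lambda>x. of_real (U \<tau> x) - of_real (U t x)) \<and>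
         continuous_on UNIV (\<lambda>x. complex_of_real (U \<tau> x) - of_real (U t x)) \<and> bounded (range (\<lambda>x. complex_of_real (U \<tau> x) - of_real (U t x)))"
        using eventually_at_within_mem[of "{0..T}" t]
      proof eventually_elim
        case (elim \<tau>)
        then have \<tau>: "\<tau> \<in> {0..T}" by simp
        have "norm (complex_of_real (U \<tau> x) - of_real (U t x)) \<le> M \<tau> + M t" for x
          using b(1)[OF \<tau>, of x] b(1)[OF t, of x] by (simp flip: of_real_diff)
        then have "bounded (range (\<lambda>x. complex_of_real (U \<tau> x) - of_real (U t x)))" by (auto simp: bounded_iff)
        moreover have "continuous_on UNIV (\<lambda>x. complex_of_real (U \<tau> x) - of_real (U t x))"
          by (intro continuous_intros cU \<tau> t)
        ultimately show ?case using d[OF \<tau>] by blast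
      qed
    qed
    then show "\<forall>\<^sub>F \<tau> in at t within {0..T}. \<forall>x. \<bar>U \<tau> x - U t x\<bar> \<le> e"
      by (simp flip: of_real_diff)
    let ?q = "\<lambda>\<tau> x. complex_of_real (1 / (\<tau> - t)) * (of_real (U \<tau> x) - of_real (U t x)) - of_real (V t x)"
    obtain K where K: "\<And>x. \<bar>V t x\<bar> \<le> K" using bV[OF t] by blast
    have "\<forall>\<^sub>F \<tau> in at t within {0..T}. \<forall>x. norm (?q \<tau> x) \<le> e"
    proof (rule eventually_sup_norm_le[OF dv[OF t] e])
      show "\<forall>\<^sub>F \<tau> in at t within {0..T}. scale_distr (1 / (\<tau> - t)) (u \<tau> - u t) - v t = regular_distr (?q \<tau>) \<and>
         continuous_on UNIV (?q \<tau>) \<and> bounded (range (?q \<tau>))"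
        using eventually_at_within_mem[of "{0..T}" t]
      proof eventually_elim
        case (elim \<tau>)
        then have \<tau>: "\<tau> \<in> {0..T}" by simp
        have b1: "norm (complex_of_real (1 / (\<tau> - t)) * (of_real (U \<tau> x) - of_real (U t x))) \<le> \<bar>1 / (\<tau> - t)\<bar> * (M \<tau> + M t)" for x
          unfolding norm_mult norm_of_real of_real_diff[symmetric]
          by (rule mult_left_mono) (use b(1)[OF \<tau>, of x] b(1)[OF t, of x] in auto)
        have b2: "norm (complex_of_real (V t x)) \<le> K" for x using K by simp
        have "norm (?q \<tau> x) \<le> \<bar>1 / (\<tau> - t)\<bar> * (M \<tau> + M t) + K" for x
          by (rule order_trans[OF norm_triangle_ineq4 add_mono[OF b1 b2]])
        then have "bounded (range (?q \<tau>))" unfolding bounded_iff by blast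
        moreover have "continuous_on UNIV (?q \<tau>)"
          by (intro continuous_intros cU \<tau> t cV)
        moreover have "scale_distr (1 / (\<tau> - t)) (u \<tau> - u t) - v t = regular_distr (?q \<tau>)"
          unfolding d[OF \<tau>] regular_distr_scale vV[OF t]
        proof (rule regular_distr_diff[OF _ b1 borel_measurable_continuous_onI[OF cV[OF t]] b2])
          show "(\<lambda>x. complex_of_real (1 / (\<tau> - t)) * (of_real (U \<tau> x) - of_real (U t x))) \<in> borel_measurable borel"
            using mU[OF \<tau>] mU[OF t] by simp
        qed
        ultimately show ?case by blast
      qed
    qed
    moreover have "norm (?q \<tau> x) = \<bar>(U \<tau> x - U t x) / (\<tau> - t) - V t x\<bar>" for \<tau> x
    proof -
      have "?q \<tau> x = of_real ((U \<tau> x - U t x) / (\<tau> - t) - V t x)" by (simp add: divide_inverse mult.commute)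
      then show ?thesis by (simp only: norm_of_real)
    qed
    ultimately show "\<forall>\<^sub>F \<tau> in at t within {0..T}. \<forall>x. \<bar>(U \<tau> x - U t x) / (\<tau> - t) - V t x\<bar> \<le> e" by simp
  qed
  then show ?thesis using U(5) by blast
qed

end

section \<open>Lipschitz bound by doubling of variables\<close>

lemma fw_classicalD:
  assumes "fw_classical T U Ux" "t \<in> {0..T}"
  shows "(U t has_real_derivative Ux t x) (at x)" "continuous_on UNIV (Ux t)" "continuous_on UNIV (U t)"
    "U t \<in> borel_measurable borel" "\<exists>M. \<forall>x. \<bar>U t x\<bar> \<le> M" "\<exists>N. \<forall>x. \<bar>Ux t x\<bar> \<le> N"
    "e > 0 \<Longrightarrow> \<forall>\<^sub>F \<tau> in at t within {0..T}. \<forall>x. \<bar>U \<tau> x - U t x\<bar> \<le> e"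
    "e > 0 \<Longrightarrow> \<forall>\<^sub>F \<tau> in at t within {0..T}. \<forall>x.
        \<bar>(U \<tau> x - U t x) / (\<tau> - t) - (fw_force (U t) x - 3 / 2 * U t x * Ux t x)\<bar> \<le> e"
proof -
  show d: "(U t has_real_derivative Ux t x) (at x)" for x using assms by (simp add: fw_classical_def)
  show "continuous_on UNIV (Ux t)" using assms by (simp add: fw_classical_def)
  show c: "continuous_on UNIV (U t)" using d by (meson DERIV_isCont continuous_at_imp_continuous_on)
  show "U t \<in> borel_measurable borel" by (rule borel_measurable_continuous_onI[OF c])
  show "\<exists>M. \<forall>x. \<bar>U t x\<bar> \<le> M" "\<exists>N. \<forall>x. \<bar>Ux t x\<bar> \<le> N"
    using assms by (auto simp: fw_classical_def bounded_iff)
  show "e > 0 \<Longrightarrow> \<forall>\<^sub>F \<tau> in at t within {0..T}. \<forall>x. \<bar>U \<tau> x - U t x\<bar> \<le> e"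
    "e > 0 \<Longrightarrow> \<forall>\<^sub>F \<tau> in at t within {0..T}. \<forall>x.
        \<bar>(U \<tau> x - U t x) / (\<tau> - t) - (fw_force (U t) x - 3 / 2 * U t x * Ux t x)\<bar> \<le> e"
    using assms by (simp_all add: fw_classical_def)
qed

lemma fw_classical_mono:
  assumes "fw_classical T U Ux" "T' \<le> T" shows "fw_classical T' U Ux"
proof -
  have le: "at t within {0..T'} \<le> at t within {0..T}" for t using assms(2) by (intro at_le) auto
  show ?thesis using assms unfolding fw_classical_def
    by (meson atLeastAtMost_iff filter_leD[OF le] order_trans)
qed

lemma fw_classical_time_derivative:
  assumes "fw_classical T U Ux" "t \<in> {0..T}"
  shows "((\<lambda>\<tau>. U \<tau> x) has_real_derivative (fw_force (U t) x - 3 / 2 * U t x * Ux t x)) (at t within {0..T})"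
  unfolding has_field_derivative_iff
proof (rule tendstoI)
  fix e :: real assume "e > 0"
  then have "\<forall>\<^sub>F \<tau> in at t within {0..T}. \<forall>x.
        \<bar>(U \<tau> x - U t x) / (\<tau> - t) - (fw_force (U t) x - 3 / 2 * U t x * Ux t x)\<bar> \<le> e / 2"
    by (intro fw_classicalD(8)[OF assms]) simp
  then show "\<forall>\<^sub>F \<tau> in at t within {0..T}. dist ((U \<tau> x - U t x) / (\<tau> - t)) (fw_force (U t) x - 3 / 2 * U t x * Ux t x) < e"
  proof eventually_elim
    case (elim \<tau>)
    show ?case using elim[rule_format, of x] \<open>e > 0\<close> by (simp add: dist_real_def)
  qed
qed

text \<open>Continuity in time is uniform in space, so it combines with continuity in space at the
  single time \<open>t\<close>.\<close>

lemma fw_classical_continuous: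
  assumes cl: "fw_classical T U Ux"
  shows "continuous_on ({0..T} \<times> UNIV) (\<lambda>p. U (fst p) (snd p))"
  unfolding continuous_on_iff
proof (intro ballI allI impI)
  fix p :: "real \<times> real" and e :: real assume p: "p \<in> {0..T} \<times> UNIV" and e: "e > 0"
  obtain t x where tx: "p = (t, x)" by (cases p)
  then have t: "t \<in> {0..T}" using p by auto
  have "\<forall>\<^sub>F \<tau> in at t within {0..T}. \<forall>x. \<bar>U \<tau> x - U t x\<bar> \<le> e / 3"
    by (rule fw_classicalD(7)[OF cl t]) (use e in simp)
  then obtain d1 where d1: "d1 > 0" "\<And>\<tau> x. \<tau> \<in> {0..T} \<Longrightarrow> \<tau> \<noteq> t \<Longrightarrow> dist \<tau> t < d1 \<Longrightarrow> \<bar>U \<tau> x - U t x\<bar> \<le> e / 3"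
    unfolding eventually_at by blast
  obtain d2 where d2: "d2 > 0" "\<And>y. dist y x < d2 \<Longrightarrow> dist (U t y) (U t x) < e / 3"
    using fw_classicalD(3)[OF cl t] e unfolding continuous_on_iff by (metis UNIV_I zero_less_divide_iff zero_less_numeral)
  show "\<exists>d>0. \<forall>p'\<in>{0..T} \<times> UNIV. dist p' p < d \<longrightarrow> dist (U (fst p') (snd p')) (U (fst p) (snd p)) < e"
  proof (intro exI[of _ "min d1 d2"] conjI ballI impI)
    fix p' :: "real \<times> real" assume p': "p' \<in> {0..T} \<times> UNIV" "dist p' p < min d1 d2"
    obtain s y where sy: "p' = (s, y)" by (cases p')
    have "dist s t < d1" "dist y x < d2"
      using p'(2) dist_fst_le[of p' p] dist_snd_le[of p' p] by (auto simp: sy tx)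
    moreover have "s \<in> {0..T}" using p'(1) sy by auto
    ultimately have "\<bar>U s y - U t y\<bar> \<le> e / 3" "dist (U t y) (U t x) < e / 3"
      using d1(2)[of s y] d2(2)[of y] e by (cases "s = t"; force)+
    then show "dist (U (fst p') (snd p')) (U (fst p) (snd p)) < e"
      unfolding sy tx fst_conv snd_conv dist_real_def by linarith
  qed (use d1 d2 in simp)
qed

text \<open>Time increments are small uniformly in space, so the spatial sup norm is a continuous
  function on the compact interval \<open>[0, T]\<close>.\<close>

lemma fw_classical_bounded:
  assumes cl: "fw_classical T U Ux"
  shows "\<exists>M\<ge>0. \<forall>t\<in>{0..T}. \<forall>x. \<bar>U t x\<bar> \<le> M"
proof -
  define n where "n t = (SUP x. \<bar>U t x\<bar>)" for t
  have bd: "bdd_above (range (\<lambda>x. \<bar>U t x\<bar>))" if t: "t \<in> {0..T}" for t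
    using fw_classicalD(5)[OF cl t] by (auto intro: bdd_aboveI)
  have up: "\<bar>U t x\<bar> \<le> n t" if "t \<in> {0..T}" for t x
    unfolding n_def by (rule cSUP_upper[OF _ bd[OF that]]) simp
  have cmp: "n s \<le> n t + e" if "t \<in> {0..T}" "\<And>x. \<bar>U s x - U t x\<bar> \<le> e" for s t e
  proof -
    have "(SUP x. \<bar>U s x\<bar>) \<le> n t + e"
    proof (rule cSUP_least)
      show "\<bar>U s x\<bar> \<le> n t + e" for x using up[OF that(1), of x] that(2)[of x] by linarith
    qed simp
    then show ?thesis by (simp add: n_def)
  qed
  have "continuous_on {0..T} n"
    unfolding continuous_on_def
  proof (intro ballI tendstoI)
    fix t e :: real assume t: "t \<in> {0..T}" and e: "e > 0"
    have "\<forall>\<^sub>F \<tau> in at t within {0..T}. \<forall>x. \<bar>U \<tau> x - U t x\<bar> \<le> e / 2"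
      by (rule fw_classicalD(7)[OF cl t]) (use e in simp)
    then show "\<forall>\<^sub>F \<tau> in at t within {0..T}. dist (n \<tau>) (n t) < e"
      using eventually_at_within_mem[of "{0..T}" t]
    proof eventually_elim
      case (elim \<tau>)
      have "\<bar>U \<tau> x - U t x\<bar> \<le> e / 2" "\<bar>U t x - U \<tau> x\<bar> \<le> e / 2" for x
        using elim(1)[rule_format, of x] by (simp_all add: abs_minus_commute)
      then have "n \<tau> \<le> n t + e / 2" "n t \<le> n \<tau> + e / 2" using cmp t elim(2) by blast+
      then show ?case using e by (simp add: dist_real_def abs_le_iff)
    qed
  qed
  then have "bounded (n ` {0..T})" by (intro compact_imp_bounded compact_continuous_image) auto
  then obtain M where "\<And>t. t \<in> {0..T} \<Longrightarrow> \<bar>n t\<bar> \<le> M"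
    unfolding bounded_iff by (metis imageI real_norm_def)
  then have "\<bar>U t x\<bar> \<le> max M 0" if "t \<in> {0..T}" for t x
    using up[OF that, of x] that by (force simp: max_def)
  then show ?thesis by (intro exI[of _ "max M 0"]) auto
qed

text \<open>The plain L1 norm of the kernel bounds the nonlocal term by the sup norm; the weighted
  one, \<open>fw_C\<close>, is there because the barrier grows quadratically in space.\<close>

definition fw_B :: real where "fw_B = (LINT z|lborel. \<bar>fw_dkernel z\<bar>)"
definition fw_C :: real where "fw_C = (LINT z|lborel. \<bar>fw_dkernel z\<bar> * (1 + z\<^sup>2))"

lemma fw_B_nonneg: "fw_B \<ge> 0" unfolding fw_B_def by (intro Bochner_Integration.integral_nonneg) simp
lemma fw_C_nonneg: "fw_C \<ge> 0" unfolding fw_C_def by (intro Bochner_Integration.integral_nonneg) (simp add: add_nonneg_nonneg)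

lemma integrable_fw_C: "integrable lborel (\<lambda>z. \<bar>fw_dkernel z\<bar> * (1 + z\<^sup>2))"
proof -
  have "integrable lborel (\<lambda>z. z ^ 2 *\<^sub>R fw_dkernel z)"
    by (rule rapid_integrable[OF rapid_power[OF rapid_fw_dkernel]]) measurable
  then have "integrable lborel (\<lambda>z. \<bar>fw_dkernel z\<bar> + \<bar>z ^ 2 *\<^sub>R fw_dkernel z\<bar>)"
    by (intro Bochner_Integration.integrable_add integrable_abs integrable_fw_dkernel)
  then show ?thesis by (simp add: algebra_simps abs_mult)
qed

text \<open>Convolution must preserve the quadratic weight:
  \<open>1 + (x - z)\<^sup>2 + (y - z)\<^sup>2\<close> is at most 4 times the product of
  \<open>1 + x\<^sup>2 + y\<^sup>2\<close> and \<open>1 + z\<^sup>2\<close>, and the factor in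
  \<open>z\<close> is integrated into \<open>fw_C\<close>.\<close>

lemma fw_force_increment:
  assumes [measurable]: "w \<in> borel_measurable borel" and b: "\<And>x. \<bar>w x\<bar> \<le> M"
    and inc: "\<And>z. \<bar>w (y - z) - w (x - z)\<bar> \<le> A + E * (1 + (x - z)\<^sup>2 + (y - z)\<^sup>2)" and E: "E \<ge> 0"
  shows "\<bar>fw_force w y - fw_force w x\<bar> \<le> fw_B * A + E * (4 * fw_C * (1 + x\<^sup>2 + y\<^sup>2))"
proof -
  note i = integrable_fw_dkernel_mult[OF assms(1) b]
  have "\<bar>fw_force w y - fw_force w x\<bar> = norm (LINT z|lborel. fw_dkernel z * w (y - z) - fw_dkernel z * w (x - z))"
    unfolding fw_force_def using i by simp
  also have "\<dots> \<le> (LINT z|lborel. norm (fw_dkernel z * w (y - z) - fw_dkernel z * w (x - z)))"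
    by (rule integral_norm_bound)
  also have "\<dots> \<le> (LINT z|lborel. \<bar>fw_dkernel z\<bar> * A + (E * (4 * (1 + x\<^sup>2 + y\<^sup>2))) * (\<bar>fw_dkernel z\<bar> * (1 + z\<^sup>2)))"
  proof (rule integral_mono)
    show "integrable lborel (\<lambda>z. norm (fw_dkernel z * w (y - z) - fw_dkernel z * w (x - z)))"
      by (intro integrable_norm Bochner_Integration.integrable_diff i)
    show "integrable lborel (\<lambda>z. \<bar>fw_dkernel z\<bar> * A + (E * (4 * (1 + x\<^sup>2 + y\<^sup>2))) * (\<bar>fw_dkernel z\<bar> * (1 + z\<^sup>2)))"
      by (intro Bochner_Integration.integrable_add integrable_mult_left integrable_mult_right integrable_abs integrable_fw_dkernel integrable_fw_C)
    fix z
    have "(x - z)\<^sup>2 \<le> 2 * x\<^sup>2 + 2 * z\<^sup>2" "(y - z)\<^sup>2 \<le> 2 * y\<^sup>2 + 2 * z\<^sup>2"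
      using zero_le_power2[of "x + z"] zero_le_power2[of "y + z"] by (simp_all add: power2_eq_square algebra_simps)
    moreover have "4 * ((1 + x\<^sup>2 + y\<^sup>2) * (1 + z\<^sup>2)) = 4 + 4 * x\<^sup>2 + 4 * y\<^sup>2 + 4 * z\<^sup>2 + 4 * (x\<^sup>2 * z\<^sup>2) + 4 * (y\<^sup>2 * z\<^sup>2)"
      by (simp add: algebra_simps)
    moreover have "0 \<le> x\<^sup>2 * z\<^sup>2" "0 \<le> y\<^sup>2 * z\<^sup>2" "0 \<le> x\<^sup>2" "0 \<le> y\<^sup>2" "0 \<le> z\<^sup>2" by simp_all
    ultimately have "1 + (x - z)\<^sup>2 + (y - z)\<^sup>2 \<le> 4 * ((1 + x\<^sup>2 + y\<^sup>2) * (1 + z\<^sup>2))" by linarith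
    then have "E * (1 + (x - z)\<^sup>2 + (y - z)\<^sup>2) \<le> E * (4 * ((1 + x\<^sup>2 + y\<^sup>2) * (1 + z\<^sup>2)))" using E by (rule mult_left_mono)
    with inc[of z] have "\<bar>w (y - z) - w (x - z)\<bar> \<le> A + E * (4 * ((1 + x\<^sup>2 + y\<^sup>2) * (1 + z\<^sup>2)))" by linarith
    then have "\<bar>fw_dkernel z\<bar> * \<bar>w (y - z) - w (x - z)\<bar> \<le> \<bar>fw_dkernel z\<bar> * (A + E * (4 * ((1 + x\<^sup>2 + y\<^sup>2) * (1 + z\<^sup>2))))"
      by (rule mult_left_mono) simp
    then show "norm (fw_dkernel z * w (y - z) - fw_dkernel z * w (x - z)) \<le> \<bar>fw_dkernel z\<bar> * A + (E * (4 * (1 + x\<^sup>2 + y\<^sup>2))) * (\<bar>fw_dkernel z\<bar> * (1 + z\<^sup>2))"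
      by (simp add: abs_mult[symmetric] right_diff_distrib[symmetric]) (simp add: abs_mult algebra_simps)
  qed
  also have "\<dots> = fw_B * A + E * (4 * fw_C * (1 + x\<^sup>2 + y\<^sup>2))"
  proof -
    have "(LINT z|lborel. \<bar>fw_dkernel z\<bar> * A + (E * (4 * (1 + x\<^sup>2 + y\<^sup>2))) * (\<bar>fw_dkernel z\<bar> * (1 + z\<^sup>2)))
       = (LINT z|lborel. \<bar>fw_dkernel z\<bar> * A) + (LINT z|lborel. (E * (4 * (1 + x\<^sup>2 + y\<^sup>2))) * (\<bar>fw_dkernel z\<bar> * (1 + z\<^sup>2)))"
      by (rule Bochner_Integration.integral_add)
        (intro integrable_mult_left integrable_mult_right integrable_abs integrable_fw_dkernel integrable_fw_C)+
    also have "\<dots> = fw_B * A + (E * (4 * (1 + x\<^sup>2 + y\<^sup>2))) * fw_C"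
      unfolding fw_B_def fw_C_def by (simp only: integral_mult_left_zero integral_mult_right_zero)
    finally show ?thesis by (simp add: mult_ac)
  qed
  finally show ?thesis .
qed

text \<open>Doubling of variables: the weight \<open>\<delta> * exp (K * t) * (1 + x\<^sup>2 + y\<^sup>2)\<close> makes the supremum of the increment attained,
  and \<open>1 / (1 - a * t)\<close> solves the Riccati equation that dominates the slope.\<close>

definition barrier :: "real \<Rightarrow> real \<Rightarrow> real \<Rightarrow> real \<Rightarrow> real \<Rightarrow> real \<Rightarrow> real \<Rightarrow> real" where
  "barrier a \<eta> \<delta> K t x y = 1 / (1 - a * t) * (\<bar>y - x\<bar> + \<eta>) + \<delta> * exp (K * t) * (1 + x\<^sup>2 + y\<^sup>2)"

text \<open>The weight confines all violations to a compact box, so the closed set of violations has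
  an earliest time. The term \<open>\<eta>\<close> makes the inequality strict at time 0, where the
  data satisfy it only weakly, and so this time is positive.\<close>

lemma first_touching:
  assumes cl: "fw_classical T U Ux" and T: "0 \<le> T" "a * T < 1" and a: "0 \<le> a"
    and \<eta>: "\<eta> > 0" and \<delta>: "\<delta> > 0" and K: "K \<ge> 0"
    and lip0: "\<And>x y. \<bar>U 0 y - U 0 x\<bar> \<le> \<bar>y - x\<bar>"
    and viol: "t \<in> {0..T}" "U t y - U t x \<ge> barrier a \<eta> \<delta> K t x y"
  obtains t0 x0 y0 where "t0 \<in> {0<..T}" "U t0 y0 - U t0 x0 = barrier a \<eta> \<delta> K t0 x0 y0"
    "\<And>x y. U t0 y - U t0 x \<le> barrier a \<eta> \<delta> K t0 x y"
    "\<And>t. t \<in> {0..<t0} \<Longrightarrow> U t y0 - U t x0 < barrier a \<eta> \<delta> K t x0 y0"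
proof -
  let ?W = "barrier a \<eta> \<delta> K"
  obtain M where M: "M \<ge> 0" "\<And>t x. t \<in> {0..T} \<Longrightarrow> \<bar>U t x\<bar> \<le> M" using fw_classical_bounded[OF cl] by blast
  have den: "1 - a * t > 0" if "t \<in> {0..T}" for t
    using mult_left_mono[of t T a] that a T by auto
  \<comment> \<open>A violation forces
    \<open>\<delta> * (1 + x\<^sup>2 + y\<^sup>2) \<le> 2 * M\<close>, since an increment of
    \<open>U\<close> is at most \<open>2 * M\<close>.\<close>
  define R where "R = 2 * M / \<delta>"
  have far: "\<bar>x\<bar> \<le> 1 + R \<and> \<bar>y\<bar> \<le> 1 + R" if t: "t \<in> {0..T}" and v: "U t y - U t x \<ge> ?W t x y" for t x y
  proof -
    have "1 / (1 - a * t) * (\<bar>y - x\<bar> + \<eta>) \<ge> 0" using den[OF t] \<eta> by simp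
    moreover have "\<delta> * exp (K * t) * (1 + x\<^sup>2 + y\<^sup>2) \<ge> \<delta> * (1 + x\<^sup>2 + y\<^sup>2)"
    proof (intro mult_right_mono)
      show "\<delta> \<le> \<delta> * exp (K * t)" using \<delta> K t by simp
    qed (simp add: add_nonneg_nonneg)
    ultimately have "\<delta> * (1 + x\<^sup>2 + y\<^sup>2) \<le> 2 * M"
      using v M(2)[OF t, of x] M(2)[OF t, of y] unfolding barrier_def by linarith
    then have *: "1 + x\<^sup>2 + y\<^sup>2 \<le> R" using \<delta> by (simp add: R_def pos_le_divide_eq mult.commute)
    have sq: "\<bar>z\<bar> \<le> 1 + z\<^sup>2" for z :: real
      using zero_le_power2[of "\<bar>z\<bar> - 1"] by (simp add: power2_diff)
    show ?thesis using * sq[of x] sq[of y] zero_le_power2[of x] zero_le_power2[of y] by linarith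
  qed
  define S where "S = {0..T} \<times> ({-(1+R)..1+R} \<times> {-(1+R)..1+R})"
  define V where "V = {p \<in> S. ?W (fst p) (fst (snd p)) (snd (snd p)) \<le> U (fst p) (snd (snd p)) - U (fst p) (fst (snd p))}"
  have cS: "compact S" unfolding S_def by (intro compact_Times compact_Icc)
  have contU: "continuous_on S (\<lambda>p. U (fst p) (g (snd p)))" if "continuous_on UNIV g" for g :: "real \<times> real \<Rightarrow> real"
  proof -
    have "continuous_on S ((\<lambda>p. U (fst p) (snd p)) \<circ> (\<lambda>p. (fst p, g (snd p))))"
    proof (rule continuous_on_compose)
      show "continuous_on S (\<lambda>p. (fst p, g (snd p)))"
        by (intro continuous_intros continuous_on_compose2[OF that]) auto
      show "continuous_on ((\<lambda>p. (fst p, g (snd p))) ` S) (\<lambda>p. U (fst p) (snd p))"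
        by (rule continuous_on_subset[OF fw_classical_continuous[OF cl]]) (auto simp: S_def)
    qed
    then show ?thesis by (simp add: comp_def)
  qed
  have "closed V" unfolding V_def
  proof (rule continuous_on_closed_Collect_le)
    show "continuous_on S (\<lambda>p. ?W (fst p) (fst (snd p)) (snd (snd p)))"
      unfolding barrier_def by (intro continuous_intros) (use den in \<open>force simp: S_def\<close>)
    show "continuous_on S (\<lambda>p. U (fst p) (snd (snd p)) - U (fst p) (fst (snd p)))"
      by (intro continuous_intros contU)
    show "closed S" using cS by (rule compact_imp_closed)
  qed
  then have "compact (S \<inter> V)" by (rule compact_Int_closed[OF cS])
  moreover have "S \<inter> V = V" by (auto simp: V_def)
  ultimately have cV: "compact V" by simp
  have inV: "(t, x, y) \<in> V" if "t \<in> {0..T}" "U t y - U t x \<ge> ?W t x y" for t x y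
    using far[OF that] that by (auto simp: V_def S_def abs_le_iff)
  have "V \<noteq> {}" using inV[OF viol] by auto
  then obtain p where p: "p \<in> V" "\<And>q. q \<in> V \<Longrightarrow> fst p \<le> fst q"
    using continuous_attains_inf[OF cV, of fst] continuous_on_fst[OF continuous_on_id] by blast
  obtain t0 x0 y0 where p0: "p = (t0, x0, y0)" by (cases p) auto
  have t0: "t0 \<in> {0..T}" and v0: "U t0 y0 - U t0 x0 \<ge> ?W t0 x0 y0"
    using p(1) by (auto simp: p0 V_def S_def)
  have least: "t0 \<le> t" if "t \<in> {0..T}" "U t y - U t x \<ge> ?W t x y" for t x y
    using p(2)[OF inV[OF that]] by (simp add: p0)
  have start: "U 0 y - U 0 x < ?W 0 x y" for x y
  proof -
    have "\<delta> * exp (K * 0) * (1 + x\<^sup>2 + y\<^sup>2) \<ge> 0" using \<delta> by (simp add: add_nonneg_nonneg)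
    then show ?thesis using lip0[of y x] \<eta> unfolding barrier_def by simp
  qed
  have pos: "t0 > 0" using t0 v0 start[of y0 x0] by (cases "t0 = 0") auto
  \<comment> \<open>A strict violation elsewhere at time \<open>t0\<close> would, by the
    intermediate value theorem, give equality at some \<open>s \<le> t0\<close>. Minimality forces
    \<open>s = t0\<close>, where the inequality was strict.\<close>
  have glob: "U t0 y - U t0 x \<le> ?W t0 x y" for x y
  proof (rule ccontr)
    assume n: "\<not> U t0 y - U t0 x \<le> ?W t0 x y"
    define f where "f t = U t y - U t x - ?W t x y" for t
    have "continuous_on {0..t0} f"
    proof -
      have "continuous_on {0..T} (\<lambda>t. U t z)" for z
        by (rule DERIV_continuous_on[OF fw_classical_time_derivative[OF cl]])
      then have "continuous_on {0..t0} (\<lambda>t. U t z)" for z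
        by (rule continuous_on_subset) (use t0 in auto)
      then show ?thesis unfolding f_def barrier_def
        by (intro continuous_intros) (use den t0 in force)+
    qed
    moreover have "f 0 \<le> 0" "0 \<le> f t0" using start[of y x] n by (auto simp: f_def)
    ultimately obtain s where s: "0 \<le> s" "s \<le> t0" "f s = 0" using IVT'[of f 0 0 t0] pos by auto
    have "t0 \<le> s" by (rule least[of s x y]) (use s t0 in \<open>auto simp: f_def\<close>)
    then have "f t0 = 0" using s by simp
    then show False using n by (simp add: f_def)
  qed
  show thesis
  proof (rule that[of t0 y0 x0])
    show "t0 \<in> {0<..T}" using pos t0 by simp
    show "U t0 y0 - U t0 x0 = ?W t0 x0 y0" using v0 glob[of y0 x0] by simp
    show "U t0 y - U t0 x \<le> ?W t0 x y" for x y by (rule glob)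
    fix t assume "t \<in> {0..<t0}"
    then show "U t y0 - U t x0 < ?W t x0 y0" using least[of t x0 y0] t0 by force
  qed
qed

text \<open>Only quotients from the left are used, since \<open>t0\<close> may be the end point
  \<open>T\<close>.\<close>

lemma DERIV_within_nonneg_of_left_max:
  fixes q :: "real \<Rightarrow> real"
  assumes d: "(q has_real_derivative D) (at t0 within {0..T})" and t0: "t0 \<in> {0<..T}"
    and le: "\<And>t. t \<in> {0..<t0} \<Longrightarrow> q t \<le> q t0"
  shows "D \<ge> 0"
proof (rule tendsto_lowerbound)
  have "(q has_real_derivative D) (at t0 within {0..t0})"
    by (rule DERIV_subset[OF d]) (use t0 in auto)
  then show "((\<lambda>t. (q t - q t0) / (t - t0)) \<longlongrightarrow> D) (at t0 within {0..t0})"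
    by (simp add: has_field_derivative_iff)
  show "\<forall>\<^sub>F t in at t0 within {0..t0}. 0 \<le> (q t - q t0) / (t - t0)"
    using eventually_at_within_mem[of "{0..t0}" t0]
    by eventually_elim (use le in \<open>auto intro!: divide_nonpos_nonpos\<close>)
  show "at t0 within {0..t0} \<noteq> bot"
    using t0 by (simp add: at_within_Icc_at_left)
qed

text \<open>At a first touching point the increment minus the barrier is maximal in space, which
  fixes both slopes, and its time derivative is nonnegative. By the equation, transport drives the
  increment at rate at most \<open>3 / 2 * L\<^sup>2\<close> per unit of \<open>d + \<eta>\<close>
  and the nonlocal term at rate \<open>fw_B * L\<close>, apart from weight terms. The barrier rises
  at rate \<open>(2 + fw_B) * L\<^sup>2\<close>, which is strictly faster.\<close>

lemma fw_increment_lt_barrier: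
  assumes cl: "fw_classical T U Ux" and T: "0 \<le> T" "(2 + fw_B) * T \<le> 1 / 2"
    and \<eta>: "\<eta> > 0" and \<delta>: "\<delta> > 0" and K: "K = 3 + 3 * M + 4 * fw_C"
    and M: "M \<ge> 0" "\<And>t x. t \<in> {0..T} \<Longrightarrow> \<bar>U t x\<bar> \<le> M"
    and lip0: "\<And>x y. \<bar>U 0 y - U 0 x\<bar> \<le> \<bar>y - x\<bar>"
    and t: "t \<in> {0..T}"
  shows "U t y - U t x < barrier (2 + fw_B) \<eta> \<delta> K t x y"
proof (rule ccontr)
  define a where "a = 2 + fw_B"
  have a: "a \<ge> 2" using fw_B_nonneg by (simp add: a_def)
  have K0: "K \<ge> 0" using M(1) fw_C_nonneg by (simp add: K)
  assume "\<not> ?thesis"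
  then have viol: "U t y - U t x \<ge> barrier a \<eta> \<delta> K t x y" by (simp add: a_def)
  have aT: "a * T < 1" "0 \<le> a" using T a by (simp_all add: a_def)
  obtain t0 x0 y0 where t0: "t0 \<in> {0<..T}" and eq: "U t0 y0 - U t0 x0 = barrier a \<eta> \<delta> K t0 x0 y0"
    and glob: "\<And>x y. U t0 y - U t0 x \<le> barrier a \<eta> \<delta> K t0 x y"
    and before: "\<And>t. t \<in> {0..<t0} \<Longrightarrow> U t y0 - U t x0 < barrier a \<eta> \<delta> K t x0 y0"
    by (rule first_touching[OF cl T(1) aT \<eta> \<delta> K0 lip0 t viol]) (rule that)
  have t0': "t0 \<in> {0..T}" using t0 by simp
  define L where "L = 1 / (1 - a * t0)"
  define E where "E = \<delta> * exp (K * t0)"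
  define w where "w = 1 + x0\<^sup>2 + y0\<^sup>2"
  define d where "d = \<bar>y0 - x0\<bar>"
  define s where "s = sgn (y0 - x0)"
  have "a * t0 \<le> a * T" by (rule mult_left_mono) (use t0 a in auto)
  \<comment> \<open>This keeps the Riccati solution \<open>L\<close> between 1 and 2, away from its
    blow-up.\<close>
  then have at: "0 \<le> a * t0" "a * t0 \<le> 1 / 2" using a t0 T(2)[folded a_def] by (simp, linarith)
  have L: "1 \<le> L" "L \<le> 2" using at by (simp_all add: L_def field_simps)
  have E0: "E > 0" using \<delta> by (simp add: E_def)
  have w1: "w \<ge> 1" by (simp add: w_def)
  have W: "barrier a \<eta> \<delta> K t0 x y = L * (\<bar>y - x\<bar> + \<eta>) + E * (1 + x\<^sup>2 + y\<^sup>2)" for x y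
    by (simp add: barrier_def L_def E_def)
  have P: "U t0 y0 - U t0 x0 = L * (d + \<eta>) + E * w" using eq by (simp add: W d_def w_def)
  have Ppos: "L * (d + \<eta>) > 0" "E * w > 0" using L \<eta> E0 w1 by (simp_all add: d_def)
  have ne: "x0 \<noteq> y0" using P Ppos by auto
  have s: "\<bar>s\<bar> = 1" "d > 0" using ne by (auto simp: s_def d_def sgn_if)
  \<comment> \<open>Off the diagonal the distance is locally linear with slope \<open>s\<close>, so
    the barrier can be differentiated at the touching point.\<close>
  have abs1: "\<bar>y - x0\<bar> = s * (y - x0)" if "\<bar>y0 - y\<bar> < d" for y
    using that ne by (auto simp: s_def d_def sgn_if abs_if split: if_splits)
  have abs2: "\<bar>y0 - x\<bar> = s * (y0 - x)" if "\<bar>x0 - x\<bar> < d" for x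
    using that ne by (auto simp: s_def d_def sgn_if abs_if split: if_splits)
  note der = fw_classicalD(1)[OF cl t0']
  have Uy: "Ux t0 y0 = L * s + 2 * E * y0"
  proof -
    have "((\<lambda>y. U t0 y - U t0 x0 - (L * (s * (y - x0) + \<eta>) + E * (1 + x0\<^sup>2 + y\<^sup>2))) has_real_derivative Ux t0 y0 - (L * s + 2 * E * y0)) (at y0)"
      by (auto intro!: derivative_eq_intros der)
    then have "Ux t0 y0 - (L * s + 2 * E * y0) = 0"
    proof (rule DERIV_local_max[OF _ s(2)])
      show "\<forall>y. \<bar>y0 - y\<bar> < d \<longrightarrow> U t0 y - U t0 x0 - (L * (s * (y - x0) + \<eta>) + E * (1 + x0\<^sup>2 + y\<^sup>2))
          \<le> U t0 y0 - U t0 x0 - (L * (s * (y0 - x0) + \<eta>) + E * (1 + x0\<^sup>2 + y0\<^sup>2))"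
      proof (intro allI impI)
        fix y assume y: "\<bar>y0 - y\<bar> < d"
        show "U t0 y - U t0 x0 - (L * (s * (y - x0) + \<eta>) + E * (1 + x0\<^sup>2 + y\<^sup>2))
          \<le> U t0 y0 - U t0 x0 - (L * (s * (y0 - x0) + \<eta>) + E * (1 + x0\<^sup>2 + y0\<^sup>2))"
          using glob[where x=x0 and y=y] eq abs1[OF y] abs1[of y0] s(2) unfolding W by simp
      qed
    qed
    then show ?thesis by simp
  qed
  have Ux0: "Ux t0 x0 = L * s - 2 * E * x0"
  proof -
    have "((\<lambda>x. U t0 y0 - U t0 x - (L * (s * (y0 - x) + \<eta>) + E * (1 + x\<^sup>2 + y0\<^sup>2))) has_real_derivative (- Ux t0 x0 + L * s - 2 * E * x0)) (at x0)"
      by (auto intro!: derivative_eq_intros der)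
    then have "- Ux t0 x0 + L * s - 2 * E * x0 = 0"
    proof (rule DERIV_local_max[OF _ s(2)])
      show "\<forall>x. \<bar>x0 - x\<bar> < d \<longrightarrow> U t0 y0 - U t0 x - (L * (s * (y0 - x) + \<eta>) + E * (1 + x\<^sup>2 + y0\<^sup>2))
          \<le> U t0 y0 - U t0 x0 - (L * (s * (y0 - x0) + \<eta>) + E * (1 + x0\<^sup>2 + y0\<^sup>2))"
      proof (intro allI impI)
        fix x assume x: "\<bar>x0 - x\<bar> < d"
        show "U t0 y0 - U t0 x - (L * (s * (y0 - x) + \<eta>) + E * (1 + x\<^sup>2 + y0\<^sup>2))
          \<le> U t0 y0 - U t0 x0 - (L * (s * (y0 - x0) + \<eta>) + E * (1 + x0\<^sup>2 + y0\<^sup>2))"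
          using glob[where x=x and y=y0] eq abs2[OF x] abs2[of x0] s(2) unfolding W by simp
      qed
    qed
    then show ?thesis by simp
  qed
  define V where "V z = fw_force (U t0) z - 3 / 2 * U t0 z * Ux t0 z" for z
  have time: "V y0 - V x0 - (a * L\<^sup>2 * (d + \<eta>) + K * E * w) \<ge> 0"
  proof (rule DERIV_within_nonneg_of_left_max[OF _ t0])
    have dV: "((\<lambda>t. U t z) has_real_derivative V z) (at t0 within {0..T})" for z
      unfolding V_def by (rule fw_classical_time_derivative[OF cl t0'])
    have den: "1 - a * t0 \<noteq> 0" using at by auto
    show "((\<lambda>t. U t y0 - U t x0 - barrier a \<eta> \<delta> K t x0 y0) has_real_derivative
        V y0 - V x0 - (a * L\<^sup>2 * (d + \<eta>) + K * E * w)) (at t0 within {0..T})"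
      unfolding barrier_def
      by (rule derivative_eq_intros dV refl den)+
        (simp add: L_def E_def w_def d_def power2_eq_square)
    show "U t y0 - U t x0 - barrier a \<eta> \<delta> K t x0 y0 \<le> U t0 y0 - U t0 x0 - barrier a \<eta> \<delta> K t0 x0 y0"
      if "t \<in> {0..<t0}" for t using before[OF that] eq by simp
  qed
  have F: "fw_force (U t0) y0 - fw_force (U t0) x0 \<le> fw_B * (L * (d + \<eta>)) + E * (4 * fw_C * w)"
  proof -
    \<comment> \<open>A common shift by \<open>z\<close> preserves the distance \<open>d\<close>, so
      global maximality bounds the shifted increments with the same first term; exchanging the two
      points gives the absolute value.\<close>
    have inc: "\<bar>U t0 (y0 - z) - U t0 (x0 - z)\<bar> \<le> L * (d + \<eta>) + E * (1 + (x0 - z)\<^sup>2 + (y0 - z)\<^sup>2)" for z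
      using glob[where x="x0 - z" and y="y0 - z"] glob[where x="y0 - z" and y="x0 - z"]
      unfolding W d_def by (simp add: abs_le_iff abs_minus_commute algebra_simps)
    have "\<bar>fw_force (U t0) y0 - fw_force (U t0) x0\<bar> \<le> fw_B * (L * (d + \<eta>)) + E * (4 * fw_C * (1 + x0\<^sup>2 + y0\<^sup>2))"
      by (rule fw_force_increment[OF fw_classicalD(4)[OF cl t0'] M(2)[OF t0'] inc]) (use E0 in simp)
    then show ?thesis by (simp add: w_def)
  qed
  have N: "- (3 / 2) * (U t0 y0 * Ux t0 y0 - U t0 x0 * Ux t0 x0) \<le> 3 / 2 * L * (L * (d + \<eta>) + E * w) + 3 * M * E * w"
  proof -
    have "- (3 / 2) * (U t0 y0 * Ux t0 y0 - U t0 x0 * Ux t0 x0)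
       = - (3 / 2) * L * s * (U t0 y0 - U t0 x0) + 3 * E * (- (U t0 y0 * y0) - U t0 x0 * x0)"
      unfolding Uy Ux0 by (simp add: field_simps)
    also have "\<dots> = 3 / 2 * L * (- s * (L * (d + \<eta>) + E * w)) + 3 * E * (- (U t0 y0 * y0) - U t0 x0 * x0)"
      unfolding P by simp
    \<comment> \<open>For \<open>s = 1\<close> the transport term is favourable; the bound
      \<open>- s \<le> 1\<close> gives this up so that both orders of the points are treated at
      once.\<close>
    also have "\<dots> \<le> 3 / 2 * L * (1 * (L * (d + \<eta>) + E * w)) + 3 * E * (M * w)"
    proof (intro add_mono mult_left_mono mult_right_mono)
      have "\<bar>U t0 z * z\<bar> \<le> M * \<bar>z\<bar>" for z
        unfolding abs_mult by (rule mult_right_mono[OF M(2)[OF t0']]) simp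
      then have 1: "- (U t0 y0 * y0) - U t0 x0 * x0 \<le> M * \<bar>y0\<bar> + M * \<bar>x0\<bar>"
        by (smt (verit))
      have "\<bar>x0\<bar> + \<bar>y0\<bar> \<le> w"
        using zero_le_power2[of "\<bar>x0\<bar> - 1"] zero_le_power2[of "\<bar>y0\<bar> - 1"] unfolding w_def
        by (simp add: power2_diff) (smt (verit) zero_le_power2)
      then have "M * (\<bar>x0\<bar> + \<bar>y0\<bar>) \<le> M * w" using M(1) by (rule mult_left_mono)
      then show "- (U t0 y0 * y0) - U t0 x0 * x0 \<le> M * w" using 1 by (simp add: distrib_left)
      show "- s \<le> 1" using s(1) by linarith
    qed (use L E0 Ppos in auto)
    finally show ?thesis by (simp add: algebra_simps)
  qed
  have sum: "0 \<le> 3 / 2 * L * (L * (d + \<eta>) + E * w) + 3 * M * E * w + (fw_B * (L * (d + \<eta>)) + E * (4 * fw_C * w))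
     - (a * L\<^sup>2 * (d + \<eta>) + K * E * w)"
  proof -
    have "V y0 - V x0 = (fw_force (U t0) y0 - fw_force (U t0) x0) + - (3 / 2) * (U t0 y0 * Ux t0 y0 - U t0 x0 * Ux t0 x0)"
      unfolding V_def by (simp add: field_simps)
    with time F N show ?thesis by linarith
  qed
  \<comment> \<open>The constant \<open>K\<close> absorbs the weight terms: 3 for the weight in the
    touching value, by \<open>L \<le> 2\<close>, then \<open>3 * M\<close> for the slopes of the
    weight and \<open>4 * fw_C\<close> for the nonlocal term. What is left is at most
    \<open>- (1 / 2) * L\<^sup>2 * (d + \<eta>)\<close>, which is negative.\<close>
  have "fw_B * (L * (d + \<eta>)) \<le> fw_B * (L\<^sup>2 * (d + \<eta>))"
    using L fw_B_nonneg \<eta> s(2) by (intro mult_left_mono mult_right_mono) (auto simp: power2_eq_square)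
  moreover have "3 / 2 * L * (E * w) \<le> 3 * (E * w)"
    using L Ppos(2) by (intro mult_right_mono) auto
  moreover have "a * L\<^sup>2 * (d + \<eta>) = 2 * (L\<^sup>2 * (d + \<eta>)) + fw_B * (L\<^sup>2 * (d + \<eta>))" by (simp add: a_def algebra_simps)
  moreover have "3 / 2 * L * (L * (d + \<eta>) + E * w) = 3 / 2 * (L\<^sup>2 * (d + \<eta>)) + 3 / 2 * L * (E * w)"
    by (simp add: power2_eq_square algebra_simps)
  moreover have "K * E * w = 3 * (E * w) + 3 * M * E * w + E * (4 * fw_C * w)" by (simp add: K algebra_simps)
  moreover have "L\<^sup>2 * (d + \<eta>) > 0" using L \<eta> s(2) by simp
  ultimately show False using sum by linarith
qed

text \<open>Letting \<open>\<eta>\<close> and \<open>\<delta>\<close> tend to 0 leaves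
  \<open>L * \<bar>y - x\<bar>\<close> with \<open>L \<le> 2\<close>. The unknown bound
  \<open>M\<close> enters only through \<open>K\<close>, hence only through the weight that
  disappears in the limit.\<close>

theorem fw_classical_Lipschitz:
  assumes cl: "fw_classical T U Ux" and T: "0 \<le> T" "(2 + fw_B) * T \<le> 1 / 2"
    and lip0: "\<And>x y. \<bar>U 0 y - U 0 x\<bar> \<le> \<bar>y - x\<bar>" and t: "t \<in> {0..T}"
  shows "\<bar>U t y - U t x\<bar> \<le> 2 * \<bar>y - x\<bar>"
proof -
  obtain M where M: "M \<ge> 0" "\<And>t x. t \<in> {0..T} \<Longrightarrow> \<bar>U t x\<bar> \<le> M" using fw_classical_bounded[OF cl] by blast
  define K where "K = 3 + 3 * M + 4 * fw_C"
  define L where "L = 1 / (1 - (2 + fw_B) * t)"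
  have "(2 + fw_B) * t \<le> (2 + fw_B) * T" by (rule mult_left_mono) (use t fw_B_nonneg in auto)
  then have at: "0 \<le> (2 + fw_B) * t" "(2 + fw_B) * t \<le> 1 / 2"
    using fw_B_nonneg t T(2) by (simp, linarith)
  have L: "1 \<le> L" "L \<le> 2" using at by (simp_all add: L_def field_simps)
  have "U t y - U t x \<le> 2 * \<bar>y - x\<bar>" for x y
  proof (rule field_le_epsilon)
    fix e :: real assume e: "e > 0"
    define \<eta> where "\<eta> = e / (2 * L)"
    define A where "A = exp (K * t) * (1 + x\<^sup>2 + y\<^sup>2)"
    have A: "A > 0" unfolding A_def by (intro mult_pos_pos) (simp_all add: add_pos_nonneg)
    define \<delta> where "\<delta> = e / (2 * A)"
    have pos: "\<eta> > 0" "\<delta> > 0" using e L A by (simp_all add: \<eta>_def \<delta>_def)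
    have "U t y - U t x < barrier (2 + fw_B) \<eta> \<delta> K t x y"
      by (rule fw_increment_lt_barrier[OF cl T pos K_def M lip0 t])
    also have "\<dots> = L * \<bar>y - x\<bar> + L * \<eta> + \<delta> * A"
      by (simp add: barrier_def L_def A_def algebra_simps add_divide_distrib)
    also have "\<dots> = L * \<bar>y - x\<bar> + e" using L A by (simp add: \<eta>_def \<delta>_def)
    also have "\<dots> \<le> 2 * \<bar>y - x\<bar> + e" using L by (intro add_right_mono mult_right_mono) auto
    finally show "U t y - U t x \<le> 2 * \<bar>y - x\<bar> + e" by simp
  qed
  from this[of y x] this[of x y] show ?thesis by (simp add: abs_le_iff abs_minus_commute)
qed

section \<open>Divergence of two solutions\<close>

lemma DERIV_bound_of_Lipschitz:
  fixes f :: "real \<Rightarrow> real"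
  assumes d: "(f has_real_derivative D) (at x)" and l: "\<And>y. \<bar>f y - f x\<bar> \<le> C * \<bar>y - x\<bar>"
  shows "\<bar>D\<bar> \<le> C"
proof (rule tendsto_upperbound)
  show "((\<lambda>y. \<bar>(f y - f x) / (y - x)\<bar>) \<longlongrightarrow> \<bar>D\<bar>) (at x)"
    using d unfolding has_field_derivative_iff by (rule tendsto_rabs)
  show "\<forall>\<^sub>F y in at x. \<bar>(f y - f x) / (y - x)\<bar> \<le> C"
    using l by (auto simp: eventually_at_filter abs_divide pos_divide_le_eq)
qed simp

text \<open>With slopes at most 2 the time derivative is at most \<open>(3 + fw_B) * N\<close>,
  where \<open>N\<close> is the sup over space and time and 3 is \<open>3 / 2 * 2\<close>.
  Integration gives \<open>N \<le> c + N / 2\<close>, which can be solved because \<open>N\<close>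
  is known to be finite.\<close>

lemma fw_classical_near_initial:
  assumes cl: "fw_classical T U Ux" and T: "0 \<le> T" "(3 + fw_B) * T \<le> 1 / 2"
    and lip0: "\<And>x y. \<bar>U 0 y - U 0 x\<bar> \<le> \<bar>y - x\<bar>" and c: "\<And>x. \<bar>U 0 x\<bar> \<le> c" and t: "t \<in> {0..T}"
  shows "\<bar>U t x\<bar> \<le> 2 * c" "\<bar>U t x - U 0 x\<bar> \<le> 2 * (3 + fw_B) * c * t"
proof -
  have T': "(2 + fw_B) * T \<le> 1 / 2" using T by (simp add: algebra_simps)
  obtain M where M: "\<And>t x. t \<in> {0..T} \<Longrightarrow> \<bar>U t x\<bar> \<le> M" using fw_classical_bounded[OF cl] by blast
  define N where "N = (SUP p\<in>{0..T} \<times> UNIV. \<bar>U (fst p) (snd p)\<bar>)"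
  have N: "\<bar>U t x\<bar> \<le> N" if "t \<in> {0..T}" for t x
  proof -
    have "bdd_above ((\<lambda>p. \<bar>U (fst p) (snd p)\<bar>) ` ({0..T} \<times> UNIV))"
      by (rule bdd_aboveI[of _ M]) (use M in auto)
    then show ?thesis unfolding N_def using cSUP_upper[of "(t, x)" "{0..T} \<times> UNIV" "\<lambda>p. \<bar>U (fst p) (snd p)\<bar>"] that by simp
  qed
  have N0: "N \<ge> 0" using order_trans[OF abs_ge_zero N[of 0 0]] T(1) by simp
  have V: "\<bar>fw_force (U t) x - 3 / 2 * U t x * Ux t x\<bar> \<le> (3 + fw_B) * N" if t: "t \<in> {0..T}" for t x
  proof -
    have "\<bar>Ux t x\<bar> \<le> 2"
      by (rule DERIV_bound_of_Lipschitz[OF fw_classicalD(1)[OF cl t] fw_classical_Lipschitz[OF cl T(1) T' lip0 t]])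
    then have "\<bar>U t x * Ux t x\<bar> \<le> N * 2" unfolding abs_mult using N[OF t, of x] N0 by (intro mult_mono) auto
    moreover have "\<bar>fw_force (U t) x\<bar> \<le> fw_B * N"
      unfolding fw_B_def by (rule fw_force_bound[OF fw_classicalD(4)[OF cl t] N[OF t]])
    ultimately show ?thesis by (simp add: abs_le_iff algebra_simps)
  qed
  have inc: "\<bar>U t x - U 0 x\<bar> \<le> (3 + fw_B) * N * t" if t: "t \<in> {0..T}" for t x
  proof -
    have "norm (U t x - U 0 x) \<le> (3 + fw_B) * N * norm (t - 0)"
    proof (rule field_differentiable_bound[where S="{0..T}"])
      show "((\<lambda>t. U t x) has_real_derivative (fw_force (U s) x - 3 / 2 * U s x * Ux s x)) (at s within {0..T})" if "s \<in> {0..T}" for s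
        by (rule fw_classical_time_derivative[OF cl that])
    qed (use V t T(1) in auto)
    then show ?thesis using t by simp
  qed
  have "N \<le> c + N / 2" unfolding N_def
  proof (rule cSUP_least)
    fix p assume p: "p \<in> {0..T} \<times> (UNIV :: real set)"
    then have s: "fst p \<in> {0..T}" by auto
    have "(3 + fw_B) * N * fst p \<le> (3 + fw_B) * N * T"
      using s N0 fw_B_nonneg by (intro mult_left_mono) auto
    also have "\<dots> = ((3 + fw_B) * T) * N" by simp
    also have "\<dots> \<le> 1 / 2 * N" by (rule mult_right_mono[OF T(2) N0])
    finally have "\<bar>U (fst p) (snd p) - U 0 (snd p)\<bar> \<le> N / 2" using inc[OF s, of "snd p"] by linarith
    then have "\<bar>U (fst p) (snd p)\<bar> \<le> c + N / 2" using c[of "snd p"] by linarith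
    then show "\<bar>U (fst p) (snd p)\<bar> \<le> c + (SUP p\<in>{0..T} \<times> UNIV. \<bar>U (fst p) (snd p)\<bar>) / 2" by (simp add: N_def)
  qed (use T in auto)
  then have Nc: "N \<le> 2 * c" by simp
  show "\<bar>U t x\<bar> \<le> 2 * c" using N[OF t, of x] Nc by linarith
  have "(3 + fw_B) * N * t \<le> (3 + fw_B) * (2 * c) * t"
    using Nc t fw_B_nonneg by (intro mult_right_mono mult_left_mono) auto
  then show "\<bar>U t x - U 0 x\<bar> \<le> 2 * (3 + fw_B) * c * t" using inc[OF t, of x] by (simp add: mult_ac)
qed

lemma fw_classical_force_continuous:
  assumes "fw_classical T U Ux" "t \<in> {0..T}" shows "continuous_on UNIV (fw_force (U t))"
proof -
  obtain M N where "\<And>x. \<bar>U t x\<bar> \<le> M" "\<And>x. \<bar>Ux t x\<bar> \<le> N" using fw_classicalD(5,6)[OF assms] by blast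
  then have "continuous_on UNIV (\<lambda>x. Re (complex_of_real (fw_force (U t) x)))"
    using continuous_fw_force[OF fw_classicalD(1,2)[OF assms]] by (intro continuous_intros) auto
  then show ?thesis by simp
qed

text \<open>Uniform convergence of the difference quotients passes to the integral over a bounded
  interval.\<close>

lemma fw_classical_integral_time_derivative:
  assumes cl: "fw_classical T U Ux" and t: "t \<in> {0..T}" and P: "P \<ge> 0"
  shows "((\<lambda>\<tau>. integral {a..a + P} (U \<tau>)) has_real_derivative
     integral {a..a + P} (\<lambda>x. fw_force (U t) x - 3 / 2 * U t x * Ux t x)) (at t within {0..T})"
  unfolding has_field_derivative_iff
proof (rule tendstoI)
  fix e :: real assume e: "e > 0"
  let ?V = "\<lambda>x. fw_force (U t) x - 3 / 2 * U t x * Ux t x"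
  note cf = fw_classical_force_continuous[OF cl t]
  have cV: "continuous_on {a..a + P} ?V"
    by (intro continuous_intros continuous_on_subset[OF cf] continuous_on_subset[OF fw_classicalD(3)[OF cl t]]
        continuous_on_subset[OF fw_classicalD(2)[OF cl t]]) auto
  \<comment> \<open>\<open>P + 1\<close> instead of \<open>P\<close>, because \<open>P\<close> may
    be 0.\<close>
  define e' where "e' = e / (2 * (P + 1))"
  have e': "e' > 0" using e P by (simp add: e'_def)
  have "\<forall>\<^sub>F \<tau> in at t within {0..T}. \<forall>x. \<bar>(U \<tau> x - U t x) / (\<tau> - t) - ?V x\<bar> \<le> e'"
    by (rule fw_classicalD(8)[OF cl t e'])
  then show "\<forall>\<^sub>F \<tau> in at t within {0..T}. dist ((integral {a..a + P} (U \<tau>) - integral {a..a + P} (U t)) / (\<tau> - t)) (integral {a..a + P} ?V) < e"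
    using eventually_at_within_mem[of "{0..T}" t]
  proof eventually_elim
    case (elim \<tau>)
    have \<tau>: "\<tau> \<in> {0..T}" "\<tau> \<noteq> t" using elim by auto
    have i: "U s integrable_on {a..a + P}" if "s \<in> {0..T}" for s
      by (intro integrable_continuous_interval continuous_on_subset[OF fw_classicalD(3)[OF cl that]]) auto
    have iV: "?V integrable_on {a..a + P}" by (rule integrable_continuous_interval[OF cV])
    have iq: "(\<lambda>x. (U \<tau> x - U t x) / (\<tau> - t)) integrable_on {a..a + P}"
      using integrable_diff[OF i[OF \<tau>(1)] i[OF t]] by (rule integrable_on_divide)
    have "(integral {a..a + P} (U \<tau>) - integral {a..a + P} (U t)) / (\<tau> - t) - integral {a..a + P} ?V
       = integral {a..a + P} (\<lambda>x. (U \<tau> x - U t x) / (\<tau> - t) - ?V x)"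
      using i[OF \<tau>(1)] i[OF t] iV iq by (simp add: Henstock_Kurzweil_Integration.integral_diff)
    also have "norm \<dots> \<le> e' * (a + P - a)"
    proof (rule integral_bound)
      show "continuous_on {a..a + P} (\<lambda>x. (U \<tau> x - U t x) / (\<tau> - t) - ?V x)"
        by (intro continuous_intros cV continuous_on_subset[OF fw_classicalD(3)[OF cl t]] continuous_on_subset[OF fw_classicalD(3)[OF cl \<tau>(1)]])
          (use \<tau> in auto)
    qed (use elim P in auto)
    also have "\<dots> < e"
    proof -
      have "e' * P \<le> e' * (P + 1)" using e' by (intro mult_left_mono) auto
      also have "\<dots> = e / 2" using P by (simp add: e'_def field_simps)
      finally show ?thesis using e by simp
    qed
    finally show ?case by (simp add: dist_norm)
  qed
qed

text \<open>The transport term is the derivative of \<open>3 / 4 * (U t x)\<^sup>2\<close>, so it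
  contributes end point values only and no slope.\<close>

lemma fw_classical_integral_flux:
  assumes cl: "fw_classical T U Ux" and t: "t \<in> {0..T}" and P: "P \<ge> 0"
  shows "integral {a..a + P} (\<lambda>x. fw_force (U t) x - 3 / 2 * U t x * Ux t x)
    = integral {a..a + P} (fw_force (U t)) - 3 / 4 * ((U t (a + P))\<^sup>2 - (U t a)\<^sup>2)"
    and "fw_force (U t) integrable_on {a..a + P}"
proof -
  note cf = fw_classical_force_continuous[OF cl t]
  show i: "fw_force (U t) integrable_on {a..a + P}"
    by (intro integrable_continuous_interval continuous_on_subset[OF cf]) auto
  have "((\<lambda>x. 3 / 2 * U t x * Ux t x) has_integral 3 / 4 * (U t (a + P))\<^sup>2 - 3 / 4 * (U t a)\<^sup>2) {a..a + P}"
  proof (rule fundamental_theorem_of_calculus)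
    fix x
    have "((\<lambda>x. 3 / 4 * (U t x)\<^sup>2) has_real_derivative 3 / 2 * U t x * Ux t x) (at x)"
      by (auto intro!: derivative_eq_intros fw_classicalD(1)[OF cl t])
    then show "((\<lambda>x. 3 / 4 * (U t x)\<^sup>2) has_vector_derivative 3 / 2 * U t x * Ux t x) (at x within {a..a + P})"
      by (simp add: has_real_derivative_iff_has_vector_derivative has_vector_derivative_at_within)
  qed (use P in simp)
  from has_integral_diff[OF integrable_integral[OF i] this]
  show "integral {a..a + P} (\<lambda>x. fw_force (U t) x - 3 / 2 * U t x * Ux t x)
    = integral {a..a + P} (fw_force (U t)) - 3 / 4 * ((U t (a + P))\<^sup>2 - (U t a)\<^sup>2)"
    by (simp add: integral_unique right_diff_distrib)
qed

text \<open>Subtracting \<open>c\<close> is free because the kernel integrates to 0, and only the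
  remainder has to be small.\<close>

lemma fw_force_diff_const:
  assumes [measurable]: "v \<in> borel_measurable borel" "w \<in> borel_measurable borel"
    and b: "\<And>x. \<bar>v x\<bar> \<le> M" "\<And>x. \<bar>w x\<bar> \<le> N" and d: "\<And>x. \<bar>v x - w x - c\<bar> \<le> A"
  shows "\<bar>fw_force v x - fw_force w x\<bar> \<le> fw_B * A"
proof -
  have ic: "integrable lborel (\<lambda>z. fw_dkernel z * c)" by (intro integrable_mult_left integrable_fw_dkernel)
  have "fw_force (\<lambda>x. v x - w x - c) x = fw_force v x - fw_force w x - (LINT z|lborel. fw_dkernel z * c)"
    unfolding fw_force_def right_diff_distrib using integrable_fw_dkernel_mult[OF assms(1) b(1)] integrable_fw_dkernel_mult[OF assms(2) b(2)] ic by simp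
  then have "fw_force v x - fw_force w x = fw_force (\<lambda>x. v x - w x - c) x" by (simp add: integral_fw_dkernel)
  then show ?thesis unfolding fw_B_def by (simp add: fw_force_bound[OF _ d])
qed

lemma abs_square_diff_le:
  fixes u v :: real assumes "\<bar>u - v\<bar> \<le> e" "\<bar>u\<bar> \<le> p" "\<bar>v\<bar> \<le> q"
  shows "\<bar>u\<^sup>2 - v\<^sup>2\<bar> \<le> e * (p + q)"
proof -
  have "u\<^sup>2 - v\<^sup>2 = (u - v) * (u + v)" by (simp add: power2_eq_square algebra_simps)
  then have "\<bar>u\<^sup>2 - v\<^sup>2\<bar> = \<bar>u - v\<bar> * \<bar>u + v\<bar>" by (simp add: abs_mult)
  also have "\<dots> \<le> e * (p + q)" using assms by (intro mult_mono) auto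
  finally show ?thesis .
qed

text \<open>The second difference of the flux \<open>v\<^sup>2 - u\<^sup>2\<close> at \<open>0, \<pi>/k, 2\<pi>/k\<close> equals \<open>8 / k\<^sup>2\<close> initially, which drives the functional
  \<open>Z\<close>; the nonlocal term only sees \<open>v - u - 1/k\<close> because its kernel has mean zero.\<close>

theorem fw_classical_divergence:
  assumes cu: "fw_classical T U Ux" and cv: "fw_classical T V Vx" and T: "0 \<le> T" "(30 + 16 * fw_B) * (3 + fw_B) * T \<le> 1"
    and k: "k > 0" and U0: "\<And>x. U 0 x = cos (k * x) / k" and V0: "\<And>x. V 0 x = cos (k * x) / k + 1 / k"
    and t: "t \<in> {0..T}" and D: "\<And>x y. \<bar>(V t x - U t x) - (V t y - U t y)\<bar> \<le> D * \<bar>x - y\<bar>"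
  shows "3 * t / pi\<^sup>2 \<le> D"
proof -
  define B where "B = fw_B"
  have B: "B \<ge> 0" using fw_B_nonneg by (simp add: B_def)
  \<comment> \<open>\<open>\<alpha> * s / k\<close> bounds the drift of \<open>U\<close> from its
    data of size \<open>1 / k\<close>. The data of \<open>V\<close> are bounded by
    \<open>2 / k\<close>, so its drift bound is twice as large.\<close>
  define \<alpha> where "\<alpha> = 2 * (3 + B)"
  have \<alpha>: "\<alpha> \<ge> 0" using B by (simp add: \<alpha>_def)
  \<comment> \<open>\<open>45 + 24 * B\<close> is the error rate found for \<open>Z'\<close> below.
    The threshold on \<open>T\<close> is chosen so that the error takes at most half of the main
    term \<open>6 / k\<^sup>2\<close>.\<close>
  have TB: "(45 + 24 * B) * \<alpha> * s \<le> 3" if "s \<in> {0..T}" for s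
  proof -
    have "(45 + 24 * B) * \<alpha> * s \<le> (45 + 24 * B) * \<alpha> * T" using that B \<alpha> by (intro mult_left_mono) auto
    also have "\<dots> = 3 * ((30 + 16 * B) * (3 + B) * T)" by (simp add: \<alpha>_def algebra_simps)
    also have "\<dots> \<le> 3" using T(2) by (simp add: B_def)
    finally show ?thesis .
  qed
  have T': "(3 + fw_B) * T \<le> 1 / 2"
  proof -
    have "30 * ((3 + fw_B) * T) \<le> (30 + 16 * fw_B) * ((3 + fw_B) * T)"
      using fw_B_nonneg T(1) by (intro mult_right_mono) auto
    then show ?thesis using T(2) by (simp add: mult.assoc)
  qed
  have cosl: "\<bar>cos (k * y) / k - cos (k * x) / k\<bar> \<le> \<bar>y - x\<bar>" for x y
  proof -
    have "norm (cos (k * y) / k - cos (k * x) / k) \<le> 1 * norm (y - x)"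
    proof (rule field_differentiable_bound[where S=UNIV])
      show "((\<lambda>z. cos (k * z) / k) has_real_derivative - sin (k * z)) (at z within UNIV)" for z
        using k by (auto intro!: derivative_eq_intros)
    qed auto
    then show ?thesis by simp
  qed
  have lu: "\<bar>U 0 y - U 0 x\<bar> \<le> \<bar>y - x\<bar>" and lv: "\<bar>V 0 y - V 0 x\<bar> \<le> \<bar>y - x\<bar>" for x y
    using cosl[of y x] by (simp_all add: U0 V0)
  have bu0: "\<bar>U 0 x\<bar> \<le> 1 / k" for x
    unfolding U0 abs_divide using k by (simp add: divide_right_mono)
  have bv0: "\<bar>V 0 x\<bar> \<le> 2 / k" for x
  proof -
    have "\<bar>V 0 x\<bar> \<le> \<bar>U 0 x\<bar> + 1 / k" unfolding U0 V0 using k abs_triangle_ineq[of "cos (k * x) / k" "1 / k"] by simp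
    then show ?thesis using bu0[of x] by simp
  qed
  note NU = fw_classical_near_initial[OF cu T(1) T' lu bu0] and NV = fw_classical_near_initial[OF cv T(1) T' lv bv0]
  have bu: "\<bar>U s x\<bar> \<le> 2 / k" "\<bar>U s x - U 0 x\<bar> \<le> \<alpha> * s / k" if "s \<in> {0..T}" for s x
    using NU[OF that, of x] by (simp_all add: \<alpha>_def B_def)
  have bv: "\<bar>V s x\<bar> \<le> 4 / k" "\<bar>V s x - V 0 x\<bar> \<le> 2 * (\<alpha> * s / k)" if "s \<in> {0..T}" for s x
    using NV[OF that, of x] by (simp_all add: \<alpha>_def B_def mult_ac)
  define P where "P = pi / k"
  have P: "P > 0" using k by (simp add: P_def)
  \<comment> \<open>Subtracting adjacent half periods makes the constant \<open>1 / k\<close>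
    cancel, so \<open>Z\<close> starts at 0, and turns the end point fluxes into a second
    difference.\<close>
  define Z where "Z s = (integral {0..0 + P} (V s) - integral {P..P + P} (V s)) - (integral {0..0 + P} (U s) - integral {P..P + P} (U s))" for s
  define Z' where "Z' s = (integral {0..0 + P} (\<lambda>x. fw_force (V s) x - 3 / 2 * V s x * Vx s x) - integral {P..P + P} (\<lambda>x. fw_force (V s) x - 3 / 2 * V s x * Vx s x))
     - (integral {0..0 + P} (\<lambda>x. fw_force (U s) x - 3 / 2 * U s x * Ux s x) - integral {P..P + P} (\<lambda>x. fw_force (U s) x - 3 / 2 * U s x * Ux s x))" for s
  have dZ: "(Z has_real_derivative Z' s) (at s within {0..T})" if s: "s \<in> {0..T}" for s
    unfolding Z_def[abs_def] Z'_def
    by (intro DERIV_diff fw_classical_integral_time_derivative[OF cu s] fw_classical_integral_time_derivative[OF cv s] less_imp_le[OF P])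
  have Z'_ge: "Z' s \<ge> 3 / k\<^sup>2" if s: "s \<in> {0..T}" for s
  proof -
    define Q where "Q x = (V s x)\<^sup>2 - (U s x)\<^sup>2" for x
    define Q0 where "Q0 x = (V 0 x)\<^sup>2 - (U 0 x)\<^sup>2" for x
    define r where "r = \<alpha> * s / k\<^sup>2"
    have s0: "s \<ge> 0" using s by simp
    have r0: "r \<ge> 0" using \<alpha> s0 by (simp add: r_def)
    \<comment> \<open>12 comes from \<open>V\<close> and 3 from \<open>U\<close>, each as the drift
      times the sum of the bounds on the solution and on its data.\<close>
    have QQ: "\<bar>Q x - Q0 x\<bar> \<le> 15 * r" for x
    proof -
      have "\<bar>(V s x)\<^sup>2 - (V 0 x)\<^sup>2\<bar> \<le> 2 * (\<alpha> * s / k) * (4 / k + 2 / k)"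
        by (rule abs_square_diff_le[OF bv(2)[OF s] bv(1)[OF s] bv0])
      moreover have "2 * (\<alpha> * s / k) * (4 / k + 2 / k) = 12 * r" by (simp add: r_def power2_eq_square)
      moreover have "\<bar>(U s x)\<^sup>2 - (U 0 x)\<^sup>2\<bar> \<le> (\<alpha> * s / k) * (2 / k + 1 / k)"
        by (rule abs_square_diff_le[OF bu(2)[OF s] bu(1)[OF s] bu0])
      moreover have "(\<alpha> * s / k) * (2 / k + 1 / k) = 3 * r" by (simp add: r_def power2_eq_square)
      ultimately show ?thesis unfolding Q_def Q0_def by linarith
    qed
    \<comment> \<open>Multiplied by \<open>k\<^sup>2\<close>, the three values are 3, -1 and
      3.\<close>
    have q0: "Q0 0 - 2 * Q0 P + Q0 (P + P) = 8 / k\<^sup>2"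
    proof -
      have "cos (k * P) = -1" "cos (k * (P + P)) = 1" using k by (simp_all add: P_def distrib_left)
      then show ?thesis unfolding Q0_def U0 V0 using k by (simp add: power2_eq_square field_simps)
    qed
    have F: "\<bar>fw_force (V s) x - fw_force (U s) x\<bar> \<le> B * (3 * (\<alpha> * s / k))" for x
      unfolding B_def
    proof (rule fw_force_diff_const[OF fw_classicalD(4)[OF cv s] fw_classicalD(4)[OF cu s] bv(1)[OF s] bu(1)[OF s]])
      show "\<bar>V s x - U s x - 1 / k\<bar> \<le> 3 * (\<alpha> * s / k)" for x
        using bu(2)[OF s, of x] bv(2)[OF s, of x] unfolding U0 V0 by linarith
    qed
    have G: "\<bar>integral {a..a + P} (fw_force (V s)) - integral {a..a + P} (fw_force (U s))\<bar> \<le> 12 * B * r" for a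
    proof -
      note iV = fw_classical_integral_flux(2)[OF cv s less_imp_le[OF P], of a]
      note iU = fw_classical_integral_flux(2)[OF cu s less_imp_le[OF P], of a]
      have "norm (integral {a..a + P} (\<lambda>x. fw_force (V s) x - fw_force (U s) x)) \<le> integral {a..a + P} (\<lambda>x. B * (3 * (\<alpha> * s / k)))"
        by (rule integral_norm_bound_integral[OF integrable_diff[OF iV iU]]) (use F in auto)
      also have "\<dots> = B * (3 * (\<alpha> * s / k)) * P" using P by (simp add: mult.commute)
      also have "\<dots> = 3 * pi * B * r" by (simp add: r_def P_def power2_eq_square)
      \<comment> \<open>The length \<open>pi / k\<close> of the half period brings in
        \<open>pi\<close>, which is rounded up to 4.\<close>
      also have "\<dots> \<le> 12 * B * r" using pi_less_4 B r0 by (intro mult_right_mono) auto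
      finally show ?thesis using Henstock_Kurzweil_Integration.integral_diff[OF iV iU] by simp
    qed
    have "Z' s = 3 / 4 * (Q 0 - 2 * Q P + Q (P + P))
      + (integral {0..0 + P} (fw_force (V s)) - integral {0..0 + P} (fw_force (U s)))
      - (integral {P..P + P} (fw_force (V s)) - integral {P..P + P} (fw_force (U s)))"
      unfolding Z'_def fw_classical_integral_flux(1)[OF cv s less_imp_le[OF P]] fw_classical_integral_flux(1)[OF cu s less_imp_le[OF P]]
      by (simp add: Q_def field_simps)
    \<comment> \<open>60 is 15 times \<open>1 + 2 + 1\<close>, the absolute weights of the second
      difference.\<close>
    moreover have "8 / k\<^sup>2 - 60 * r \<le> Q 0 - 2 * Q P + Q (P + P)"
      using QQ[of 0, THEN abs_le_D2] QQ[of P, THEN abs_le_D1] QQ[of "P + P", THEN abs_le_D2] q0 by linarith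
    moreover have "3 / 4 * p - (c + c) \<le> z" if "z = 3 / 4 * q + a - b" "p \<le> q" "- a \<le> c" "b \<le> c" for z q a b c p :: real
      using that by simp
    ultimately have "Z' s \<ge> 3 / 4 * (8 / k\<^sup>2 - 60 * r) - (12 * B * r + 12 * B * r)"
      using G[of 0, THEN abs_le_D2] G[of P, THEN abs_le_D1] by blast
    then have "Z' s \<ge> 3 / 4 * (8 / k\<^sup>2 - 60 * r) - 24 * B * r" by (simp add: algebra_simps)
    also have "3 / 4 * (8 / k\<^sup>2 - 60 * r) - 24 * B * r = 6 / k\<^sup>2 - (45 + 24 * B) * r" by (simp add: algebra_simps)
    also have "(45 + 24 * B) * r = ((45 + 24 * B) * \<alpha> * s) / k\<^sup>2" by (simp add: r_def)
    finally have "Z' s \<ge> 6 / k\<^sup>2 - ((45 + 24 * B) * \<alpha> * s) / k\<^sup>2" .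
    moreover have "((45 + 24 * B) * \<alpha> * s) / k\<^sup>2 \<le> 3 / k\<^sup>2" by (rule divide_right_mono[OF TB[OF s]]) simp
    moreover have "6 / k\<^sup>2 = 3 / k\<^sup>2 + 3 / k\<^sup>2" by simp
    ultimately show ?thesis by linarith
  qed
  have iUV: "U s integrable_on {a..b}" "V s integrable_on {a..b}" if "s \<in> {0..T}" for s a b
    by (intro integrable_continuous_interval continuous_on_subset[OF fw_classicalD(3)[OF cu that]] continuous_on_subset[OF fw_classicalD(3)[OF cv that]]; simp)+
  have "Z 0 = 0"
  proof -
    have I: "integral {a..a + P} (V 0) = integral {a..a + P} (U 0) + P / k" for a
    proof -
      have "integral {a..a + P} (V 0) = integral {a..a + P} (\<lambda>x. U 0 x + 1 / k)"
        by (rule Henstock_Kurzweil_Integration.integral_cong) (simp add: U0 V0)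
      also have "\<dots> = integral {a..a + P} (U 0) + integral {a..a + P} (\<lambda>x. 1 / k)"
        by (rule Henstock_Kurzweil_Integration.integral_add) (use iUV(1)[of 0] T(1) in auto)
      finally show ?thesis using P by simp
    qed
    show ?thesis unfolding Z_def I[of 0] I[of P] by simp
  qed
  moreover have "Z 0 - 3 / k\<^sup>2 * 0 \<le> Z t - 3 / k\<^sup>2 * t"
  proof (rule DERIV_nonneg_imp_increasing_open[where f="\<lambda>s. Z s - 3 / k\<^sup>2 * s"])
    show "0 \<le> t" using t by simp
    show "\<exists>y. ((\<lambda>s. Z s - 3 / k\<^sup>2 * s) has_real_derivative y) (at s) \<and> 0 \<le> y" if "0 < s" "s < t" for s
    proof -
      have s: "s \<in> {0..T}" using that t by simp
      have "(Z has_real_derivative Z' s) (at s)"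
        using dZ[OF s] at_within_Icc_at[of 0 s T] that t by simp
      then have "((\<lambda>s. Z s - 3 / k\<^sup>2 * s) has_real_derivative Z' s - 3 / k\<^sup>2) (at s)"
        by (rule DERIV_diff[OF _ DERIV_cmult_Id])
      then show ?thesis using Z'_ge[OF s] by (intro exI[of _ "Z' s - 3 / k\<^sup>2"]) simp
    qed
    have "continuous_on {0..T} Z" using dZ by (rule DERIV_continuous_on)
    then have "continuous_on {0..t} Z" by (rule continuous_on_subset) (use t in auto)
    then show "continuous_on {0..t} (\<lambda>s. Z s - 3 / k\<^sup>2 * s)" by (intro continuous_intros)
  qed
  ultimately have Zt: "3 * t / k\<^sup>2 \<le> Z t" by simp
  \<comment> \<open>Each \<open>x\<close> is paired with \<open>x + P\<close>: one factor
    \<open>P\<close> is the distance within a pair, the other the length of the interval. Since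
    \<open>P\<close> is \<open>pi / k\<close>, the powers of \<open>k\<close> cancel against those
    in the lower bound.\<close>
  have "Z t \<le> D * P * P"
  proof -
    have sh: "integral {P..P + P} f = integral {0..0 + P} (\<lambda>x. f (x + P))" for f :: "real \<Rightarrow> real"
      using integral_shift_cbox_plus[of 0 P f P] by (simp add: comp_def add.commute)
    have ct: "continuous_on A (\<lambda>x. w (x + P))" if "continuous_on UNIV w" for w :: "real \<Rightarrow> real" and A
      by (rule continuous_on_compose2[OF that]) (auto intro!: continuous_intros)
    note cU = fw_classicalD(3)[OF cu t] and cV = fw_classicalD(3)[OF cv t]
    note i = iUV[OF t, of 0 "0 + P"] integrable_continuous_interval[OF ct[OF cU]] integrable_continuous_interval[OF ct[OF cV]]
    have "Z t = integral {0..0 + P} (\<lambda>x. (V t x - V t (x + P)) - (U t x - U t (x + P)))"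
      unfolding Z_def sh using i by (simp add: Henstock_Kurzweil_Integration.integral_diff integrable_diff)
    also have "\<dots> \<le> integral {0..0 + P} (\<lambda>x. D * P)"
    proof (rule integral_le)
      show "(\<lambda>x. (V t x - V t (x + P)) - (U t x - U t (x + P))) integrable_on {0..0 + P}"
        by (intro integrable_diff i)
      show "(V t x - V t (x + P)) - (U t x - U t (x + P)) \<le> D * P" for x
        using D[of x "x + P"] P by (simp add: abs_le_iff)
    qed auto
    finally show ?thesis using P by (simp add: mult_ac)
  qed
  with Zt have "3 * t / k\<^sup>2 \<le> D * (pi\<^sup>2 / k\<^sup>2)" by (simp add: P_def power2_eq_square)
  then have "3 * t \<le> D * pi\<^sup>2" using k by (simp add: field_simps)
  then show ?thesis by (simp add: pos_divide_le_eq)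
qed

section \<open>Transfer of the classical estimate to the flow\<close>

lemma fw_flow_eq:
  assumes ex: "fw_existence_time chi phi T U" and u0: "u0 \<in> U" and sol: "fw_solution chi phi T u0 u" and t: "t \<in> {0..T}"
  shows "fw_flow chi phi T t u0 = u t"
  unfolding fw_flow_def
proof (rule the_equality)
  show "\<exists>w. fw_solution chi phi T u0 w \<and> w t = u t" using sol by blast
  fix y assume "\<exists>w. fw_solution chi phi T u0 w \<and> w t = y"
  then obtain w where w: "fw_solution chi phi T u0 w" "w t = y" by blast
  obtain v where v: "\<And>w. fw_solution chi phi T u0 w \<Longrightarrow> \<forall>t\<in>{0..T}. w t = v t"
    using ex u0 unfolding fw_existence_time_def by blast
  show "y = u t" using v[OF w(1)] v[OF sol] w(2) t by metis
qed

context lp_pair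
begin

text \<open>The initial value is attained as a distribution; both representatives being continuous,
  the identity holds at every point.\<close>

lemma solution_initial_value:
  assumes sol: "fw_solution chi phi T u0 u" and T: "T \<ge> 0" and u0: "u0 = regular_distr (\<lambda>x. of_real (h x))"
    and h: "continuous_on UNIV h" "\<And>x. \<bar>h x\<bar> \<le> M"
  obtains U Ux where "fw_classical T U Ux" "\<And>t. t \<in> {0..T} \<Longrightarrow> u t = regular_distr (\<lambda>x. of_real (U t x))" "\<And>x. U 0 x = h x"
proof -
  obtain U Ux where U: "fw_classical T U Ux" "\<And>t. t \<in> {0..T} \<Longrightarrow> u t = regular_distr (\<lambda>x. of_real (U t x))"
    using fw_solution_classical[OF sol] by blast
  have 0: "0 \<in> {0..T}" using T by simp
  obtain N where N: "\<And>x. \<bar>U 0 x\<bar> \<le> N" using fw_classicalD(5)[OF U(1) 0] by blast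
  have c: "continuous_on UNIV (\<lambda>x. complex_of_real (U 0 x))" "continuous_on UNIV (\<lambda>x. complex_of_real (h x))"
    using fw_classicalD(3)[OF U(1) 0] h(1) by (auto intro!: continuous_intros)
  have "u 0 = u0" using sol by (simp add: fw_solution_def)
  then have eq: "regular_distr (\<lambda>x. of_real (U 0 x)) = regular_distr (\<lambda>x. of_real (h x))"
    using U(2)[OF 0] u0 by simp
  have "AE x in lborel. complex_of_real (U 0 x) = of_real (h x)"
    by (rule regular_distr_unique[where M=N and N=M])
      (use N h(2) eq in \<open>auto intro: borel_measurable_continuous_onI c\<close>)
  then have "(\<lambda>x. complex_of_real (U 0 x)) = (\<lambda>x. of_real (h x))" by (rule AE_eq_continuous[OF c])
  then have "U 0 x = h x" for x by (metis of_real_eq_iff)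
  then show thesis using that U by blast
qed

text \<open>The classical estimate is applied on \<open>[0, t]\<close> rather than
  \<open>[0, T]\<close>: the smallness condition concerns \<open>t\<close> alone, while the
  existence time may be long.\<close>

theorem fw_flow_divergence:
  assumes ex: "fw_existence_time chi phi T S"
    and S: "cos_distr (1 / 2 ^ n) (2 ^ n) \<in> S" "cos_distr (1 / 2 ^ n) (2 ^ n) + cos_distr (1 / 2 ^ n) 0 \<in> S"
    and t: "t \<in> {0..T}" "(30 + 16 * fw_B) * (3 + fw_B) * t \<le> 1"
  shows "ennreal (3 / (2 * emb_const * pi\<^sup>2) * t) \<le> besov_norm chi phi 1
    (fw_flow chi phi T t (cos_distr (1 / 2 ^ n) (2 ^ n) + cos_distr (1 / 2 ^ n) 0) - fw_flow chi phi T t (cos_distr (1 / 2 ^ n) (2 ^ n)))"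
proof -
  define k :: real where "k = 2 ^ n"
  have k: "k > 0" by (simp add: k_def)
  let ?f = "cos_distr (1 / 2 ^ n) (2 ^ n)" and ?g = "cos_distr (1 / 2 ^ n) 0"
  have T: "T > 0" using ex by (simp add: fw_existence_time_def)
  obtain u where u: "fw_solution chi phi T ?f u" using ex S(1) unfolding fw_existence_time_def by blast
  obtain v where v: "fw_solution chi phi T (?f + ?g) v" using ex S(2) unfolding fw_existence_time_def by blast
  have fd: "?f = regular_distr (\<lambda>x. of_real (1 / k * cos (k * x)))" by (simp add: cos_distr_def k_def)
  have gd: "?f + ?g = regular_distr (\<lambda>x. of_real (1 / k * cos (k * x) + 1 / k))" by (simp add: cos_distr_add k_def)
  have b1: "\<bar>1 / k * cos (k * x)\<bar> \<le> 1 / k" for x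
    unfolding abs_mult using k by (simp add: divide_right_mono)
  have b2: "\<bar>1 / k * cos (k * x) + 1 / k\<bar> \<le> 1 / k + 1 / k" for x
    using b1[of x] k by (intro order_trans[OF abs_triangle_ineq]) simp
  have h1: "continuous_on UNIV (\<lambda>x. 1 / k * cos (k * x))" and h2: "continuous_on UNIV (\<lambda>x. 1 / k * cos (k * x) + 1 / k)"
    using k by (intro continuous_intros; simp)+
  obtain U Ux where U: "fw_classical T U Ux" "\<And>t. t \<in> {0..T} \<Longrightarrow> u t = regular_distr (\<lambda>x. of_real (U t x))"
      "\<And>x. U 0 x = 1 / k * cos (k * x)"
    by (rule solution_initial_value[OF u less_imp_le[OF T] fd h1 b1]) (rule that)
  obtain V Vx where V: "fw_classical T V Vx" "\<And>t. t \<in> {0..T} \<Longrightarrow> v t = regular_distr (\<lambda>x. of_real (V t x))"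
      "\<And>x. V 0 x = 1 / k * cos (k * x) + 1 / k"
    by (rule solution_initial_value[OF v less_imp_le[OF T] gd h2 b2]) (rule that)
  obtain MU MV where M: "\<And>x. \<bar>U t x\<bar> \<le> MU" "\<And>x. \<bar>V t x\<bar> \<le> MV"
    using fw_classicalD(5)[OF U(1) t(1)] fw_classicalD(5)[OF V(1) t(1)] by blast
  let ?z = "\<lambda>x. complex_of_real (V t x) - of_real (U t x)"
  have cU: "continuous_on UNIV (\<lambda>x. complex_of_real (U t x))" and cV: "continuous_on UNIV (\<lambda>x. complex_of_real (V t x))"
    using fw_classicalD(3)[OF U(1) t(1)] fw_classicalD(3)[OF V(1) t(1)] by (auto intro!: continuous_intros)
  have z: "v t - u t = regular_distr ?z"
    unfolding U(2)[OF t(1)] V(2)[OF t(1)]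
    by (rule regular_distr_diff[where M=MV and N=MU]) (use M in \<open>auto intro: borel_measurable_continuous_onI cU cV\<close>)
  have cz: "continuous_on UNIV ?z" by (intro continuous_intros cU cV)
  have bz: "norm (?z x) \<le> MV + MU" for x
    using M[of x] norm_triangle_ineq4[of "complex_of_real (V t x)" "of_real (U t x)"] by simp
  let ?b = "besov_norm chi phi 1 (v t - u t)"
  have "ennreal (3 / (2 * emb_const * pi\<^sup>2) * t) \<le> ?b"
  proof (cases "?b < \<infinity>")
    case True
    then obtain b where b: "?b = ennreal b" "b \<ge> 0" by (metis ennreal_cases infinity_ennreal_def less_irrefl)
    have e0: "emb_const > 0" using emb_const_ge(1) by simp
    \<comment> \<open>The slope constant \<open>D\<close> of the classical estimate is the one that
      the B^1 norm provides through the embedding.\<close>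
    have "3 * t / pi\<^sup>2 \<le> 2 * emb_const * b"
    proof (rule fw_classical_divergence[where T=t and k=k and U=U and V=V and Ux=Ux and Vx=Vx])
      show "fw_classical t U Ux" "fw_classical t V Vx"
        using fw_classical_mono U(1) V(1) t(1) by auto
      show "\<bar>(V t x - U t x) - (V t y - U t y)\<bar> \<le> 2 * emb_const * b * \<bar>x - y\<bar>" for x y
      proof -
        have "ennreal (norm (?z x - ?z y)) \<le> ennreal (2 * emb_const) * ennreal b * ennreal \<bar>x - y\<bar>"
          using increment_le_besov_1[OF cz bz, of x y] z b(1) by simp
        also have "\<dots> = ennreal (2 * emb_const * b * \<bar>x - y\<bar>)"
          using e0 b(2) by (simp add: ennreal_mult)
        finally have "norm (?z x - ?z y) \<le> 2 * emb_const * b * \<bar>x - y\<bar>"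
          using e0 b(2) by (subst (asm) ennreal_le_iff) auto
        then show ?thesis by (simp flip: of_real_diff)
      qed
    qed (use t k U(3) V(3) in auto)
    then have "3 / (2 * emb_const * pi\<^sup>2) * t \<le> b" using e0 by (simp add: field_simps)
    then show ?thesis unfolding b(1) by (rule ennreal_leI)
  next
    case False
    then have "?b = \<top>" by (simp add: less_top[symmetric])
    then show ?thesis by simp
  qed
  moreover have "fw_flow chi phi T t ?f = u t" "fw_flow chi phi T t (?f + ?g) = v t"
    using fw_flow_eq[OF ex S(1) u t(1)] fw_flow_eq[OF ex S(2) v t(1)] .
  ultimately show ?thesis by simp
qed

end

theorem theorem1p2:
  fixes chi phi :: "real \<Rightarrow> real"
  assumes lp: "littlewood_paley chi phi"
    and wp: "fw_locally_well_posed chi phi"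
  shows "(\<exists>U. besov_bounded chi phi 1 U \<and>
            (\<exists>T. fw_existence_time chi phi T U) \<and>
            (\<forall>T. fw_existence_time chi phi T U \<longrightarrow> \<not> fw_flow_uniformly_continuous_on chi phi T U)) \<and>
         (\<exists>f g :: nat \<Rightarrow> distr.
            (\<forall>n. f n \<in> besov chi phi 1) \<and> (\<forall>n. g n \<in> besov chi phi 1) \<and>
            (SUP n. besov_norm chi phi 1 (f n)) < \<infinity> \<and>
            (\<lambda>n. besov_norm chi phi 1 (g n)) \<longlonglongrightarrow> 0 \<and>
            (\<exists>T. fw_existence_time chi phi T (range f \<union> range (\<lambda>n. f n + g n))) \<and>
            (\<forall>T. fw_existence_time chi phi T (range f \<union> range (\<lambda>n. f n + g n)) \<longrightarrow>
               (\<exists>T0\<in>{0<..T}. \<exists>c>0. \<forall>t\<in>{0..T0}.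
                  ennreal (c * t) \<le>
                  liminf (\<lambda>n. besov_norm chi phi 1
                    (fw_flow chi phi T t (f n + g n) - fw_flow chi phi T t (f n))))))"
proof -
  interpret lp_pair chi phi by standard (rule lp)
  define f where "f n = cos_distr (1 / 2 ^ n) (2 ^ n)" for n
  define g where "g n = cos_distr (1 / 2 ^ n) 0" for n
  \<comment> \<open>All data form one bounded set, so well-posedness gives them a common existence
    time; the same set witnesses the failure of uniform continuity.\<close>
  define S where "S = range f \<union> range (\<lambda>n. f n + g n)"
  have nf: "besov_norm chi phi 1 (f n) \<le> ennreal 2" for n
    using besov_norm_dyadic_le[of "1 / 2 ^ n" n] by (simp add: f_def)
  have ng: "besov_norm chi phi 1 (g n) \<le> ennreal (1 / 2 ^ n)" for n
    using besov_norm_const_le[of "1 / 2 ^ n"] by (simp add: g_def)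
  have fB: "f n \<in> besov chi phi 1" and gB: "g n \<in> besov chi phi 1" for n
    using cos_distr_besov[of "1 / 2 ^ n" "2 ^ n"] cos_distr_besov[of "1 / 2 ^ n" 0] nf[of n] ng[of n] unfolding f_def g_def by blast+
  have fgB: "f n + g n \<in> besov chi phi 1" for n
    using cos_distr_add_besov fB gB unfolding f_def g_def by blast
  have lim: "(\<lambda>n. besov_norm chi phi 1 (g n)) \<longlonglongrightarrow> 0"
  proof (rule tendsto_sandwich[OF _ _ tendsto_const])
    have "(\<lambda>n. ennreal ((1 / 2) ^ n)) \<longlonglongrightarrow> ennreal 0"
      by (intro tendsto_ennrealI LIMSEQ_realpow_zero) auto
    then show "(\<lambda>n. ennreal (1 / 2 ^ n)) \<longlonglongrightarrow> 0" by (simp add: power_divide)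
  qed (use ng in auto)
  have nfg: "besov_norm chi phi 1 (f n + g n) \<le> ennreal 3" for n
  proof -
    have "besov_norm chi phi 1 (f n + g n) \<le> ennreal 2 + ennreal (1 / 2 ^ n)"
      by (rule order_trans[OF besov_norm_triangle add_mono[OF nf ng]])
    also have "\<dots> = ennreal (2 + 1 / 2 ^ n)" by (rule ennreal_plus[symmetric]) auto
    also have "\<dots> \<le> ennreal 3" by (intro ennreal_leI) simp
    finally show ?thesis .
  qed
  have supf: "(SUP n. besov_norm chi phi 1 (f n)) < \<infinity>"
    by (rule le_less_trans[OF SUP_least[OF nf]]) simp
  have bS: "besov_bounded chi phi 1 S" unfolding besov_bounded_def
  proof
    show "S \<subseteq> besov chi phi 1" using fB fgB by (auto simp: S_def)
    have "besov_norm chi phi 1 u \<le> ennreal 3" if "u \<in> S" for u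
      using that nfg nf order_trans[OF nf, of "ennreal 3"] by (auto simp: S_def ennreal_leI)
    then show "(SUP u\<in>S. besov_norm chi phi 1 u) < \<infinity>"
      by (intro le_less_trans[OF SUP_least[where u="ennreal 3"]]) simp_all
  qed
  then have exS: "\<exists>T. fw_existence_time chi phi T S" using wp by (simp add: fw_locally_well_posed_def)
  \<comment> \<open>\<open>1 / A\<close> is the time up to which the divergence estimate is
    available, the same for every \<open>n\<close>; cut off at \<open>T\<close>, it becomes the time
    \<open>T0\<close>.\<close>
  define A where "A = (30 + 16 * fw_B) * (3 + fw_B)"
  have A: "A > 0" using fw_B_nonneg by (simp add: A_def)
  \<comment> \<open>The rate \<open>3 / pi\<^sup>2\<close> at which slopes separate, divided by the
    embedding constant that relates slopes to the norm.\<close>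
  define c where "c = 3 / (2 * emb_const * pi\<^sup>2)"
  have c: "c > 0" using emb_const_ge(1) by (simp add: c_def)
  have key: "ennreal (c * t) \<le> besov_norm chi phi 1 (fw_flow chi phi T t (f n + g n) - fw_flow chi phi T t (f n))"
    if ex: "fw_existence_time chi phi T S" and t: "t \<in> {0..min T (1 / A)}" for T t n
  proof -
    have "A * t \<le> 1" using t A by (simp add: pos_le_divide_eq mult.commute)
    moreover have "f n \<in> S" "f n + g n \<in> S" by (auto simp: S_def)
    ultimately show ?thesis using fw_flow_divergence[OF ex, of n t] t
      unfolding f_def g_def c_def A_def by simp
  qed
  have T0: "min T (1 / A) \<in> {0<..T}" if "fw_existence_time chi phi T S" for T
    using that A by (auto simp: fw_existence_time_def)
  have nuc: "\<not> fw_flow_uniformly_continuous_on chi phi T S" if ex: "fw_existence_time chi phi T S" for T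
  proof
    \<comment> \<open>A single positive time suffices: there the solutions stay \<open>c * t\<close>
      apart for every \<open>n\<close>, while the norms of \<open>g n\<close> tend to 0.\<close>
    define t where "t = min T (1 / A)"
    have t: "t > 0" "t \<in> {0..T}" using T0[OF ex] by (auto simp: t_def)
    assume "fw_flow_uniformly_continuous_on chi phi T S"
    moreover have "c * t > 0" using c t by simp
    ultimately obtain \<delta> where \<delta>: "\<delta> > 0" "\<And>u w. u \<in> S \<Longrightarrow> w \<in> S \<Longrightarrow> besov_norm chi phi 1 (u - w) < ennreal \<delta> \<Longrightarrow>
        (SUP t\<in>{0..T}. besov_norm chi phi 1 (fw_flow chi phi T t u - fw_flow chi phi T t w)) < ennreal (c * t)"
      unfolding fw_flow_uniformly_continuous_on_def by blast
    have "\<forall>\<^sub>F n in sequentially. besov_norm chi phi 1 (g n) < ennreal \<delta>"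
      by (rule order_tendstoD(2)[OF lim]) (use \<delta>(1) in simp)
    then obtain n where n: "besov_norm chi phi 1 (g n) < ennreal \<delta>"
      using eventually_happens'[OF sequentially_bot] by blast
    have "(SUP t\<in>{0..T}. besov_norm chi phi 1 (fw_flow chi phi T t (f n + g n) - fw_flow chi phi T t (f n))) < ennreal (c * t)"
      by (rule \<delta>(2)) (use n in \<open>auto simp: S_def\<close>)
    moreover have "besov_norm chi phi 1 (fw_flow chi phi T t (f n + g n) - fw_flow chi phi T t (f n))
        \<le> (SUP t\<in>{0..T}. besov_norm chi phi 1 (fw_flow chi phi T t (f n + g n) - fw_flow chi phi T t (f n)))"
      by (rule SUP_upper[OF t(2)])
    moreover have "ennreal (c * t) \<le> besov_norm chi phi 1 (fw_flow chi phi T t (f n + g n) - fw_flow chi phi T t (f n))"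
      by (rule key[OF ex]) (use t in \<open>simp add: t_def\<close>)
    ultimately show False by (meson le_less_trans not_le order_trans less_irrefl)
  qed
  have low: "\<exists>T0\<in>{0<..T}. \<exists>c>0. \<forall>t\<in>{0..T0}. ennreal (c * t) \<le>
      liminf (\<lambda>n. besov_norm chi phi 1 (fw_flow chi phi T t (f n + g n) - fw_flow chi phi T t (f n)))"
    if ex: "fw_existence_time chi phi T S" for T
  proof (intro bexI[OF _ T0[OF ex]] exI[of _ c] conjI c ballI)
    fix t assume t: "t \<in> {0..min T (1 / A)}"
    show "ennreal (c * t) \<le> liminf (\<lambda>n. besov_norm chi phi 1 (fw_flow chi phi T t (f n + g n) - fw_flow chi phi T t (f n)))"
      by (intro Liminf_bounded always_eventually allI key[OF ex t])
  qed
  show ?thesis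
  proof
    show "\<exists>U. besov_bounded chi phi 1 U \<and> (\<exists>T. fw_existence_time chi phi T U) \<and>
      (\<forall>T. fw_existence_time chi phi T U \<longrightarrow> \<not> fw_flow_uniformly_continuous_on chi phi T U)"
      using bS exS nuc by blast
    show "\<exists>f g :: nat \<Rightarrow> distr.
            (\<forall>n. f n \<in> besov chi phi 1) \<and> (\<forall>n. g n \<in> besov chi phi 1) \<and>
            (SUP n. besov_norm chi phi 1 (f n)) < \<infinity> \<and>
            (\<lambda>n. besov_norm chi phi 1 (g n)) \<longlonglongrightarrow> 0 \<and>
            (\<exists>T. fw_existence_time chi phi T (range f \<union> range (\<lambda>n. f n + g n))) \<and>
            (\<forall>T. fw_existence_time chi phi T (range f \<union> range (\<lambda>n. f n + g n)) \<longrightarrow>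
               (\<exists>T0\<in>{0<..T}. \<exists>c>0. \<forall>t\<in>{0..T0}.
                  ennreal (c * t) \<le>
                  liminf (\<lambda>n. besov_norm chi phi 1
                    (fw_flow chi phi T t (f n + g n) - fw_flow chi phi T t (f n)))))"
      by (intro exI[of _ f] exI[of _ g] conjI allI impI fB gB supf lim exS[unfolded S_def] low[unfolded S_def])
  qed
qed

end
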